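(* Let $A=\bigoplus_{i\geq0}A_i$ be a positively graded algebra over a field $K$, generated in degrees $0,1$, with $A_0$ semisimple. Let $(\mathcal{S},\mathcal{U})$ be a right modular pair of subsets of $\mathbf{Z}$ and let $X\in Gr_{A_{\mathcal{U}}}$ be generated in degrees belonging to $(\mathcal{S}:\mathcal{U})$. The following assertions are equivalent: (1) $X$ is liftable with respect to the functor $(-)_{\mathcal{S}}:Gr_A\to Gr_{A_{\mathcal{U}}}$. (2) $\mathrm{Ker}(\mu_{m,u})A_{v-u}\subseteq\mathrm{Ker}(\mu_{m,v})$ whenever $(m,u,v)\in(\mathcal{S}:\mathcal{U})\times\mathcal{U}\times\mathcal{U}$ is a triple such that $0\leq u<v$ and $v-u\notin\mathcal{U}$.
   Context: Algebras are associative with unit, modules are right modules, $Gr$ denotes categories of $\mathbf{Z}$-graded right modules with degree-preserving morphisms; $A$ is viewed as $\mathbf{Z}$-graded with $A_i=0$ for $i<0$. $(\mathcal{S}:\mathcal{U})=\{m\in\mathbf{Z}:m+\mathcal{U}=\mathcal{S}\}$. $\mathcal{U}\subseteq\mathbf{Z}$ is ring-supporting if $0\in\mathcal{U}$ and whenever $u,v,w,u+v+w\in\mathcal{U}$, $u+v\in\mathcal{U}\iff v+w\in\mathcal{U}$. A pair $(\mathcal{S},\mathcal{U})$ of nonempty subsets of $\mathbf{Z}$ is right modular if $\mathcal{U}$ is ring-supporting and for all $(s,u,v)\in\mathcal{S}\times\mathcal{U}\times\mathcal{U}$ with $s+u+v\in\mathcal{S}$, $s+u\in\mathcal{S}\iff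 u+v\in\mathcal{U}$. $A_{\mathcal{U}}=\bigoplus_{u\in\mathcal{U}}A_u$ is the graded algebra with multiplication of nonzero homogeneous elements $a\cdot b=ab$ if $\deg(a)+\deg(b)\in\mathcal{U}$, and $0$ otherwise. $(-)_{\mathcal{S}}:Gr_A\to Gr_{A_{\mathcal{U}}}$ sends $M$ to $M_{\mathcal{S}}=\bigoplus_{s\in\mathcal{S}}M_s$ with, for nonzero homogeneous $x\in M_{\mathcal S}$ and $a\in A_{\mathcal U}$, $x\cdot a=xa$ if $\deg(x)+\deg(a)\in\mathcal{S}$ and $0$ otherwise. $X$ is liftable if it is isomorphic in $Gr_{A_{\mathcal{U}}}$ to $M_{\mathcal{S}}$ for some $M\in Gr_A$. $X$ is generated in degrees belonging to $\mathcal{X}$ if it is generated by its homogeneous elements with degree in $\mathcal{X}$. $\otimes$ means $\otimes_{A_0}$. For $X\in Gr_{A_{\mathcal{U}}}$ with support in $\mathcal{S}$, $\mu_{s,u}:X_s\otimes A_u\to X_{s+u}$ is the multiplication map, for $(s,u)\in\mathcal{S}\times\mathcal{U}$ with $s+u\in\mathcal{S}$. Since $X\otimes A$ is a graded right $A$-module, $\mathrm{Ker}(\mu_{s,u})A_i$ is an $A_0$-submodule of $X_s\otimes A_{u+i}$ for $i\geq0$. *)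

theory Defs
  imports "HOL-Algebra.Module" "HOL-Algebra.Generated_Rings" "HOL-Algebra.Free_Abelian_Groups"
begin

section \<open>Semisimple rings\<close>

definition right_ideal :: "'a set \<Rightarrow> ('a, 'p) ring_scheme \<Rightarrow> bool" where
  "right_ideal I R \<longleftrightarrow> additive_subgroup I R \<and> (\<forall>x\<in>I. \<forall>r\<in>carrier R. x \<otimes>\<^bsub>R\<^esub> r \<in> I)"

definition minimal_right_ideal :: "'a set \<Rightarrow> ('a, 'p) ring_scheme \<Rightarrow> bool" where
  "minimal_right_ideal I R \<longleftrightarrow> right_ideal I R \<and> I \<noteq> {\<zero>\<^bsub>R\<^esub>} \<and>
     (\<forall>J. right_ideal J R \<and> J \<subseteq> I \<longrightarrow> J = {\<zero>\<^bsub>R\<^esub>} \<or> J = I)"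

text \<open>The right regular module is the sum of its simple submodules.\<close>

definition semisimple_ring :: "('a, 'p) ring_scheme \<Rightarrow> bool" where
  "semisimple_ring R \<longleftrightarrow> ring R \<and>
     generate (add_monoid R) (\<Union>{I. minimal_right_ideal I R}) = carrier R"


section \<open>Internal \<open>\<int>\<close>-gradings\<close>

locale graded_group = abelian_group G for G :: "('g, 'p) ring_scheme" (structure) +
  fixes gr :: "int \<Rightarrow> 'g set"
  assumes gr_subgroup: "additive_subgroup (gr i) G"
    and gr_direct_sum: "x \<in> carrier G \<Longrightarrow>
      \<exists>!c. (\<forall>i. c i \<in> gr i) \<and> finite {i. c i \<noteq> \<zero>} \<and> x = (\<Oplus>i\<in>{i. c i \<noteq> \<zero>}. c i)"

definition component :: "('g, 'p) ring_scheme \<Rightarrow> (int \<Rightarrow> 'g set) \<Rightarrow> 'g \<Rightarrow> int \<Rightarrow> 'g" where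
  "component G gr x = (THE c. (\<forall>i. c i \<in> gr i) \<and> finite {i. c i \<noteq> \<zero>\<^bsub>G\<^esub>} \<and>
     x = (\<Oplus>\<^bsub>G\<^esub>i\<in>{i. c i \<noteq> \<zero>\<^bsub>G\<^esub>}. c i))"

locale graded_ring = ring R + graded_group R gr for R (structure) and gr +
  assumes gr_one: "\<one> \<in> gr 0"
    and gr_mult: "\<lbrakk>a \<in> gr i; b \<in> gr j\<rbrakk> \<Longrightarrow> a \<otimes> b \<in> gr (i + j)"

text \<open>
  A graded, not necessarily commutative algebra over a field. The library's locale \<open>algebra\<close> is not
  used because it includes commutativity; its locale \<open>module\<close> supplies the scalar multiplication.
\<close>

locale graded_algebra = K: field K + module K A + A: graded_ring A gr
  for K (structure) and A (structure) and gr +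
  assumes smult_mult_left: "\<lbrakk>k \<in> carrier K; a \<in> carrier A; b \<in> carrier A\<rbrakk> \<Longrightarrow>
      (k \<odot>\<^bsub>A\<^esub> a) \<otimes>\<^bsub>A\<^esub> b = k \<odot>\<^bsub>A\<^esub> (a \<otimes>\<^bsub>A\<^esub> b)"
    and smult_mult_right: "\<lbrakk>k \<in> carrier K; a \<in> carrier A; b \<in> carrier A\<rbrakk> \<Longrightarrow>
      a \<otimes>\<^bsub>A\<^esub> (k \<odot>\<^bsub>A\<^esub> b) = k \<odot>\<^bsub>A\<^esub> (a \<otimes>\<^bsub>A\<^esub> b)"
    and gr_smult: "\<lbrakk>k \<in> carrier K; a \<in> gr i\<rbrakk> \<Longrightarrow> k \<odot>\<^bsub>A\<^esub> a \<in> gr i"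

locale positively_graded_algebra = graded_algebra +
  assumes gr_neg: "i < 0 \<Longrightarrow> gr i = {\<zero>\<^bsub>A\<^esub>}"

text \<open>
  As \<open>K \<odot> \<one> \<subseteq> gr 0\<close>, the subring generated by degrees 0 and 1 is also the generated subalgebra.
\<close>

definition generated_in_degrees_0_1 :: "('a, 'p) ring_scheme \<Rightarrow> (int \<Rightarrow> 'a set) \<Rightarrow> bool" where
  "generated_in_degrees_0_1 A gr \<longleftrightarrow> generate_ring A (gr 0 \<union> gr 1) = carrier A"


section \<open>Graded right modules\<close>

text \<open>As in the library record \<open>module\<close>, the ring fields \<open>mult\<close> and \<open>one\<close> play no role.\<close>

record ('r, 'm) right_module = "'m ring" +
  ract :: "['m, 'r] \<Rightarrow> 'm" (infixl \<open>\<triangleleft>\<index>\<close> 70)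

locale right_module = R?: ring R + M?: abelian_group M
  for R :: "('r, 'p) ring_scheme" (structure)
    and M :: "('r, 'm, 'q) right_module_scheme" (structure) +
  assumes ract_closed: "\<lbrakk>x \<in> carrier M; a \<in> carrier R\<rbrakk> \<Longrightarrow> x \<triangleleft>\<^bsub>M\<^esub> a \<in> carrier M"
    and ract_add_left: "\<lbrakk>x \<in> carrier M; y \<in> carrier M; a \<in> carrier R\<rbrakk> \<Longrightarrow>
      (x \<oplus>\<^bsub>M\<^esub> y) \<triangleleft>\<^bsub>M\<^esub> a = x \<triangleleft>\<^bsub>M\<^esub> a \<oplus>\<^bsub>M\<^esub> y \<triangleleft>\<^bsub>M\<^esub> a"
    and ract_add_right: "\<lbrakk>x \<in> carrier M; a \<in> carrier R; b \<in> carrier R\<rbrakk> \<Longrightarrow>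
      x \<triangleleft>\<^bsub>M\<^esub> (a \<oplus>\<^bsub>R\<^esub> b) = x \<triangleleft>\<^bsub>M\<^esub> a \<oplus>\<^bsub>M\<^esub> x \<triangleleft>\<^bsub>M\<^esub> b"
    and ract_assoc: "\<lbrakk>x \<in> carrier M; a \<in> carrier R; b \<in> carrier R\<rbrakk> \<Longrightarrow>
      (x \<triangleleft>\<^bsub>M\<^esub> a) \<triangleleft>\<^bsub>M\<^esub> b = x \<triangleleft>\<^bsub>M\<^esub> (a \<otimes>\<^bsub>R\<^esub> b)"
    and ract_one: "x \<in> carrier M \<Longrightarrow> x \<triangleleft>\<^bsub>M\<^esub> \<one>\<^bsub>R\<^esub> = x"

locale graded_right_module = right_module R M + R: graded_ring R rgr + M: graded_group M mgr
  for R :: "('r, 'p) ring_scheme" (structure) and rgr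
    and M :: "('r, 'm, 'q) right_module_scheme" (structure) and mgr +
  assumes gr_ract: "\<lbrakk>x \<in> mgr i; a \<in> rgr j\<rbrakk> \<Longrightarrow> x \<triangleleft>\<^bsub>M\<^esub> a \<in> mgr (i + j)"

definition right_submodule ::
  "'m set \<Rightarrow> ('r, 'p) ring_scheme \<Rightarrow> ('r, 'm, 'q) right_module_scheme \<Rightarrow> bool" where
  "right_submodule H R M \<longleftrightarrow>
     additive_subgroup H M \<and> (\<forall>x\<in>H. \<forall>a\<in>carrier R. x \<triangleleft>\<^bsub>M\<^esub> a \<in> H)"

definition generated_in_degrees ::
  "('r, 'p) ring_scheme \<Rightarrow> ('r, 'm, 'q) right_module_scheme \<Rightarrow> (int \<Rightarrow> 'm set) \<Rightarrow> int set \<Rightarrow> bool"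
  where
  "generated_in_degrees R M mgr D \<longleftrightarrow>
     \<Inter>{H. right_submodule H R M \<and> (\<Union>d\<in>D. mgr d) \<subseteq> H} = carrier M"

definition graded_hom ::
  "('r, 'p) ring_scheme \<Rightarrow> ('r, 'm, 'q) right_module_scheme \<Rightarrow> (int \<Rightarrow> 'm set) \<Rightarrow>
   ('r, 'n, 's) right_module_scheme \<Rightarrow> (int \<Rightarrow> 'n set) \<Rightarrow> ('m \<Rightarrow> 'n) set" where
  "graded_hom R M mgr N ngr = {f. f \<in> hom (add_monoid M) (add_monoid N) \<and>
     (\<forall>x\<in>carrier M. \<forall>a\<in>carrier R. f (x \<triangleleft>\<^bsub>M\<^esub> a) = f x \<triangleleft>\<^bsub>N\<^esub> a) \<and>
     (\<forall>i. f ` mgr i \<subseteq> ngr i)}"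

definition graded_isomorphic ::
  "('r, 'p) ring_scheme \<Rightarrow> ('r, 'm, 'q) right_module_scheme \<Rightarrow> (int \<Rightarrow> 'm set) \<Rightarrow>
   ('r, 'n, 's) right_module_scheme \<Rightarrow> (int \<Rightarrow> 'n set) \<Rightarrow> bool" where
  "graded_isomorphic R M mgr N ngr \<longleftrightarrow>
     (\<exists>f\<in>graded_hom R M mgr N ngr. \<exists>g\<in>graded_hom R N ngr M mgr.
        (\<forall>x\<in>carrier M. g (f x) = x) \<and> (\<forall>y\<in>carrier N. f (g y) = y))"


section \<open>Modular pairs and truncation\<close>

definition colon :: "int set \<Rightarrow> int set \<Rightarrow> int set" where
  "colon S U = {m. (\<lambda>u. m + u) ` U = S}"

definition ring_supporting :: "int set \<Rightarrow> bool" where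
  "ring_supporting U \<longleftrightarrow> 0 \<in> U \<and>
     (\<forall>u\<in>U. \<forall>v\<in>U. \<forall>w\<in>U. u + v + w \<in> U \<longrightarrow> (u + v \<in> U \<longleftrightarrow> v + w \<in> U))"

definition right_modular :: "int set \<Rightarrow> int set \<Rightarrow> bool" where
  "right_modular S U \<longleftrightarrow> S \<noteq> {} \<and> U \<noteq> {} \<and> ring_supporting U \<and>
     (\<forall>s\<in>S. \<forall>u\<in>U. \<forall>v\<in>U. s + u + v \<in> S \<longrightarrow> (s + u \<in> S \<longleftrightarrow> u + v \<in> U))"

definition trunc_carrier :: "('g, 'p) ring_scheme \<Rightarrow> (int \<Rightarrow> 'g set) \<Rightarrow> int set \<Rightarrow> 'g set" where
  "trunc_carrier G gr D = {x \<in> carrier G. \<forall>i. i \<notin> D \<longrightarrow> component G gr x i = \<zero>\<^bsub>G\<^esub>}"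

definition trunc_grading ::
  "('g, 'p) ring_scheme \<Rightarrow> (int \<Rightarrow> 'g set) \<Rightarrow> int set \<Rightarrow> int \<Rightarrow> 'g set" where
  "trunc_grading G gr D i = (if i \<in> D then gr i else {\<zero>\<^bsub>G\<^esub>})"

text \<open>
  The products prescribed for homogeneous elements are extended biadditively: one sums over the
  finitely many pairs of nonzero homogeneous components whose product is not declared to be zero.
\<close>

definition trunc_algebra ::
  "('k, 'a, 'p) module_scheme \<Rightarrow> (int \<Rightarrow> 'a set) \<Rightarrow> int set \<Rightarrow> ('k, 'a, 'p) module_scheme" where
  "trunc_algebra A gr U = A\<lparr>
     carrier := trunc_carrier A gr U,
     monoid.mult := (\<lambda>a b. finsum A (\<lambda>(i, j). component A gr a i \<otimes>\<^bsub>A\<^esub> component A gr b j)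
       {(i, j). component A gr a i \<noteq> \<zero>\<^bsub>A\<^esub> \<and> component A gr b j \<noteq> \<zero>\<^bsub>A\<^esub> \<and> i + j \<in> U})\<rparr>"

definition trunc_module ::
  "('a, 'p) ring_scheme \<Rightarrow> (int \<Rightarrow> 'a set) \<Rightarrow> ('a, 'm, 'q) right_module_scheme \<Rightarrow>
   (int \<Rightarrow> 'm set) \<Rightarrow> int set \<Rightarrow> ('a, 'm, 'q) right_module_scheme" where
  "trunc_module A gr M mgr S = M\<lparr>
     carrier := trunc_carrier M mgr S,
     ract := (\<lambda>x a. finsum M (\<lambda>(i, j). component M mgr x i \<triangleleft>\<^bsub>M\<^esub> component A gr a j)
       {(i, j). component M mgr x i \<noteq> \<zero>\<^bsub>M\<^esub> \<and> component A gr a j \<noteq> \<zero>\<^bsub>A\<^esub> \<and> i + j \<in> S})\<rparr>"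

text \<open>
  HOL cannot quantify over types inside a formula, so the type \<open>'m\<close> of the elements of the lift
  is a parameter. The type \<open>int \<Rightarrow> 'a \<Rightarrow> 'x\<close> always suffices for a module \<open>X\<close> with elements of
  type \<open>'x\<close>: let \<open>\<phi>\<close> be an isomorphism from \<open>M\<^sub>S\<close> to \<open>X\<close> and let \<open>L\<close> be the largest graded submodule
  of \<open>M\<close> with no nonzero component in a degree of \<open>S\<close>. Then \<open>M / L\<close> is a lift as well, and sending
  \<open>z\<close> to \<open>(i, a) \<mapsto> \<phi> ((z\<^sub>i a)\<^sub>S)\<close> embeds it in \<open>int \<Rightarrow> 'a \<Rightarrow> 'x\<close>.
\<close>

definition liftable ::
  "'m itself \<Rightarrow> ('k, 'a, 'p) module_scheme \<Rightarrow> (int \<Rightarrow> 'a set) \<Rightarrow> int set \<Rightarrow> int set \<Rightarrow>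
   ('a, 'x, 'q) right_module_scheme \<Rightarrow> (int \<Rightarrow> 'x set) \<Rightarrow> bool" where
  "liftable _ A gr S U X xgr \<longleftrightarrow>
     (\<exists>(M :: ('a, 'm) right_module) mgr. graded_right_module A gr M mgr \<and>
        graded_isomorphic (trunc_algebra A gr U) X xgr
          (trunc_module A gr M mgr S) (trunc_grading M mgr S))"


section \<open>Tensor products over a noncommutative ring\<close>

text \<open>
  \<open>P \<otimes>\<^sub>R Q\<close> as a quotient of the free abelian group on the set of pairs, for a right \<open>R\<close>-module \<open>P\<close>
  and a left \<open>R\<close>-module \<open>Q\<close> with actions \<open>ra\<close> and \<open>la\<close>. Only the underlying set of \<open>R\<close> enters, and
  only the additive structures of \<open>P\<close> and \<open>Q\<close>.
\<close>

definition tensor_relations ::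
  "'r set \<Rightarrow> ('x, 'p) ring_scheme \<Rightarrow> ('x \<Rightarrow> 'r \<Rightarrow> 'x) \<Rightarrow> ('y, 'q) ring_scheme \<Rightarrow> ('r \<Rightarrow> 'y \<Rightarrow> 'y) \<Rightarrow>
   (('x \<times> 'y) \<Rightarrow>\<^sub>0 int) set" where
  "tensor_relations R P ra Q la = generate (free_Abelian_group (carrier P \<times> carrier Q))
     ({frag_of (x \<oplus>\<^bsub>P\<^esub> x', y) - frag_of (x, y) - frag_of (x', y) | x x' y.
         x \<in> carrier P \<and> x' \<in> carrier P \<and> y \<in> carrier Q} \<union>
      {frag_of (x, y \<oplus>\<^bsub>Q\<^esub> y') - frag_of (x, y) - frag_of (x, y') | x y y'.
         x \<in> carrier P \<and> y \<in> carrier Q \<and> y' \<in> carrier Q} \<union>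
      {frag_of (ra x r, y) - frag_of (x, la r y) | x r y.
         x \<in> carrier P \<and> r \<in> R \<and> y \<in> carrier Q})"

definition tensor_product ::
  "'r set \<Rightarrow> ('x, 'p) ring_scheme \<Rightarrow> ('x \<Rightarrow> 'r \<Rightarrow> 'x) \<Rightarrow> ('y, 'q) ring_scheme \<Rightarrow> ('r \<Rightarrow> 'y \<Rightarrow> 'y) \<Rightarrow>
   (('x \<times> 'y) \<Rightarrow>\<^sub>0 int) set monoid" where
  "tensor_product R P ra Q la =
     free_Abelian_group (carrier P \<times> carrier Q) Mod tensor_relations R P ra Q la"

text \<open>
  The group \<open>X\<^sub>s \<otimes> A\<^sub>u\<close> over \<open>A\<^sub>0\<close>. Here \<open>A\<^sub>0\<close> acts on \<open>X\<^sub>s\<close> by the action of the truncated algebra,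
  which contains \<open>A\<^sub>0\<close>.
\<close>

definition tens_rel where
  "tens_rel A gr X xgr s u = tensor_relations (gr 0)
     (X\<lparr>carrier := xgr s\<rparr>) (ract X) (A\<lparr>carrier := gr u\<rparr>) (monoid.mult A)"

definition tens ::
  "('a, 'p) ring_scheme \<Rightarrow> (int \<Rightarrow> 'a set) \<Rightarrow> ('a, 'x, 'q) right_module_scheme \<Rightarrow> (int \<Rightarrow> 'x set) \<Rightarrow>
   int \<Rightarrow> int \<Rightarrow> (('x \<times> 'a) \<Rightarrow>\<^sub>0 int) set monoid" where
  "tens A gr X xgr s u = tensor_product (gr 0)
     (X\<lparr>carrier := xgr s\<rparr>) (ract X) (A\<lparr>carrier := gr u\<rparr>) (monoid.mult A)"

text \<open>
  The multiplication map \<open>x \<otimes> a \<mapsto> x a\<close>. Elements of the tensor product are cosets \<open>T\<close>, on which the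
  additive extension of \<open>(x, a) \<mapsto> x a\<close> to the free abelian group is constant.
\<close>

definition mu ::
  "('a, 'x, 'q) right_module_scheme \<Rightarrow> (('x \<times> 'a) \<Rightarrow>\<^sub>0 int) set \<Rightarrow> 'x" where
  "mu X T = the_elem ((\<lambda>f. finsum X
     (\<lambda>(x, a). [Poly_Mapping.lookup f (x, a)] \<cdot>\<^bsub>X\<^esub> (x \<triangleleft>\<^bsub>X\<^esub> a)) (Poly_Mapping.keys f)) ` T)"

definition Ker_mu ::
  "('a, 'p) ring_scheme \<Rightarrow> (int \<Rightarrow> 'a set) \<Rightarrow> ('a, 'x, 'q) right_module_scheme \<Rightarrow> (int \<Rightarrow> 'x set) \<Rightarrow>
   int \<Rightarrow> int \<Rightarrow> (('x \<times> 'a) \<Rightarrow>\<^sub>0 int) set set" where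
  "Ker_mu A gr X xgr s u =
     kernel (tens A gr X xgr s u) (add_monoid (X\<lparr>carrier := xgr (s + u)\<rparr>)) (mu X)"

text \<open>
  The action of \<open>b \<in> A\<^sub>i\<close> on \<open>X \<otimes> A\<close>, as the map from \<open>X\<^sub>s \<otimes> A\<^sub>u\<close> to \<open>X\<^sub>s \<otimes> A\<^sub>u\<^sub>+\<^sub>i\<close> with
  \<open>x \<otimes> a \<mapsto> x \<otimes> a b\<close>; the product \<open>a b\<close> is that of \<open>A\<close>, not that of the truncated algebra.
\<close>

definition tens_act ::
  "('a, 'p) ring_scheme \<Rightarrow> (int \<Rightarrow> 'a set) \<Rightarrow> ('a, 'x, 'q) right_module_scheme \<Rightarrow> (int \<Rightarrow> 'x set) \<Rightarrow>
   int \<Rightarrow> int \<Rightarrow> int \<Rightarrow> (('x \<times> 'a) \<Rightarrow>\<^sub>0 int) set \<Rightarrow> 'a \<Rightarrow> (('x \<times> 'a) \<Rightarrow>\<^sub>0 int) set" where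
  "tens_act A gr X xgr s u i T b = the_elem ((\<lambda>f.
     tens_rel A gr X xgr s (u + i) #>\<^bsub>free_Abelian_group (xgr s \<times> gr (u + i))\<^esub>
       frag_extend (\<lambda>(x, a). frag_of (x, a \<otimes>\<^bsub>A\<^esub> b)) f) ` T)"

definition Ker_mu_times ::
  "('a, 'p) ring_scheme \<Rightarrow> (int \<Rightarrow> 'a set) \<Rightarrow> ('a, 'x, 'q) right_module_scheme \<Rightarrow> (int \<Rightarrow> 'x set) \<Rightarrow>
   int \<Rightarrow> int \<Rightarrow> int \<Rightarrow> (('x \<times> 'a) \<Rightarrow>\<^sub>0 int) set set" where
  "Ker_mu_times A gr X xgr s u i = generate (tens A gr X xgr s (u + i))
     {tens_act A gr X xgr s u i T b | T b. T \<in> Ker_mu A gr X xgr s u \<and> b \<in> gr i}"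

end

theory Submission
  imports Defs
begin

text \<open>
  If \<open>X\<close> is the truncation of \<open>M\<close>, a relation \<open>\<Sum>x\<^sub>k a\<^sub>k = 0\<close> in \<open>X\<close> holds in \<open>M\<close> and may be multiplied
  there by any \<open>b\<close>; this is the kernel condition.

  Conversely, put \<open>C = (S : U)\<close> and, for a degree \<open>s \<in> S\<close>, let \<open>m\<close> be the largest element of \<open>C\<close> with
  \<open>m \<le> s\<close>. Differences of elements of \<open>C\<close> are periods of \<open>U\<close>, and \<open>A\<^sub>p\<^sub>+\<^sub>q = A\<^sub>p A\<^sub>q\<close> because \<open>A\<close> is
  generated in degrees 0 and 1; hence generators of lower degree can be moved up to degree \<open>m\<close>, and
  \<open>X\<^sub>s = X\<^sub>m A\<^sub>s\<^sub>-\<^sub>m\<close>. By the kernel condition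
  \<open>(\<Sum>x\<^sub>k c\<^sub>k) \<star> a = \<Sum>x\<^sub>k (c\<^sub>k a)\<close>, for \<open>x\<^sub>k \<in> X\<^sub>m\<close> and \<open>c\<^sub>k \<in> A\<^sub>s\<^sub>-\<^sub>m\<close>, is a well-defined product \<open>x \<star> a\<close> of
  \<open>x \<in> X\<^sub>s\<close> with an arbitrary homogeneous \<open>a\<close>. It extends the given action and satisfies
  \<open>(x \<star> a) \<star> b = x \<star> (a b)\<close> as soon as the degree of \<open>x \<star> a\<close> lies in \<open>S\<close>. The lift consists of the
  finite sums of homogeneous additive maps \<open>F\<close> from \<open>A\<close> to \<open>X\<close> with \<open>F (b a) = F b \<star> a\<close> whenever the
  degree of \<open>F b\<close> lies in \<open>S\<close>, with action \<open>(F c) a = F (c a)\<close>. In a degree \<open>s \<in> S\<close> such an \<open>F\<close> is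
  determined by \<open>F 1 \<in> X\<^sub>s\<close>, which can be arbitrary.
\<close>

text \<open>The product \<open>\<star>\<close> does not make \<open>X\<close> itself an
  \<open>A\<close>-module: if the degree of \<open>x \<star> a\<close> falls outside
  \<open>S\<close>, this element is 0, while \<open>x \<star> (a b)\<close> may be back in a degree
  of \<open>S\<close> and nonzero. A lift may thus need elements in degrees outside
  \<open>S\<close>, which \<open>X\<close> does not contain. A map \<open>F\<close> from
  \<open>A\<close> to \<open>X\<close> remembers all the values \<open>F a\<close> at once,
  translation of its argument is associative for trivial reasons, and the law imposed in degrees of
  \<open>S\<close> asks only for what \<open>star_assoc\<close> provides. An element
  \<open>x\<close> becomes the map sending \<open>a\<close> to \<open>x \<star> a\<close>.

  Condition (2) tests only degrees \<open>i = v - u\<close> that are positive and outside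
  \<open>U\<close>, with \<open>u + i\<close> in \<open>U\<close>. The rest of the well-definedness
  of \<open>\<star>\<close> is automatic: products leaving \<open>U\<close> are 0 by convention, for
  \<open>i\<close> in \<open>U\<close> (in particular 0) associativity in \<open>X\<close> applies,
  and \<open>A\<^sub>i = 0\<close> for negative \<open>i\<close>.

  Taking \<open>m\<close> largest is canonical but not stable: multiplying by \<open>a\<close> may
  raise it. Associativity therefore rests on computing \<open>\<star>\<close> from any element of
  \<open>(S : U)\<close> not above the degree, and this uses generation in degrees 0 and 1 once
  more.\<close>

lemma (in abelian_group) additive_subgroup_minusI:
  assumes "H \<subseteq> carrier G" "\<zero> \<in> H" "\<And>x y. x \<in> H \<Longrightarrow> y \<in> H \<Longrightarrow> x \<ominus> y \<in> H"
  shows "additive_subgroup H G"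
proof -
  have inv: "\<ominus> x \<in> H" if "x \<in> H" for x
    using assms(3)[OF assms(2) that] assms(1) that by (auto simp: a_minus_def)
  have "x \<oplus> y \<in> H" if "x \<in> H" "y \<in> H" for x y
    using assms(3)[OF that(1) inv[OF that(2)]] assms(1) that by (auto simp: a_minus_def)
  then show ?thesis
    using assms(1,2) inv
    by (auto intro!: additive_subgroupI add.subgroupI simp flip: a_inv_def)
qed

lemma (in abelian_group) additive_subgroup_minus:
  "additive_subgroup H G \<Longrightarrow> x \<in> H \<Longrightarrow> y \<in> H \<Longrightarrow> x \<ominus> y \<in> H"
  unfolding a_minus_def
  by (intro additive_subgroup.a_closed additive_subgroup.a_inv_closed)
     (auto intro: abelian_group_axioms additive_subgroup.a_inv_closed)

lemma (in abelian_group) finsum_in_subgroup: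
  assumes H: "additive_subgroup H G" and "\<And>i. i \<in> I \<Longrightarrow> c i \<in> H"
  shows "finsum G c I \<in> H"
  using assms(2)
proof (induction I rule: infinite_finite_induct)
  case (insert i I)
  have "H \<subseteq> carrier G" using additive_subgroup.a_subset[OF H] .
  then have "finsum G c (insert i I) = c i \<oplus> finsum G c I"
    using insert by (intro finsum_insert) auto
  then show ?case using insert H by (simp add: additive_subgroup.a_closed)
qed (use additive_subgroup.zero_closed[OF H] in auto)

text \<open>Projections to a degree, one-sided actions and evaluations of functions at a point all
  instantiate this locale, so that \<open>map_minus\<close> and \<open>map_finsum\<close> carry the
  passage from generators to sums.\<close>

locale additive_map = G: abelian_group G + H: abelian_group H
  for G :: "('g, 'p) ring_scheme" and H :: "('h, 'q) ring_scheme" +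
  fixes f :: "'g \<Rightarrow> 'h"
  assumes map_closed: "x \<in> carrier G \<Longrightarrow> f x \<in> carrier H"
    and map_add: "\<lbrakk>x \<in> carrier G; y \<in> carrier G\<rbrakk> \<Longrightarrow> f (x \<oplus>\<^bsub>G\<^esub> y) = f x \<oplus>\<^bsub>H\<^esub> f y"
begin

lemma map_zero: "f \<zero>\<^bsub>G\<^esub> = \<zero>\<^bsub>H\<^esub>"
  using map_add[of "\<zero>\<^bsub>G\<^esub>" "\<zero>\<^bsub>G\<^esub>"] map_closed[of "\<zero>\<^bsub>G\<^esub>"]
  by (metis G.l_zero G.zero_closed H.add.l_cancel_one')

lemma map_minus:
  assumes "x \<in> carrier G" "y \<in> carrier G"
  shows "f (x \<ominus>\<^bsub>G\<^esub> y) = f x \<ominus>\<^bsub>H\<^esub> f y"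
proof -
  have "f (x \<ominus>\<^bsub>G\<^esub> y) \<oplus>\<^bsub>H\<^esub> f y = f x"
    using assms by (simp flip: map_add add: G.minus_eq G.a_assoc G.l_neg)
  then show ?thesis
    using assms by (metis G.minus_closed H.minus_eq H.a_inv_closed H.add.inv_solve_right map_closed)
qed

lemma map_finsum:
  assumes "\<And>i. i \<in> I \<Longrightarrow> c i \<in> carrier G"
  shows "f (finsum G c I) = finsum H (\<lambda>i. f (c i)) I"
  using assms
proof (induction I rule: infinite_finite_induct)
  case (insert i I)
  have "finsum G c (insert i I) = c i \<oplus>\<^bsub>G\<^esub> finsum G c I"
    using insert by (intro G.finsum_insert) auto
  moreover have "finsum H (\<lambda>i. f (c i)) (insert i I) = f (c i) \<oplus>\<^bsub>H\<^esub> finsum H (\<lambda>i. f (c i)) I"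
    using insert map_closed by (intro H.finsum_insert) auto
  moreover have "finsum G c I \<in> carrier G" using insert by (intro G.finsum_closed) auto
  ultimately show ?case using insert by (simp add: map_add)
qed (simp_all add: map_zero)

end

text \<open>\<open>finsum\<close> is defined by a fold that mentions the carrier, so shrinking the
  carrier of a record could change its value. The inclusion is an additive map and therefore
  commutes with sums.\<close>

lemma finsum_carrier_update:
  assumes "abelian_group G" "additive_subgroup H G" "\<And>i. i \<in> I \<Longrightarrow> c i \<in> H"
    "abelian_group G'" "carrier G' = H" "\<zero>\<^bsub>G'\<^esub> = \<zero>\<^bsub>G\<^esub>" "add G' = add G"
  shows "finsum G' c I = finsum G c I"
proof -
  interpret G: abelian_group G by fact
  interpret G': abelian_group G' by fact
  have "H \<subseteq> carrier G" by (rule additive_subgroup.a_subset) fact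
  then interpret additive_map G' G "\<lambda>x. x"
    using assms(5-7) by unfold_locales auto
  show ?thesis using map_finsum[of I c] assms(3,5) by simp
qed

section \<open>Graded groups\<close>

context graded_group
begin

abbreviation comp :: "'g \<Rightarrow> int \<Rightarrow> 'g" where "comp \<equiv> component G gr"

lemma gr_carrier: "x \<in> gr i \<Longrightarrow> x \<in> carrier G"
  using additive_subgroup.a_subset[OF gr_subgroup] by auto

lemma gr_zero: "\<zero> \<in> gr i"
  by (rule additive_subgroup.zero_closed[OF gr_subgroup])

lemma gr_add: "x \<in> gr i \<Longrightarrow> y \<in> gr i \<Longrightarrow> x \<oplus> y \<in> gr i"
  by (rule additive_subgroup.a_closed[OF gr_subgroup])

lemma gr_minus: "x \<in> gr i \<Longrightarrow> y \<in> gr i \<Longrightarrow> x \<ominus> y \<in> gr i"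
  by (rule additive_subgroup_minus[OF gr_subgroup])

lemma
  assumes "x \<in> carrier G"
  shows comp_gr: "comp x i \<in> gr i"
    and finite_support: "finite {i. comp x i \<noteq> \<zero>}"
    and finsum_support: "(\<Oplus>i\<in>{i. comp x i \<noteq> \<zero>}. comp x i) = x"
  using theI'[OF gr_direct_sum[OF assms]] by (auto simp: component_def)

lemma comp_closed: "x \<in> carrier G \<Longrightarrow> comp x i \<in> carrier G"
  using comp_gr gr_carrier by blast

lemma finsum_neutral:
  assumes "finite J" "I \<subseteq> J" "\<And>i. i \<in> J \<Longrightarrow> c i \<in> carrier G" "\<And>i. i \<in> J - I \<Longrightarrow> c i = \<zero>"
  shows "(\<Oplus>i\<in>I. c i) = (\<Oplus>i\<in>J. c i)"
  using assms by (intro add.finprod_mono_neutral_cong_left) auto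

lemma finsum_comp:
  assumes "x \<in> carrier G" "finite I" "{i. comp x i \<noteq> \<zero>} \<subseteq> I"
  shows "(\<Oplus>i\<in>I. comp x i) = x"
proof -
  have "(\<Oplus>i\<in>{i. comp x i \<noteq> \<zero>}. comp x i) = (\<Oplus>i\<in>I. comp x i)"
    using assms by (intro finsum_neutral) (auto simp: comp_closed)
  then show ?thesis using finsum_support[OF assms(1)] by simp
qed

lemma comp_eqI:
  assumes "\<And>i. c i \<in> gr i" "finite I" "\<And>i. i \<notin> I \<Longrightarrow> c i = \<zero>" "x = (\<Oplus>i\<in>I. c i)"
  shows "comp x = c"
proof -
  let ?P = "\<lambda>c. (\<forall>i. c i \<in> gr i) \<and> finite {i. c i \<noteq> \<zero>} \<and> x = (\<Oplus>i\<in>{i. c i \<noteq> \<zero>}. c i)"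
  have sub: "{i. c i \<noteq> \<zero>} \<subseteq> I" using assms(3) by auto
  have "x \<in> carrier G" using assms(1,4) gr_carrier by (auto intro!: finsum_closed)
  then have "\<exists>!c. ?P c" by (rule gr_direct_sum)
  moreover have "finite {i. c i \<noteq> \<zero>}"
    using finite_subset[OF sub] assms(2) .
  moreover have "(\<Oplus>i\<in>{i. c i \<noteq> \<zero>}. c i) = (\<Oplus>i\<in>I. c i)"
    using sub gr_carrier[OF assms(1)] assms(2) by (intro finsum_neutral) auto
  then have "x = (\<Oplus>i\<in>{i. c i \<noteq> \<zero>}. c i)" using assms(4) by simp
  ultimately have "\<exists>!c. ?P c" and "?P c"
    using assms(1) by blast+
  then show ?thesis unfolding component_def by (rule the1_equality[where P = ?P])
qed

lemma comp_homogeneous: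
  assumes "x \<in> gr i"
  shows "comp x j = (if j = i then x else \<zero>)"
proof -
  have "comp x = (\<lambda>j. if j = i then x else \<zero>)"
    using assms gr_zero gr_carrier by (intro comp_eqI[where I = "{i}"]) auto
  then show ?thesis by simp
qed

lemma comp_zero: "comp \<zero> j = \<zero>"
  using comp_homogeneous[OF gr_zero] by simp

lemma comp_ext:
  assumes "x \<in> carrier G" "y \<in> carrier G" "\<And>i. comp x i = comp y i"
  shows "x = y"
proof -
  have "comp x = comp y" using assms(3) by auto
  then show ?thesis using finsum_support[OF assms(1)] finsum_support[OF assms(2)] by (metis (no_types))
qed

lemma comp_add:
  assumes "x \<in> carrier G" "y \<in> carrier G"
  shows "comp (x \<oplus> y) i = comp x i \<oplus> comp y i"
proof -
  let ?I = "{i. comp x i \<noteq> \<zero>} \<union> {i. comp y i \<noteq> \<zero>}"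
  have "x \<oplus> y = (\<Oplus>i\<in>?I. comp x i \<oplus> comp y i)"
    using assms finsum_comp[of x ?I] finsum_comp[of y ?I]
    by (simp add: finite_support comp_closed Pi_iff)
  then have "comp (x \<oplus> y) = (\<lambda>i. comp x i \<oplus> comp y i)"
    using assms by (intro comp_eqI[where I = ?I]) (auto intro!: gr_add comp_gr finite_support)
  then show ?thesis by simp
qed

lemma additive_map_comp: "additive_map G G (\<lambda>x. comp x i)"
  by unfold_locales (simp_all add: comp_closed comp_add)

lemmas comp_minus = additive_map.map_minus[OF additive_map_comp]

lemma homogeneous_induct [consumes 1, case_names homogeneous add]:
  assumes x: "x \<in> carrier G"
    and gr: "\<And>x i. x \<in> gr i \<Longrightarrow> P x"
    and add: "\<And>x y. \<lbrakk>x \<in> carrier G; y \<in> carrier G; P x; P y\<rbrakk> \<Longrightarrow> P (x \<oplus> y)"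
  shows "P x"
proof -
  have "P (\<Oplus>i\<in>I. comp x i)" if "finite I" for I
    using that
  proof induction
    case empty
    show ?case using gr[OF gr_zero] by simp
  next
    case (insert i I)
    have "(\<Oplus>i\<in>insert i I. comp x i) = comp x i \<oplus> (\<Oplus>i\<in>I. comp x i)"
      using insert x by (intro finsum_insert) (auto simp: comp_closed)
    moreover have "(\<Oplus>i\<in>I. comp x i) \<in> carrier G"
      using x by (intro finsum_closed) (auto simp: comp_closed)
    ultimately show ?case using add[OF comp_closed[OF x] _ gr[OF comp_gr[OF x]] insert(3)] by simp
  qed
  from this[OF finite_support[OF x]] show ?thesis using finsum_support[OF x] by simp
qed

text \<open>Subgroups are often prescribed degree by degree. \<open>W n\<close> need not lie in
  \<open>gr n\<close>, so a degree is left free by taking the whole carrier. Truncations and both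
  generation arguments (\<open>gr_eq_products_1\<close>, \<open>xgr_spanned\<close>) use this
  form.\<close>

lemma additive_subgroup_components:
  assumes "\<And>n. additive_subgroup (W n) G"
  shows "additive_subgroup {x \<in> carrier G. \<forall>n. comp x n \<in> W n} G"
proof (rule additive_subgroup_minusI)
  fix x y assume "x \<in> {x \<in> carrier G. \<forall>n. comp x n \<in> W n}" "y \<in> {x \<in> carrier G. \<forall>n. comp x n \<in> W n}"
  then show "x \<ominus> y \<in> {x \<in> carrier G. \<forall>n. comp x n \<in> W n}"
    using additive_subgroup_minus[OF assms] by (simp add: comp_minus)
qed (use additive_subgroup.zero_closed[OF assms] in \<open>auto simp: comp_zero\<close>)

end

text \<open>Applying \<open>p j\<close> to a finite sum of homogeneous elements leaves its summand
  of degree \<open>j\<close>, whence the uniqueness of the decomposition.\<close>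

lemma graded_groupI:
  assumes G: "abelian_group G" and sub: "\<And>i. additive_subgroup (gr i) G"
    and sum: "\<And>x. x \<in> carrier G \<Longrightarrow> \<exists>c I. (\<forall>i. c i \<in> gr i) \<and> finite I \<and> x = finsum G c I"
    and proj: "\<And>i. additive_map G G (p i)"
    and p_gr: "\<And>i j x. x \<in> gr i \<Longrightarrow> p j x = (if j = i then x else \<zero>\<^bsub>G\<^esub>)"
  shows "graded_group G gr"
proof -
  interpret abelian_group G by fact
  have car: "x \<in> carrier G" if "x \<in> gr i" for x i
    using additive_subgroup.a_subset[OF sub] that by auto
  have p_sum: "p j (finsum G c I) = (if j \<in> I then c j else \<zero>\<^bsub>G\<^esub>)"
    if "\<And>i. c i \<in> gr i" "finite I" for c I j
  proof -
    have "p j (finsum G c I) = (\<Oplus>\<^bsub>G\<^esub>i\<in>I. if j = i then c i else \<zero>\<^bsub>G\<^esub>)"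
      using car[OF that(1)] p_gr[OF that(1)]
      by (subst additive_map.map_finsum[OF proj]) (auto intro!: finsum_cong' split: if_splits)
    also have "\<dots> = (if j \<in> I then c j else \<zero>\<^bsub>G\<^esub>)"
      using that(2) car[OF that(1)] by (auto simp: add.finprod_singleton intro!: add.finprod_one_eqI)
    finally show ?thesis .
  qed
  show ?thesis
  proof (intro graded_group.intro graded_group_axioms.intro)
    fix x assume "x \<in> carrier G"
    then obtain c I where c: "\<And>i. c i \<in> gr i" "finite I" "x = finsum G c I"
      using sum by metis
    \<comment> \<open>The family \<open>c\<close> may be nonzero outside \<open>I\<close>; only its
      restriction to \<open>I\<close> can be the decomposition.\<close>
    define d where "d = (\<lambda>i. if i \<in> I then c i else \<zero>\<^bsub>G\<^esub>)"
    have d: "\<And>i. d i \<in> gr i" using c sub by (auto simp: d_def additive_subgroup.zero_closed)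
    have fin: "{i. d i \<noteq> \<zero>\<^bsub>G\<^esub>} \<subseteq> I" by (auto simp: d_def)
    have "x = (\<Oplus>\<^bsub>G\<^esub>i\<in>{i. d i \<noteq> \<zero>\<^bsub>G\<^esub>}. d i)"
      unfolding c(3) using c fin car
      by (intro add.finprod_mono_neutral_cong_right) (auto simp: d_def)
    moreover have "finite {i. d i \<noteq> \<zero>\<^bsub>G\<^esub>}" using finite_subset[OF fin c(2)] .
    moreover have "d' = d" if d': "\<forall>i. d' i \<in> gr i" "finite {i. d' i \<noteq> \<zero>\<^bsub>G\<^esub>}"
      "x = (\<Oplus>\<^bsub>G\<^esub>i\<in>{i. d' i \<noteq> \<zero>\<^bsub>G\<^esub>}. d' i)" for d'
    proof
      fix j
      have "p j x = d' j" using p_sum[of d' "{i. d' i \<noteq> \<zero>\<^bsub>G\<^esub>}" j] d' by auto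
      moreover have "p j x = d j" using p_sum[of c I j] c by (simp add: d_def)
      ultimately show "d' j = d j" by simp
    qed
    ultimately show "\<exists>!c. (\<forall>i. c i \<in> gr i) \<and> finite {i. c i \<noteq> \<zero>\<^bsub>G\<^esub>} \<and>
        x = (\<Oplus>\<^bsub>G\<^esub>i\<in>{i. c i \<noteq> \<zero>\<^bsub>G\<^esub>}. c i)"
      using d by (intro ex1I[of _ d]) auto
  qed (rule G sub)+
qed

lemma (in abelian_group) abelian_group_restrict:
  assumes H: "additive_subgroup H G"
    and G': "carrier G' = H" "\<zero>\<^bsub>G'\<^esub> = \<zero>" "add G' = add G"
  shows "abelian_group G'"
proof (rule abelian_groupI)
  have sub: "x \<in> carrier G" if "x \<in> H" for x using additive_subgroup.a_subset[OF H] that by auto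
  have "\<ominus> x \<in> H" if "x \<in> H" for x
    using additive_subgroup_minus[OF H additive_subgroup.zero_closed[OF H] that] sub[OF that]
    by (simp add: minus_eq)
  then show "\<exists>y\<in>carrier G'. y \<oplus>\<^bsub>G'\<^esub> x = \<zero>\<^bsub>G'\<^esub>" if "x \<in> carrier G'" for x
    using that G' sub by (intro bexI[of _ "\<ominus> x"]) (auto simp: l_neg)
qed (use assms additive_subgroup.a_subset[OF H] in
     \<open>auto simp: additive_subgroup.a_closed additive_subgroup.zero_closed a_ac subset_iff\<close>)

lemma (in abelian_group) additive_subgroup_restrict:
  assumes H: "additive_subgroup H G"
    and G': "carrier G' = H" "\<zero>\<^bsub>G'\<^esub> = \<zero>" "add G' = add G"
    and K: "additive_subgroup K G" "K \<subseteq> H"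
  shows "additive_subgroup K G'"
proof -
  interpret G': abelian_group G' by (rule abelian_group_restrict[OF H G'])
  interpret additive_map G' G "\<lambda>x. x"
    using assms additive_subgroup.a_subset[OF H] by unfold_locales auto
  show ?thesis
  proof (rule G'.additive_subgroup_minusI)
    fix x y assume "x \<in> K" "y \<in> K"
    moreover from this have "x \<ominus>\<^bsub>G'\<^esub> y = x \<ominus> y" using K(2) G'(1) map_minus by auto
    ultimately show "x \<ominus>\<^bsub>G'\<^esub> y \<in> K" using additive_subgroup_minus[OF K(1)] by simp
  qed (use K G' additive_subgroup.zero_closed[OF K(1)] in auto)
qed

lemma graded_isomorphicI_bij:
  assumes X: "graded_group X xgr" and N: "graded_group N ngr"
    and act: "\<And>x a. \<lbrakk>x \<in> carrier X; a \<in> carrier R\<rbrakk> \<Longrightarrow> x \<triangleleft>\<^bsub>X\<^esub> a \<in> carrier X"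
    and f: "f \<in> graded_hom R X xgr N ngr" "bij_betw f (carrier X) (carrier N)"
    and onto: "\<And>i. ngr i \<subseteq> f ` xgr i"
  shows "graded_isomorphic R X xgr N ngr"
proof -
  interpret X: graded_group X xgr by fact
  interpret N: graded_group N ngr by fact
  have hom: "f (x \<oplus>\<^bsub>X\<^esub> y) = f x \<oplus>\<^bsub>N\<^esub> f y" if "x \<in> carrier X" "y \<in> carrier X" for x y
    using f(1) that by (simp add: graded_hom_def hom_def)
  have fact: "f (x \<triangleleft>\<^bsub>X\<^esub> a) = f x \<triangleleft>\<^bsub>N\<^esub> a" if "x \<in> carrier X" "a \<in> carrier R" for x a
    using f(1) that by (simp add: graded_hom_def)
  define g where "g = the_inv_into (carrier X) f"
  have inj: "inj_on f (carrier X)" and img: "f ` carrier X = carrier N"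
    using f(2) by (auto simp: bij_betw_def)
  have gf: "g (f x) = x" if "x \<in> carrier X" for x
    unfolding g_def using inj that by (rule the_inv_into_f_f)
  have fg: "\<exists>x \<in> carrier X. y = f x \<and> g y = x" if "y \<in> carrier N" for y
    using that gf unfolding img[symmetric] by auto
  have "g \<in> graded_hom R N ngr X xgr"
    unfolding graded_hom_def mem_Collect_eq
  proof (intro conjI allI ballI homI)
    fix x y assume "x \<in> carrier (add_monoid N)" "y \<in> carrier (add_monoid N)"
    then obtain x' y' where *: "x' \<in> carrier X" "y' \<in> carrier X" "x = f x'" "y = f y'"
      using fg[of x] fg[of y] by auto
    then have "g (f (x' \<oplus>\<^bsub>X\<^esub> y')) = x' \<oplus>\<^bsub>X\<^esub> y'" by (intro gf) simp
    then show "g (x \<otimes>\<^bsub>add_monoid N\<^esub> y) = g x \<otimes>\<^bsub>add_monoid X\<^esub> g y"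
      using * by (simp add: hom gf)
  next
    fix y a assume "y \<in> carrier N" and a: "a \<in> carrier R"
    then obtain x where x: "x \<in> carrier X" "y = f x" using fg by blast
    then have "g (f (x \<triangleleft>\<^bsub>X\<^esub> a)) = x \<triangleleft>\<^bsub>X\<^esub> a" using a by (intro gf act)
    then show "g (y \<triangleleft>\<^bsub>N\<^esub> a) = g y \<triangleleft>\<^bsub>X\<^esub> a" using x a by (simp add: fact gf)
  next
    fix i
    show "g ` ngr i \<subseteq> xgr i"
    proof (rule image_subsetI)
      fix y assume "y \<in> ngr i"
      then obtain x where x: "x \<in> xgr i" "y = f x" using onto[of i] by blast
      then show "g y \<in> xgr i" using gf[OF X.gr_carrier[OF x(1)]] by simp
    qed
  next
    fix x assume "x \<in> carrier (add_monoid N)"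
    then show "g x \<in> carrier (add_monoid X)" using fg[of x] by auto
  qed
  moreover have "f (g y) = y" if "y \<in> carrier N" for y using fg[OF that] by auto
  ultimately show ?thesis using f(1) gf unfolding graded_isomorphic_def by blast
qed

text \<open>Biadditivity is what reduces the comparison of two actions to homogeneous elements.
  Separating it from associativity makes it applicable to \<open>trunc_module\<close>, whose action
  is given as a sum over components.\<close>

locale biadditive_action = R: abelian_group R + M: abelian_group M
  for R :: "('r, 'p) ring_scheme" and M :: "('r, 'm, 'q) right_module_scheme" +
  assumes act_closed: "\<lbrakk>x \<in> carrier M; a \<in> carrier R\<rbrakk> \<Longrightarrow> x \<triangleleft>\<^bsub>M\<^esub> a \<in> carrier M"
    and act_add_left: "\<lbrakk>x \<in> carrier M; y \<in> carrier M; a \<in> carrier R\<rbrakk> \<Longrightarrow>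
      (x \<oplus>\<^bsub>M\<^esub> y) \<triangleleft>\<^bsub>M\<^esub> a = x \<triangleleft>\<^bsub>M\<^esub> a \<oplus>\<^bsub>M\<^esub> y \<triangleleft>\<^bsub>M\<^esub> a"
    and act_add_right: "\<lbrakk>x \<in> carrier M; a \<in> carrier R; b \<in> carrier R\<rbrakk> \<Longrightarrow>
      x \<triangleleft>\<^bsub>M\<^esub> (a \<oplus>\<^bsub>R\<^esub> b) = x \<triangleleft>\<^bsub>M\<^esub> a \<oplus>\<^bsub>M\<^esub> x \<triangleleft>\<^bsub>M\<^esub> b"
begin

lemma additive_map_act_left: "a \<in> carrier R \<Longrightarrow> additive_map M M (\<lambda>x. x \<triangleleft>\<^bsub>M\<^esub> a)"
  by unfold_locales (simp_all add: act_closed act_add_left)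

lemma additive_map_act_right: "x \<in> carrier M \<Longrightarrow> additive_map R M (\<lambda>a. x \<triangleleft>\<^bsub>M\<^esub> a)"
  by unfold_locales (simp_all add: act_closed act_add_right)

lemmas act_zero_left = additive_map.map_zero[OF additive_map_act_left]
  and act_zero_right = additive_map.map_zero[OF additive_map_act_right]

end

lemma (in right_module) biadditive_action: "biadditive_action R M"
  by unfold_locales (simp_all add: ract_closed ract_add_left ract_add_right)

text \<open>Everything is checked on components: the \<open>\<phi> i\<close> are summed to one map
  \<open>f\<close>, compatibility with the action spreads from homogeneous elements by biadditivity,
  and inverting each component with \<open>\<psi> i\<close> gives injectivity and
  surjectivity.\<close>

lemma graded_isomorphicI:
  assumes X: "graded_group X xgr" and N: "graded_group N ngr" and R: "graded_group R rgr"
    and actX: "biadditive_action R X" and actN: "biadditive_action R N"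
    and grX: "\<And>i j x a. \<lbrakk>x \<in> xgr i; a \<in> rgr j\<rbrakk> \<Longrightarrow> x \<triangleleft>\<^bsub>X\<^esub> a \<in> xgr (i + j)"
    and \<phi>: "\<And>i x. x \<in> xgr i \<Longrightarrow> \<phi> i x \<in> ngr i"
      "\<And>i x y. \<lbrakk>x \<in> xgr i; y \<in> xgr i\<rbrakk> \<Longrightarrow> \<phi> i (x \<oplus>\<^bsub>X\<^esub> y) = \<phi> i x \<oplus>\<^bsub>N\<^esub> \<phi> i y"
      "\<And>i j x a. \<lbrakk>x \<in> xgr i; a \<in> rgr j\<rbrakk> \<Longrightarrow> \<phi> (i + j) (x \<triangleleft>\<^bsub>X\<^esub> a) = \<phi> i x \<triangleleft>\<^bsub>N\<^esub> a"
    and \<psi>: "\<And>i y. y \<in> ngr i \<Longrightarrow> \<psi> i y \<in> xgr i"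
      "\<And>i x. x \<in> xgr i \<Longrightarrow> \<psi> i (\<phi> i x) = x" "\<And>i y. y \<in> ngr i \<Longrightarrow> \<phi> i (\<psi> i y) = y"
  shows "graded_isomorphic R X xgr N ngr"
proof -
  interpret X: graded_group X xgr by fact
  interpret N: graded_group N ngr by fact
  interpret R: graded_group R rgr by fact
  interpret AX: biadditive_action R X by fact
  interpret AN: biadditive_action R N by fact
  have \<phi>0: "\<phi> i \<zero>\<^bsub>X\<^esub> = \<zero>\<^bsub>N\<^esub>" for i
    using \<phi>(1)[OF X.gr_zero, of i] \<phi>(2)[OF X.gr_zero X.gr_zero, of i] N.gr_carrier
    by (metis N.add.l_cancel_one' X.l_zero X.zero_closed)
  have \<psi>0: "\<psi> i \<zero>\<^bsub>N\<^esub> = \<zero>\<^bsub>X\<^esub>" for i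
    using \<psi>(2)[OF X.gr_zero, of i] by (simp add: \<phi>0)
  define f where "f x = (\<Oplus>\<^bsub>N\<^esub>i\<in>{i. X.comp x i \<noteq> \<zero>\<^bsub>X\<^esub>}. \<phi> i (X.comp x i))" for x
  have f_closed: "f x \<in> carrier N" if "x \<in> carrier X" for x
    unfolding f_def using \<phi>(1)[OF X.comp_gr[OF that]] N.gr_carrier by (intro N.finsum_closed) blast
  have f_comp: "N.comp (f x) = (\<lambda>i. \<phi> i (X.comp x i))" if "x \<in> carrier X" for x
    unfolding f_def using \<phi>(1)[OF X.comp_gr[OF that]] X.finite_support[OF that]
    by (intro N.comp_eqI) (auto simp: \<phi>0)
  have f_add: "f (x \<oplus>\<^bsub>X\<^esub> y) = f x \<oplus>\<^bsub>N\<^esub> f y" if "x \<in> carrier X" "y \<in> carrier X" for x y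
    by (rule N.comp_ext)
       (use that in \<open>simp_all add: f_closed f_comp X.comp_add N.comp_add \<phi>(2) X.comp_gr\<close>)
  have f_gr: "f x = \<phi> i x" if "x \<in> xgr i" for x i
    by (rule N.comp_ext)
       (use that X.gr_carrier[OF that] N.gr_carrier[OF \<phi>(1)[OF that]] \<phi>(1)[OF that] in \<open>simp_all add: f_closed f_comp X.comp_homogeneous N.comp_homogeneous \<phi>0\<close>)
  have f_act: "f (x \<triangleleft>\<^bsub>X\<^esub> a) = f x \<triangleleft>\<^bsub>N\<^esub> a" if x: "x \<in> carrier X" and a: "a \<in> carrier R" for x a
    using x
  proof (induction rule: X.homogeneous_induct)
    case x: (homogeneous x i)
    note xc = X.gr_carrier[OF x]
    show ?case using a
    proof (induction rule: R.homogeneous_induct)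
      case (homogeneous a j)
      then show ?case using f_gr[OF x] f_gr[OF grX[OF x]] \<phi>(3)[OF x] by simp
    next
      case (add a b)
      then show ?case
        using xc f_closed[OF xc] by (simp add: AX.act_add_right AN.act_add_right f_add AX.act_closed)
    qed
  next
    case (add x y)
    then show ?case using a
      by (simp add: AX.act_add_left AN.act_add_left f_add AX.act_closed f_closed)
  qed
  have f_inj: "inj_on f (carrier X)"
  proof (rule inj_onI)
    fix x y assume xy: "x \<in> carrier X" "y \<in> carrier X" "f x = f y"
    have "X.comp x i = X.comp y i" for i
    proof -
      have "\<phi> i (X.comp x i) = \<phi> i (X.comp y i)"
        using fun_cong[OF f_comp[OF xy(1)], of i] fun_cong[OF f_comp[OF xy(2)], of i] xy(3) by simp
      then show ?thesis
        using \<psi>(2)[OF X.comp_gr[OF xy(1), of i]] \<psi>(2)[OF X.comp_gr[OF xy(2), of i]] by metis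
    qed
    then show "x = y" using xy X.comp_ext by blast
  qed
  have f_surj: "y \<in> f ` carrier X" if y: "y \<in> carrier N" for y
  proof -
    define x where "x = (\<Oplus>\<^bsub>X\<^esub>i\<in>{i. N.comp y i \<noteq> \<zero>\<^bsub>N\<^esub>}. \<psi> i (N.comp y i))"
    have x: "x \<in> carrier X"
      unfolding x_def using \<psi>(1)[OF N.comp_gr[OF y]] X.gr_carrier by (intro X.finsum_closed) blast
    have xc: "X.comp x = (\<lambda>i. \<psi> i (N.comp y i))"
      using \<psi>(1)[OF N.comp_gr[OF y]] N.finite_support[OF y]
      by (intro X.comp_eqI[OF _ _ _ x_def]) (auto simp: \<psi>0)
    have "f x = y"
      by (rule N.comp_ext) (use x y xc in \<open>simp_all add: f_closed f_comp \<psi>(3) N.comp_gr\<close>)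
    then show ?thesis using x by blast
  qed
  show ?thesis
  proof (rule graded_isomorphicI_bij[OF X N AX.act_closed])
    show "f \<in> graded_hom R X xgr N ngr"
      unfolding graded_hom_def using f_closed f_add f_act f_gr \<phi>(1) by (auto simp: hom_def)
    show "bij_betw f (carrier X) (carrier N)"
      using f_inj f_surj f_closed by (auto simp: bij_betw_def)
    show "ngr i \<subseteq> f ` xgr i" for i
    proof
      fix y assume "y \<in> ngr i"
      then show "y \<in> f ` xgr i" using \<psi>(1,3) f_gr by (metis imageI)
    qed
  qed
qed

section \<open>Truncations\<close>

context graded_group
begin

lemma trunc_carrier_subgroup: "additive_subgroup (trunc_carrier G gr D) G"
proof -
  have "additive_subgroup (carrier G) G" and "additive_subgroup {\<zero>} G"
    by (rule additive_subgroup_minusI, auto simp: a_minus_def)+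
  then have "additive_subgroup {x \<in> carrier G. \<forall>n. comp x n \<in> (if n \<in> D then carrier G else {\<zero>})} G"
    by (intro additive_subgroup_components) auto
  moreover have "{x \<in> carrier G. \<forall>n. comp x n \<in> (if n \<in> D then carrier G else {\<zero>})} =
      trunc_carrier G gr D"
    by (auto simp: trunc_carrier_def comp_closed)
  ultimately show ?thesis by simp
qed

lemma trunc_grading_subset: "trunc_grading G gr D i \<subseteq> trunc_carrier G gr D"
  by (auto simp: trunc_grading_def trunc_carrier_def comp_homogeneous comp_zero gr_carrier)

lemma trunc_grading_subgroup: "additive_subgroup (trunc_grading G gr D i) G"
proof -
  have "additive_subgroup {\<zero>} G" by (rule additive_subgroup_minusI, auto simp: a_minus_def)
  then show ?thesis by (simp add: trunc_grading_def gr_subgroup)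
qed

text \<open>The record \<open>G'\<close> is left open because \<open>trunc_module\<close> changes
  the action along with the carrier. Components taken in \<open>G\<close> stay in the truncation and
  serve as its projections.\<close>

lemma trunc_graded_group:
  assumes G': "carrier G' = trunc_carrier G gr D" "\<zero>\<^bsub>G'\<^esub> = \<zero>" "add G' = add G"
  shows "graded_group G' (trunc_grading G gr D)"
proof -
  note H = trunc_carrier_subgroup
  interpret G': abelian_group G' using abelian_group_restrict[OF H G'] .
  have sub: "x \<in> carrier G" if "x \<in> carrier G'" for x using that G' by (auto simp: trunc_carrier_def)
  show ?thesis
  proof (rule graded_groupI[where p = "\<lambda>i x. comp x i"])
    show "additive_subgroup (trunc_grading G gr D i) G'" for i
      by (rule additive_subgroup_restrict[OF H G' trunc_grading_subgroup trunc_grading_subset])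
    have comp_D: "comp x i \<in> trunc_grading G gr D i" if "x \<in> carrier G'" for x i
      using that G' comp_gr by (auto simp: trunc_grading_def trunc_carrier_def)
    then show "additive_map G' G' (\<lambda>x. comp x i)" for i
      using trunc_grading_subset[of D i] sub
      by unfold_locales (auto simp: G' comp_add)
    show "comp x j = (if j = i then x else \<zero>\<^bsub>G'\<^esub>)" if "x \<in> trunc_grading G gr D i" for i j x
      using that by (auto simp: trunc_grading_def G' comp_homogeneous comp_zero split: if_splits)
    show "\<exists>c I. (\<forall>i. c i \<in> trunc_grading G gr D i) \<and> finite I \<and> x = finsum G' c I"
      if x: "x \<in> carrier G'" for x
    proof (intro exI conjI allI)
      show "comp x i \<in> trunc_grading G gr D i" for i using comp_D[OF x] .
      show "finite {i. comp x i \<noteq> \<zero>}" using finite_support sub[OF x] .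
      have "finsum G' (comp x) {i. comp x i \<noteq> \<zero>} = finsum G (comp x) {i. comp x i \<noteq> \<zero>}"
        using comp_D[OF x] trunc_grading_subset
        by (intro finsum_carrier_update[OF abelian_group_axioms H _ G'.abelian_group_axioms G']) blast
      then show "x = finsum G' (comp x) {i. comp x i \<noteq> \<zero>}"
        using finsum_support sub[OF x] by simp
    qed
  qed (rule G'.abelian_group_axioms)
qed

end

text \<open>The index set of the defining sum is a single pair, or empty when a factor vanishes or
  \<open>i + j\<close> lies outside \<open>U\<close>; for a vanishing factor the product in
  \<open>A\<close> is 0 as well.\<close>

lemma trunc_algebra_mult:
  fixes A :: "('k, 'a, 'p) module_scheme"
  assumes A: "graded_ring A gr" and ab: "a \<in> gr i" "b \<in> gr j"
  shows "a \<otimes>\<^bsub>trunc_algebra A gr U\<^esub> b = (if i + j \<in> U then a \<otimes>\<^bsub>A\<^esub> b else \<zero>\<^bsub>A\<^esub>)"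
proof -
  interpret graded_ring A gr by fact
  have "{(i', j'). component A gr a i' \<noteq> \<zero>\<^bsub>A\<^esub> \<and> component A gr b j' \<noteq> \<zero>\<^bsub>A\<^esub> \<and> i' + j' \<in> U} =
      (if a \<noteq> \<zero>\<^bsub>A\<^esub> \<and> b \<noteq> \<zero>\<^bsub>A\<^esub> \<and> i + j \<in> U then {(i, j)} else {})"
    using ab by (auto simp: comp_homogeneous split: if_splits)
  then show ?thesis
    using ab gr_carrier by (auto simp: trunc_algebra_def comp_homogeneous)
qed

lemma trunc_module_ract:
  assumes R: "graded_group R rgr" and M: "graded_group M mgr" and act: "biadditive_action R M"
    and xa: "x \<in> mgr i" "a \<in> rgr j"
  shows "x \<triangleleft>\<^bsub>trunc_module R rgr M mgr S\<^esub> a = (if i + j \<in> S then x \<triangleleft>\<^bsub>M\<^esub> a else \<zero>\<^bsub>M\<^esub>)"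
proof -
  interpret R: graded_group R rgr by fact
  interpret M: graded_group M mgr by fact
  interpret act: biadditive_action R M by fact
  have "{(i', j'). component M mgr x i' \<noteq> \<zero>\<^bsub>M\<^esub> \<and> component R rgr a j' \<noteq> \<zero>\<^bsub>R\<^esub> \<and> i' + j' \<in> S} =
      (if x \<noteq> \<zero>\<^bsub>M\<^esub> \<and> a \<noteq> \<zero>\<^bsub>R\<^esub> \<and> i + j \<in> S then {(i, j)} else {})"
    using xa by (auto simp: M.comp_homogeneous R.comp_homogeneous split: if_splits)
  then show ?thesis
    using xa M.gr_carrier[OF xa(1)] R.gr_carrier[OF xa(2)]
    by (auto simp: trunc_module_def M.comp_homogeneous R.comp_homogeneous act.act_closed act.act_zero_left
        act.act_zero_right)
qed

text \<open>\<open>R'\<close> stands for the truncated algebra: a smaller carrier with the addition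
  of \<open>R\<close>, while components are still taken in \<open>R\<close>.\<close>

lemma trunc_module_biadditive_action:
  assumes R: "graded_group R rgr" and M: "graded_group M mgr" and act: "biadditive_action R M"
    and gr: "\<And>i j x a. \<lbrakk>x \<in> mgr i; a \<in> rgr j\<rbrakk> \<Longrightarrow> x \<triangleleft>\<^bsub>M\<^esub> a \<in> mgr (i + j)"
    and R': "abelian_group R'" "carrier R' \<subseteq> carrier R" "add R' = add R"
  shows "biadditive_action R' (trunc_module R rgr M mgr S)"
proof -
  interpret R: graded_group R rgr by fact
  interpret M: graded_group M mgr by fact
  interpret act: biadditive_action R M by fact
  interpret R': abelian_group R' by fact
  let ?T = "trunc_module R rgr M mgr S"
  have T: "carrier ?T = trunc_carrier M mgr S" "\<zero>\<^bsub>?T\<^esub> = \<zero>\<^bsub>M\<^esub>" "add ?T = add M"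
    by (simp_all add: trunc_module_def)
  interpret T: graded_group ?T "trunc_grading M mgr S"
    by (rule M.trunc_graded_group[OF T])
  let ?t = "\<lambda>x a (i, j). M.comp x i \<triangleleft>\<^bsub>M\<^esub> R.comp a j"
  have t: "?t x a p \<in> carrier M" if "x \<in> carrier M" "a \<in> carrier R" for x a p
    using that by (auto simp: act.act_closed M.comp_closed R.comp_closed split: prod.split)
  \<comment> \<open>The defining sum runs over supports, which vary with the elements. Rewritten
    over arbitrary finite sets containing the supports, the sums for two elements and for their sum
    acquire a common index set.\<close>
  have ract: "x \<triangleleft>\<^bsub>?T\<^esub> a = (\<Oplus>\<^bsub>M\<^esub>p\<in>{(i, j). i \<in> I \<and> j \<in> J \<and> i + j \<in> S}. ?t x a p)"
    if x: "x \<in> carrier M" and a: "a \<in> carrier R" and IJ: "finite I" "finite J"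
      "{i. M.comp x i \<noteq> \<zero>\<^bsub>M\<^esub>} \<subseteq> I" "{j. R.comp a j \<noteq> \<zero>\<^bsub>R\<^esub>} \<subseteq> J" for x a I J
  proof -
    have fin: "finite {(i, j). i \<in> I \<and> j \<in> J \<and> i + j \<in> S}"
      by (rule finite_subset[of _ "I \<times> J"]) (use IJ in auto)
    have "x \<triangleleft>\<^bsub>?T\<^esub> a = (\<Oplus>\<^bsub>M\<^esub>p\<in>{(i, j). M.comp x i \<noteq> \<zero>\<^bsub>M\<^esub> \<and> R.comp a j \<noteq> \<zero>\<^bsub>R\<^esub> \<and> i + j \<in> S}. ?t x a p)"
      by (simp add: trunc_module_def)
    also have "\<dots> = (\<Oplus>\<^bsub>M\<^esub>p\<in>{(i, j). i \<in> I \<and> j \<in> J \<and> i + j \<in> S}. ?t x a p)"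
    proof (rule M.add.finprod_mono_neutral_cong_left[OF fin])
      show "?t x a p = \<zero>\<^bsub>M\<^esub>" if "p \<in> {(i, j). i \<in> I \<and> j \<in> J \<and> i + j \<in> S} -
          {(i, j). M.comp x i \<noteq> \<zero>\<^bsub>M\<^esub> \<and> R.comp a j \<noteq> \<zero>\<^bsub>R\<^esub> \<and> i + j \<in> S}" for p
        using that M.comp_closed[OF x] R.comp_closed[OF a] by (auto simp: act.act_zero_left act.act_zero_right)
    qed (use IJ(3,4) t[OF x a] in auto)
    finally show ?thesis .
  qed
  have Tc: "x \<in> carrier M" if "x \<in> carrier ?T" for x using that T by (simp add: trunc_carrier_def)
  have R'c: "a \<in> carrier R" if "a \<in> carrier R'" for a using that R' by blast
  let ?X = "\<lambda>x. {i. M.comp x i \<noteq> \<zero>\<^bsub>M\<^esub>}" and ?A = "\<lambda>a. {j. R.comp a j \<noteq> \<zero>\<^bsub>R\<^esub>}"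
  show ?thesis
  proof unfold_locales
    fix x a assume x: "x \<in> carrier ?T" and a: "a \<in> carrier R'"
    note xa = Tc[OF x] R'c[OF a]
    have "?t x a p \<in> carrier ?T" if p': "p \<in> {(i, j). i \<in> ?X x \<and> j \<in> ?A a \<and> i + j \<in> S}" for p
    proof -
      obtain i j where p: "p = (i, j)" "i + j \<in> S" using p' by blast
      have "?t x a p \<in> mgr (i + j)"
        using p gr[OF M.comp_gr R.comp_gr] xa by simp
      then show ?thesis using p M.trunc_grading_subset[of S "i + j"] T by (auto simp: trunc_grading_def)
    qed
    then show "x \<triangleleft>\<^bsub>?T\<^esub> a \<in> carrier ?T"
      unfolding ract[OF xa M.finite_support[OF xa(1)] R.finite_support[OF xa(2)] order.refl order.refl]
        T(1)
      by (intro M.finsum_in_subgroup[OF M.trunc_carrier_subgroup])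
  next
    fix x y a assume *: "x \<in> carrier ?T" "y \<in> carrier ?T" "a \<in> carrier R'"
    note c = Tc[OF *(1)] Tc[OF *(2)] R'c[OF *(3)]
    let ?I = "?X x \<union> ?X y"
    have I: "finite ?I" "?X (x \<oplus>\<^bsub>M\<^esub> y) \<subseteq> ?I"
      using c M.finite_support by (auto simp: M.comp_add)
    let ?P = "{(i, j). i \<in> ?I \<and> j \<in> ?A a \<and> i + j \<in> S}"
    have "(\<Oplus>\<^bsub>M\<^esub>p\<in>?P. ?t (x \<oplus>\<^bsub>M\<^esub> y) a p) = (\<Oplus>\<^bsub>M\<^esub>p\<in>?P. ?t x a p \<oplus>\<^bsub>M\<^esub> ?t y a p)"
      using c by (intro M.finsum_cong')
        (auto simp: M.comp_add act.act_add_left M.comp_closed R.comp_closed act.act_closed)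
    also have "\<dots> = (\<Oplus>\<^bsub>M\<^esub>p\<in>?P. ?t x a p) \<oplus>\<^bsub>M\<^esub> (\<Oplus>\<^bsub>M\<^esub>p\<in>?P. ?t y a p)"
      using t[OF c(1,3)] t[OF c(2,3)] by (intro M.finsum_addf) auto
    finally show "(x \<oplus>\<^bsub>?T\<^esub> y) \<triangleleft>\<^bsub>?T\<^esub> a = x \<triangleleft>\<^bsub>?T\<^esub> a \<oplus>\<^bsub>?T\<^esub> y \<triangleleft>\<^bsub>?T\<^esub> a"
      using ract[of x a ?I "?A a"] ract[of y a ?I "?A a"] ract[of "x \<oplus>\<^bsub>M\<^esub> y" a ?I "?A a"] c I
        R.finite_support[OF c(3)] by (simp add: T)
  next
    fix x a b assume *: "x \<in> carrier ?T" "a \<in> carrier R'" "b \<in> carrier R'"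
    note c = Tc[OF *(1)] R'c[OF *(2)] R'c[OF *(3)]
    let ?J = "?A a \<union> ?A b"
    have J: "finite ?J" "?A (a \<oplus>\<^bsub>R\<^esub> b) \<subseteq> ?J"
      using c R.finite_support by (auto simp: R.comp_add)
    let ?P = "{(i, j). i \<in> ?X x \<and> j \<in> ?J \<and> i + j \<in> S}"
    have "(\<Oplus>\<^bsub>M\<^esub>p\<in>?P. ?t x (a \<oplus>\<^bsub>R\<^esub> b) p) = (\<Oplus>\<^bsub>M\<^esub>p\<in>?P. ?t x a p \<oplus>\<^bsub>M\<^esub> ?t x b p)"
      using c by (intro M.finsum_cong')
        (auto simp: R.comp_add act.act_add_right M.comp_closed R.comp_closed act.act_closed)
    also have "\<dots> = (\<Oplus>\<^bsub>M\<^esub>p\<in>?P. ?t x a p) \<oplus>\<^bsub>M\<^esub> (\<Oplus>\<^bsub>M\<^esub>p\<in>?P. ?t x b p)"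
      using t[OF c(1,2)] t[OF c(1,3)] by (intro M.finsum_addf) auto
    finally show "x \<triangleleft>\<^bsub>?T\<^esub> (a \<oplus>\<^bsub>R'\<^esub> b) = x \<triangleleft>\<^bsub>?T\<^esub> a \<oplus>\<^bsub>?T\<^esub> x \<triangleleft>\<^bsub>?T\<^esub> b"
      using ract[of x a "?X x" ?J] ract[of x b "?X x" ?J] ract[of x "a \<oplus>\<^bsub>R\<^esub> b" "?X x" ?J] c J
        M.finite_support[OF c(1)] by (simp add: T R'(3))
  qed
qed

section \<open>Evaluating formal sums of pairs\<close>

text \<open>The additive extension of \<open>\<phi>\<close> from generators to formal sums, in the
  form in which \<open>mu\<close> spells it out.\<close>

definition frag_sum :: "('g, 'p) ring_scheme \<Rightarrow> ('b \<Rightarrow> 'g) \<Rightarrow> ('b \<Rightarrow>\<^sub>0 int) \<Rightarrow> 'g" where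
  "frag_sum G \<phi> f = finsum G (\<lambda>p. [Poly_Mapping.lookup f p] \<cdot>\<^bsub>G\<^esub> \<phi> p) (Poly_Mapping.keys f)"

context abelian_group
begin

lemma frag_sum_superset:
  assumes "\<phi> \<in> T \<rightarrow> carrier G" "Poly_Mapping.keys f \<subseteq> I" "I \<subseteq> T" "finite I"
  shows "frag_sum G \<phi> f = finsum G (\<lambda>p. [Poly_Mapping.lookup f p] \<cdot> \<phi> p) I"
  unfolding frag_sum_def
proof (rule add.finprod_mono_neutral_cong_left[OF assms(4,2)])
  fix p assume "p \<in> I - Poly_Mapping.keys f"
  then have "Poly_Mapping.lookup f p = 0" by (simp add: in_keys_iff)
  then show "[Poly_Mapping.lookup f p] \<cdot> \<phi> p = \<zero>" by (simp add: add_pow_def int_pow_def)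
next
  show "(\<lambda>p. [Poly_Mapping.lookup f p] \<cdot> \<phi> p) \<in> I \<rightarrow> carrier G"
    using assms(1,3) by (auto intro!: add.int_pow_closed)
qed simp

lemma frag_sum_zero: "frag_sum G \<phi> 0 = \<zero>"
  by (simp add: frag_sum_def)

lemma frag_sum_of: "\<phi> p \<in> carrier G \<Longrightarrow> frag_sum G \<phi> (frag_of p) = \<phi> p"
  by (simp add: frag_sum_def add.int_pow_1)

lemma frag_sum_closed:
  assumes "\<phi> \<in> T \<rightarrow> carrier G" "Poly_Mapping.keys f \<subseteq> T"
  shows "frag_sum G \<phi> f \<in> carrier G"
  unfolding frag_sum_def using assms by (intro finsum_closed) (auto intro!: add.int_pow_closed)

lemma frag_sum_add:
  assumes \<phi>: "\<phi> \<in> T \<rightarrow> carrier G" and f: "Poly_Mapping.keys f \<subseteq> T" and g: "Poly_Mapping.keys g \<subseteq> T"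
  shows "frag_sum G \<phi> (f + g) = frag_sum G \<phi> f \<oplus> frag_sum G \<phi> g"
proof -
  let ?I = "Poly_Mapping.keys f \<union> Poly_Mapping.keys g"
  have I: "?I \<subseteq> T" "finite ?I" using f g by auto
  have \<phi>I: "\<phi> p \<in> carrier G" if "p \<in> ?I" for p using that I \<phi> by blast
  have "frag_sum G \<phi> (f + g) = finsum G (\<lambda>p. [Poly_Mapping.lookup (f + g) p] \<cdot> \<phi> p) ?I"
    using Poly_Mapping.keys_add[of f g] by (intro frag_sum_superset[OF \<phi> _ I])
  also have "\<dots> = finsum G (\<lambda>p. [Poly_Mapping.lookup f p] \<cdot> \<phi> p \<oplus> [Poly_Mapping.lookup g p] \<cdot> \<phi> p) ?I"
    using \<phi>I by (intro finsum_cong') (auto simp: lookup_add add.int_pow_mult intro!: add.int_pow_closed)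
  also have "\<dots> = finsum G (\<lambda>p. [Poly_Mapping.lookup f p] \<cdot> \<phi> p) ?I \<oplus>
      finsum G (\<lambda>p. [Poly_Mapping.lookup g p] \<cdot> \<phi> p) ?I"
    using \<phi>I by (intro finsum_addf) (auto intro!: add.int_pow_closed)
  also have "\<dots> = frag_sum G \<phi> f \<oplus> frag_sum G \<phi> g"
    using frag_sum_superset[OF \<phi> _ I, of f] frag_sum_superset[OF \<phi> _ I, of g] by simp
  finally show ?thesis .
qed

lemma frag_sum_diff:
  assumes \<phi>: "\<phi> \<in> T \<rightarrow> carrier G" and f: "Poly_Mapping.keys f \<subseteq> T" and g: "Poly_Mapping.keys g \<subseteq> T"
  shows "frag_sum G \<phi> (f - g) = frag_sum G \<phi> f \<ominus> frag_sum G \<phi> g"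
proof -
  have fg: "Poly_Mapping.keys (f - g) \<subseteq> T" using f g keys_diff[of f g] by blast
  have "frag_sum G \<phi> f = frag_sum G \<phi> (f - g) \<oplus> frag_sum G \<phi> g"
    using frag_sum_add[OF \<phi> fg g] by simp
  then show ?thesis
    using frag_sum_closed[OF \<phi> g] frag_sum_closed[OF \<phi> fg]
    by (simp add: minus_eq a_assoc r_neg)
qed

end

lemma frag_induct_on [consumes 1, case_names zero one diff]:
  assumes "Poly_Mapping.keys f \<subseteq> T" "P 0" "\<And>p. p \<in> T \<Longrightarrow> P (frag_of p)"
    "\<And>f g. \<lbrakk>Poly_Mapping.keys f \<subseteq> T; Poly_Mapping.keys g \<subseteq> T; P f; P g\<rbrakk> \<Longrightarrow> P (f - g)"
  shows "P f"
proof -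
  have "Poly_Mapping.keys f \<subseteq> T \<and> P f"
    using assms(1)
  proof (induction rule: frag_induction)
    case (diff a b)
    then show ?case using assms(4) keys_diff[of a b] by blast
  qed (use assms in \<open>auto simp: keys_frag_of\<close>)
  then show ?thesis by simp
qed

lemma additive_map_frag_sum:
  assumes h: "additive_map G H h" and \<phi>: "\<phi> \<in> T \<rightarrow> carrier G" and f: "Poly_Mapping.keys f \<subseteq> T"
  shows "h (frag_sum G \<phi> f) = frag_sum H (\<lambda>p. h (\<phi> p)) f"
proof -
  interpret additive_map G H h by fact
  have h\<phi>: "(\<lambda>p. h (\<phi> p)) \<in> T \<rightarrow> carrier H" using \<phi> map_closed by blast
  show ?thesis using f
  proof (induction rule: frag_induct_on)
    case (one p)
    then show ?case using \<phi> h\<phi> by (auto simp: G.frag_sum_of H.frag_sum_of Pi_iff)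
  next
    case (diff f g)
    then show ?case
      by (simp add: G.frag_sum_diff[OF \<phi>] H.frag_sum_diff[OF h\<phi>] G.frag_sum_closed[OF \<phi>] map_minus)
  qed (simp add: G.frag_sum_zero H.frag_sum_zero map_zero)
qed

context abelian_group
begin

lemma frag_sum_extend:
  assumes \<sigma>: "\<sigma> \<in> T \<rightarrow> T'" and \<phi>: "\<phi> \<in> T' \<rightarrow> carrier G" and f: "Poly_Mapping.keys f \<subseteq> T"
  shows "Poly_Mapping.keys (frag_extend (\<lambda>p. frag_of (\<sigma> p)) f) \<subseteq> T'"
    and "frag_sum G \<phi> (frag_extend (\<lambda>p. frag_of (\<sigma> p)) f) = frag_sum G (\<lambda>p. \<phi> (\<sigma> p)) f"
proof -
  have \<phi>\<sigma>: "(\<lambda>p. \<phi> (\<sigma> p)) \<in> T \<rightarrow> carrier G" using \<sigma> \<phi> by blast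
  have keys: "Poly_Mapping.keys (frag_extend (\<lambda>p. frag_of (\<sigma> p)) f) \<subseteq> T'"
    if "Poly_Mapping.keys f \<subseteq> T" for f
    using keys_frag_extend[of "\<lambda>p. frag_of (\<sigma> p)" f] that \<sigma> by (auto simp: keys_frag_of)
  then show "Poly_Mapping.keys (frag_extend (\<lambda>p. frag_of (\<sigma> p)) f) \<subseteq> T'" using f .
  show "frag_sum G \<phi> (frag_extend (\<lambda>p. frag_of (\<sigma> p)) f) = frag_sum G (\<lambda>p. \<phi> (\<sigma> p)) f"
    using f
  proof (induction rule: frag_induct_on)
    case (one p)
    then show ?case using \<sigma> \<phi> by (simp add: frag_sum_of Pi_iff)
  next
    case (diff f g)
    then show ?case
      by (simp add: frag_extend_diff frag_sum_diff[OF \<phi>] frag_sum_diff[OF \<phi>\<sigma>] keys)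
  qed (simp add: frag_sum_zero)
qed

lemma frag_sum_cong:
  assumes "\<phi> \<in> T \<rightarrow> carrier G" "Poly_Mapping.keys f \<subseteq> T" "\<And>p. p \<in> T \<Longrightarrow> \<psi> p = \<phi> p"
  shows "frag_sum G \<psi> f = frag_sum G \<phi> f"
  unfolding frag_sum_def using assms
  by (intro finsum_cong') (auto intro!: add.int_pow_closed simp: subset_iff)

lemma frag_sum_add_fun:
  assumes \<phi>: "\<phi> \<in> T \<rightarrow> carrier G" and \<psi>: "\<psi> \<in> T \<rightarrow> carrier G" and f: "Poly_Mapping.keys f \<subseteq> T"
  shows "frag_sum G (\<lambda>p. \<phi> p \<oplus> \<psi> p) f = frag_sum G \<phi> f \<oplus> frag_sum G \<psi> f"
proof -
  have c: "\<phi> p \<in> carrier G" "\<psi> p \<in> carrier G" if "p \<in> Poly_Mapping.keys f" for p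
    using that assms by blast+
  have "frag_sum G (\<lambda>p. \<phi> p \<oplus> \<psi> p) f = finsum G (\<lambda>p. [Poly_Mapping.lookup f p] \<cdot> \<phi> p \<oplus>
      [Poly_Mapping.lookup f p] \<cdot> \<psi> p) (Poly_Mapping.keys f)"
    unfolding frag_sum_def using c
    by (intro finsum_cong') (auto simp: add.int_pow_distrib intro!: add.int_pow_closed)
  then show ?thesis
    unfolding frag_sum_def using c by (simp add: finsum_addf add.int_pow_closed)
qed

lemma frag_sum_in_subgroup:
  assumes H: "additive_subgroup H G" and "\<phi> \<in> T \<rightarrow> H" "Poly_Mapping.keys f \<subseteq> T"
  shows "frag_sum G \<phi> f \<in> H"
proof -
  have \<phi>: "\<phi> \<in> T \<rightarrow> carrier G" using assms(2) additive_subgroup.a_subset[OF H] by blast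
  show ?thesis using assms(3)
  proof (induction rule: frag_induct_on)
    case (diff f g)
    then show ?case by (simp add: frag_sum_diff[OF \<phi>] additive_subgroup_minus[OF H])
  qed (use assms(2) \<phi> in \<open>auto simp: frag_sum_zero frag_sum_of Pi_iff additive_subgroup.zero_closed[OF H]\<close>)
qed

lemma frag_sum_image_subgroup:
  assumes \<phi>: "\<phi> \<in> T \<rightarrow> carrier G"
  shows "additive_subgroup (frag_sum G \<phi> ` {f. Poly_Mapping.keys f \<subseteq> T}) G"
proof (rule additive_subgroup_minusI)
  fix x y assume "x \<in> frag_sum G \<phi> ` {f. Poly_Mapping.keys f \<subseteq> T}"
    "y \<in> frag_sum G \<phi> ` {f. Poly_Mapping.keys f \<subseteq> T}"
  then obtain f g where fg: "Poly_Mapping.keys f \<subseteq> T" "Poly_Mapping.keys g \<subseteq> T"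
    "x = frag_sum G \<phi> f" "y = frag_sum G \<phi> g" by blast
  then have "x \<ominus> y = frag_sum G \<phi> (f - g)" by (simp add: frag_sum_diff[OF \<phi>])
  moreover have "Poly_Mapping.keys (f - g) \<subseteq> T" using fg keys_diff[of f g] by blast
  ultimately show "x \<ominus> y \<in> frag_sum G \<phi> ` {f. Poly_Mapping.keys f \<subseteq> T}" by blast
next
  show "\<zero> \<in> frag_sum G \<phi> ` {f. Poly_Mapping.keys f \<subseteq> T}"
    by (rule image_eqI[of _ _ 0]) (simp_all add: frag_sum_zero)
qed (use frag_sum_closed[OF \<phi>] in blast)

end

section \<open>Algebras generated in degrees 0 and 1\<close>

context graded_ring
begin

text \<open>This is the group \<open>A\<^sub>i A\<^sub>j\<close>. As an image of formal sums it is a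
  subgroup by \<open>frag_sum_image_subgroup\<close> and admits induction over products and
  differences.\<close>

definition products :: "int \<Rightarrow> int \<Rightarrow> 'a set" where
  "products i j = frag_sum R (\<lambda>(a, b). a \<otimes> b) ` {f. Poly_Mapping.keys f \<subseteq> gr i \<times> gr j}"

lemma mult_fun: "(\<lambda>(a, b). a \<otimes> b) \<in> gr i \<times> gr j \<rightarrow> carrier R"
  using gr_carrier by auto

lemma products_subgroup: "additive_subgroup (products i j) R"
  unfolding products_def by (rule frag_sum_image_subgroup[OF mult_fun])

lemma products_mult: "a \<in> gr i \<Longrightarrow> b \<in> gr j \<Longrightarrow> a \<otimes> b \<in> products i j"
  unfolding products_def using gr_carrier
  by (intro image_eqI[of _ _ "frag_of (a, b)"]) (simp_all add: frag_sum_of keys_frag_of)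

lemma products_induct [consumes 1, case_names mult diff]:
  assumes "x \<in> products i j" "\<And>a b. a \<in> gr i \<Longrightarrow> b \<in> gr j \<Longrightarrow> P (a \<otimes> b)"
    "\<And>x y. \<lbrakk>x \<in> products i j; y \<in> products i j; P x; P y\<rbrakk> \<Longrightarrow> P (x \<ominus> y)"
  shows "P x"
proof -
  obtain f where "Poly_Mapping.keys f \<subseteq> gr i \<times> gr j" "x = frag_sum R (\<lambda>(a, b). a \<otimes> b) f"
    using assms(1) by (auto simp: products_def)
  moreover from this(1) have "P (frag_sum R (\<lambda>(a, b). a \<otimes> b) f)"
  proof (induction rule: frag_induct_on)
    case zero
    have "P (\<zero> \<otimes> \<zero>)" using assms(2) gr_zero by blast
    then show ?case by (simp add: frag_sum_zero)
  next
    case (one p)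
    then show ?case using assms(2) gr_carrier by (auto simp: frag_sum_of)
  next
    case (diff f g)
    then show ?case unfolding frag_sum_diff[OF mult_fun diff(1,2)]
      by (intro assms(3)) (auto simp: products_def)
  qed
  ultimately show ?thesis by simp
qed

lemma additive_map_mult_left: "a \<in> carrier R \<Longrightarrow> additive_map R R (\<lambda>x. a \<otimes> x)"
  by unfold_locales (simp_all add: r_distr)

lemma additive_map_mult_right: "a \<in> carrier R \<Longrightarrow> additive_map R R (\<lambda>x. x \<otimes> a)"
  by unfold_locales (simp_all add: l_distr)

lemma products_carrier: "x \<in> products i j \<Longrightarrow> x \<in> carrier R"
  using additive_subgroup.a_subset[OF products_subgroup] by blast

lemma products_mult_right:
  assumes "x \<in> products i j" "b \<in> gr k"
  shows "x \<otimes> b \<in> products i (j + k)"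
  using assms(1)
proof (induction rule: products_induct)
  case (mult a c)
  then show ?case
    using assms(2) products_mult[OF mult(1) gr_mult[OF mult(2) assms(2)]] gr_carrier m_assoc by metis
next
  case (diff x y)
  then show ?case
    using additive_map.map_minus[OF additive_map_mult_right[OF gr_carrier[OF assms(2)]]]
      additive_subgroup_minus[OF products_subgroup] products_carrier by metis
qed

lemma products_mult_left:
  assumes "x \<in> products i j" "b \<in> gr k"
  shows "b \<otimes> x \<in> products (k + i) j"
  using assms(1)
proof (induction rule: products_induct)
  case (mult a c)
  then show ?case
    using assms(2) products_mult[OF gr_mult[OF assms(2) mult(1)] mult(2)] gr_carrier m_assoc by metis
next
  case (diff x y)
  then show ?case
    using additive_map.map_minus[OF additive_map_mult_left[OF gr_carrier[OF assms(2)]]]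
      additive_subgroup_minus[OF products_subgroup] products_carrier by metis
qed

lemma carrier_subgroup: "additive_subgroup (carrier R) R"
  by (rule additive_subgroup_minusI) auto

text \<open>The elements whose component in each positive degree \<open>n\<close> lies in
  \<open>A\<^sub>n\<^sub>-\<^sub>1 A\<^sub>1\<close> form a subring that contains degrees 0 and 1,
  hence the whole ring.\<close>

lemma gr_eq_products_1:
  assumes gen: "generated_in_degrees_0_1 R gr" and neg: "\<And>i. i < 0 \<Longrightarrow> gr i = {\<zero>}" and n: "0 < n"
    and x: "x \<in> gr n"
  shows "x \<in> products (n - 1) 1"
proof -
  \<comment> \<open>Degrees at most 0 are left unconstrained, so that \<open>\<one>\<close> and
    \<open>gr 0\<close> belong to the subring.\<close>
  define W where "W n = (if 0 < n then products (n - 1) 1 else carrier R)" for n :: int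
  have W: "additive_subgroup (W n) R" for n
    by (simp add: W_def products_subgroup carrier_subgroup)
  let ?T = "{x \<in> carrier R. \<forall>n. comp x n \<in> W n}"
  have T: "additive_subgroup ?T R" by (rule additive_subgroup_components[OF W])
  have T_hom: "x \<in> ?T" if "x \<in> gr i" "0 < i \<Longrightarrow> x \<in> products (i - 1) 1" for x i
  proof -
    have "comp x n \<in> W n" for n
      using that additive_subgroup.zero_closed[OF products_subgroup] gr_carrier
      by (auto simp: comp_homogeneous W_def)
    then show ?thesis using that gr_carrier by simp
  qed
  have T_mult_hom: "x \<otimes> y \<in> ?T"
    if x: "x \<in> gr i" "0 < i \<Longrightarrow> x \<in> products (i - 1) 1"
      and y: "y \<in> gr j" "0 < j \<Longrightarrow> y \<in> products (j - 1) 1" for x y i j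
  \<comment> \<open>A factor of negative degree is 0. Once this is excluded,
    \<open>0 < i + j\<close> and \<open>\<not> 0 < j\<close> force \<open>j = 0\<close> and
    \<open>0 < i\<close>.\<close>
  proof (cases "i < 0 \<or> j < 0")
    case True
    then have "x = \<zero> \<or> y = \<zero>" using neg x y by blast
    then have "x \<otimes> y = \<zero>" using x(1) y(1) gr_carrier by auto
    then show ?thesis using additive_subgroup.zero_closed[OF T] by simp
  next
    case False
    show ?thesis
    proof (rule T_hom[OF gr_mult[OF x(1) y(1)]])
      assume "0 < i + j"
      show "x \<otimes> y \<in> products (i + j - 1) 1"
      \<comment> \<open>The last factor of degree 1 comes from \<open>y\<close> if \<open>y\<close>
        has positive degree; otherwise \<open>y\<close> has degree 0 and is absorbed into the last
        factor of \<open>x\<close>.\<close>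
      proof (cases "0 < j")
        case True
        then show ?thesis using products_mult_left[OF y(2) x(1)] by (simp add: algebra_simps)
      next
        case False
        with \<open>\<not> (i < 0 \<or> j < 0)\<close> \<open>0 < i + j\<close> have "j = 0" "0 < i" by auto
        then show ?thesis using products_mult_right[OF x(2) y(1)] by simp
      qed
    qed
  qed
  have T_pieces: "comp x i \<in> gr i" "0 < i \<Longrightarrow> comp x i \<in> products (i - 1) 1" if "x \<in> ?T" for x i
    using that comp_gr by (auto simp: W_def split: if_splits)
  have T_mult: "x \<otimes> y \<in> ?T" if x: "x \<in> ?T" and y: "y \<in> ?T" for x y
  proof -
    have xy: "x \<in> carrier R" "y \<in> carrier R" using x y by auto
    have 1: "comp x i \<otimes> y \<in> ?T" for i
    proof -
      have "comp x i \<otimes> y = comp x i \<otimes> (\<Oplus>j\<in>{j. comp y j \<noteq> \<zero>}. comp y j)"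
        using finsum_support[OF xy(2)] by simp
      also have "\<dots> = (\<Oplus>j\<in>{j. comp y j \<noteq> \<zero>}. comp x i \<otimes> comp y j)"
        using xy by (intro additive_map.map_finsum additive_map_mult_left comp_closed)
      also have "\<dots> \<in> ?T"
        using T_mult_hom[OF T_pieces[OF x] T_pieces[OF y]] by (intro finsum_in_subgroup[OF T]) blast
      finally show ?thesis .
    qed
    have "x \<otimes> y = (\<Oplus>i\<in>{i. comp x i \<noteq> \<zero>}. comp x i) \<otimes> y"
      using finsum_support[OF xy(1)] by simp
    also have "\<dots> = (\<Oplus>i\<in>{i. comp x i \<noteq> \<zero>}. comp x i \<otimes> y)"
      using xy by (intro additive_map.map_finsum[OF additive_map_mult_right] comp_closed)
    also have "\<dots> \<in> ?T" using 1 by (intro finsum_in_subgroup[OF T])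
    finally show ?thesis .
  qed
  have one: "\<one> \<in> ?T" by (rule T_hom[OF gr_one]) simp
  have "generate_ring R (gr 0 \<union> gr 1) \<subseteq> ?T"
  proof
    fix x assume "x \<in> generate_ring R (gr 0 \<union> gr 1)"
    then show "x \<in> ?T"
    proof induction
      case (incl h)
      then show ?case
      proof
        assume "h \<in> gr 0"
        then show ?thesis by (rule T_hom) simp
      next
        assume h: "h \<in> gr 1"
        then show ?thesis
          using products_mult[OF gr_one h] gr_carrier by (intro T_hom[OF h]) simp
      qed
    next
      case (a_inv h)
      then have "\<zero> \<ominus> h \<in> ?T"
        by (intro additive_subgroup_minus[OF T] additive_subgroup.zero_closed[OF T])
      moreover have "\<zero> \<ominus> h = \<ominus> h" using a_inv by (simp add: minus_eq)
      ultimately show ?case by simp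
    next
      case (eng_add h1 h2)
      then show ?case using additive_subgroup.a_closed[OF T] by blast
    next
      case (eng_mult h1 h2)
      then show ?case by (intro T_mult)
    qed (rule one)
  qed
  then have "x \<in> ?T" using gen gr_carrier[OF x] by (auto simp: generated_in_degrees_0_1_def)
  then have "comp x n \<in> W n" by blast
  then show ?thesis using n x by (simp add: W_def comp_homogeneous)
qed

text \<open>One factor of degree 1 is split off on the right at a time, and collected again in the
  second factor by \<open>products_mult_right\<close>. The base case is
  \<open>x = x \<otimes> \<one>\<close>.\<close>

lemma gr_eq_products:
  assumes gen: "generated_in_degrees_0_1 R gr" and neg: "\<And>i. i < 0 \<Longrightarrow> gr i = {\<zero>}"
    and "0 \<le> p" "0 \<le> q" and x: "x \<in> gr (p + q)"
  shows "x \<in> products p q"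
  using \<open>0 \<le> q\<close> x
proof (induction q arbitrary: x rule: int_ge_induct)
  case base
  then show ?case using products_mult[OF _ gr_one, of x p] gr_carrier by auto
next
  case (step q)
  have "x \<in> products (p + q) 1"
    using gr_eq_products_1[OF gen neg, of "p + (q + 1)"] step assms(3) by (simp add: algebra_simps)
  then show ?case
  proof (induction rule: products_induct)
    case (mult a b)
    then show ?case using products_mult_right step.IH by blast
  next
    case (diff x y)
    then show ?case by (intro additive_subgroup_minus[OF products_subgroup])
  qed
qed

end

section \<open>Modules over truncated algebras\<close>

locale truncated_module = A: graded_ring A gr +
  X: graded_right_module "trunc_algebra A gr U" "trunc_grading A gr U" X xgr
  for A :: "('k, 'a, 'p) module_scheme" and gr and U
    and X :: "('a, 'x, 'q) right_module_scheme" and xgr +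
  assumes zero_in_U: "0 \<in> U"
begin

lemma gr_trunc_algebra:
  assumes "u \<in> U" "a \<in> gr u"
  shows "a \<in> trunc_grading A gr U u" and "a \<in> carrier (trunc_algebra A gr U)"
  using assms A.trunc_grading_subset[of U u] by (auto simp: trunc_grading_def trunc_algebra_def)

lemma act_gr: "\<lbrakk>x \<in> xgr s; a \<in> gr u; u \<in> U\<rbrakk> \<Longrightarrow> x \<triangleleft>\<^bsub>X\<^esub> a \<in> xgr (s + u)"
  using X.gr_ract gr_trunc_algebra by blast

lemma act_closed: "\<lbrakk>x \<in> carrier X; a \<in> gr u; u \<in> U\<rbrakk> \<Longrightarrow> x \<triangleleft>\<^bsub>X\<^esub> a \<in> carrier X"
  using X.ract_closed gr_trunc_algebra by blast

lemma act_add_left: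
  "\<lbrakk>x \<in> carrier X; y \<in> carrier X; a \<in> gr u; u \<in> U\<rbrakk> \<Longrightarrow>
    (x \<oplus>\<^bsub>X\<^esub> y) \<triangleleft>\<^bsub>X\<^esub> a = x \<triangleleft>\<^bsub>X\<^esub> a \<oplus>\<^bsub>X\<^esub> y \<triangleleft>\<^bsub>X\<^esub> a"
  using X.ract_add_left gr_trunc_algebra by blast

lemma act_add_right:
  "\<lbrakk>x \<in> carrier X; a \<in> gr u; b \<in> gr u; u \<in> U\<rbrakk> \<Longrightarrow>
    x \<triangleleft>\<^bsub>X\<^esub> (a \<oplus>\<^bsub>A\<^esub> b) = x \<triangleleft>\<^bsub>X\<^esub> a \<oplus>\<^bsub>X\<^esub> x \<triangleleft>\<^bsub>X\<^esub> b"
  using X.ract_add_right[of x a b] gr_trunc_algebra by (simp add: trunc_algebra_def)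

lemma act_assoc:
  assumes "x \<in> carrier X" "a \<in> gr u" "b \<in> gr v" "u \<in> U" "v \<in> U"
  shows "(x \<triangleleft>\<^bsub>X\<^esub> a) \<triangleleft>\<^bsub>X\<^esub> b = (if u + v \<in> U then x \<triangleleft>\<^bsub>X\<^esub> (a \<otimes>\<^bsub>A\<^esub> b) else \<zero>\<^bsub>X\<^esub>)"
proof -
  interpret act: biadditive_action "trunc_algebra A gr U" X by (rule X.biadditive_action)
  have "x \<triangleleft>\<^bsub>X\<^esub> \<zero>\<^bsub>A\<^esub> = \<zero>\<^bsub>X\<^esub>"
    using act.act_zero_right[OF assms(1)] by (simp add: trunc_algebra_def)
  then show ?thesis
    using X.ract_assoc[OF assms(1) gr_trunc_algebra(2) gr_trunc_algebra(2), of u a v b] assms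
    by (simp add: trunc_algebra_mult[OF A.graded_ring_axioms])
qed

lemma act_one: "x \<in> carrier X \<Longrightarrow> x \<triangleleft>\<^bsub>X\<^esub> \<one>\<^bsub>A\<^esub> = x"
  using X.ract_one by (simp add: trunc_algebra_def)

lemma additive_map_act: "\<lbrakk>a \<in> gr u; u \<in> U\<rbrakk> \<Longrightarrow> additive_map X X (\<lambda>x. x \<triangleleft>\<^bsub>X\<^esub> a)"
  by (intro additive_map.intro additive_map_axioms.intro X.M.abelian_group_axioms)
     (auto simp: act_closed act_add_left)

text \<open>Subtraction in the truncated algebra is formed with inverses in its own carrier, so it
  is not literally that of \<open>A\<close>. Additivity within a single degree avoids comparing the
  two.\<close>

lemma act_minus_right:
  assumes "x \<in> carrier X" "a \<in> gr u" "b \<in> gr u" "u \<in> U"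
  shows "x \<triangleleft>\<^bsub>X\<^esub> (a \<ominus>\<^bsub>A\<^esub> b) = x \<triangleleft>\<^bsub>X\<^esub> a \<ominus>\<^bsub>X\<^esub> x \<triangleleft>\<^bsub>X\<^esub> b"
proof -
  have "a = (a \<ominus>\<^bsub>A\<^esub> b) \<oplus>\<^bsub>A\<^esub> b"
    using assms A.gr_carrier by (simp add: A.minus_eq A.a_assoc A.l_neg)
  then have "x \<triangleleft>\<^bsub>X\<^esub> a = x \<triangleleft>\<^bsub>X\<^esub> (a \<ominus>\<^bsub>A\<^esub> b) \<oplus>\<^bsub>X\<^esub> x \<triangleleft>\<^bsub>X\<^esub> b"
    using act_add_right[OF assms(1) A.gr_minus[OF assms(2,3)] assms(3,4)] by simp
  moreover have "x \<triangleleft>\<^bsub>X\<^esub> (a \<ominus>\<^bsub>A\<^esub> b) \<in> carrier X" "x \<triangleleft>\<^bsub>X\<^esub> b \<in> carrier X"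
    using act_closed[OF assms(1) A.gr_minus[OF assms(2,3)] assms(4)] act_closed assms by auto
  ultimately show ?thesis by (simp add: X.M.minus_eq X.M.a_assoc X.M.r_neg)
qed

lemma act_zero_right: "x \<in> carrier X \<Longrightarrow> x \<triangleleft>\<^bsub>X\<^esub> \<zero>\<^bsub>A\<^esub> = \<zero>\<^bsub>X\<^esub>"
  using act_minus_right[OF _ A.gr_zero A.gr_zero zero_in_U, of x] act_closed[OF _ A.gr_zero zero_in_U, of x]
  by (simp add: A.minus_eq X.M.minus_eq X.M.r_neg)

text \<open>The multiplication map before passing to the quotient by the tensor relations.\<close>

abbreviation ev :: "(('x \<times> 'a) \<Rightarrow>\<^sub>0 int) \<Rightarrow> 'x" where
  "ev \<equiv> frag_sum X (\<lambda>(x, a). x \<triangleleft>\<^bsub>X\<^esub> a)"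

lemma act_fun: "u \<in> U \<Longrightarrow> (\<lambda>(x, a). x \<triangleleft>\<^bsub>X\<^esub> a) \<in> xgr s \<times> gr u \<rightarrow> carrier X"
  using act_closed X.M.gr_carrier by auto

lemma act_fun_gr: "u \<in> U \<Longrightarrow> (\<lambda>(x, a). x \<triangleleft>\<^bsub>X\<^esub> a) \<in> xgr s \<times> gr u \<rightarrow> xgr (s + u)"
  using act_gr by auto

lemma mult_fun: "b \<in> gr i \<Longrightarrow> (\<lambda>(x, a). (x, a \<otimes>\<^bsub>A\<^esub> b)) \<in> xgr s \<times> gr u \<rightarrow> xgr s \<times> gr (u + i)"
  using A.gr_mult by auto

section \<open>The groups \<open>X\<^sub>s \<otimes> A\<^sub>u\<close> as quotients of formal sums,
  and the kernel of multiplication\<close>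

abbreviation FA :: "int \<Rightarrow> int \<Rightarrow> (('x \<times> 'a) \<Rightarrow>\<^sub>0 int) monoid" where
  "FA s u \<equiv> free_Abelian_group (xgr s \<times> gr u)"

abbreviation rel :: "int \<Rightarrow> int \<Rightarrow> (('x \<times> 'a) \<Rightarrow>\<^sub>0 int) set" where
  "rel s u \<equiv> tens_rel A gr X xgr s u"

abbreviation coset :: "int \<Rightarrow> int \<Rightarrow> (('x \<times> 'a) \<Rightarrow>\<^sub>0 int) \<Rightarrow> (('x \<times> 'a) \<Rightarrow>\<^sub>0 int) set" where
  "coset s u f \<equiv> rel s u #>\<^bsub>FA s u\<^esub> f"

definition gens :: "int \<Rightarrow> int \<Rightarrow> (('x \<times> 'a) \<Rightarrow>\<^sub>0 int) set" where
  "gens s u = {frag_of (x \<oplus>\<^bsub>X\<^esub> x', y) - frag_of (x, y) - frag_of (x', y) | x x' y.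
         x \<in> xgr s \<and> x' \<in> xgr s \<and> y \<in> gr u} \<union>
      {frag_of (x, y \<oplus>\<^bsub>A\<^esub> y') - frag_of (x, y) - frag_of (x, y') | x y y'.
         x \<in> xgr s \<and> y \<in> gr u \<and> y' \<in> gr u} \<union>
      {frag_of (x \<triangleleft>\<^bsub>X\<^esub> r, y) - frag_of (x, r \<otimes>\<^bsub>A\<^esub> y) | x r y.
         x \<in> xgr s \<and> r \<in> gr 0 \<and> y \<in> gr u}"

lemma rel_eq: "rel s u = generate (FA s u) (gens s u)"
  by (simp add: tens_rel_def tensor_relations_def gens_def)

lemma keys_fragI: "p \<in> T \<Longrightarrow> q \<in> T \<Longrightarrow> Poly_Mapping.keys (frag_of p - frag_of q) \<subseteq> T"
  "p \<in> T \<Longrightarrow> q \<in> T \<Longrightarrow> r \<in> T \<Longrightarrow> Poly_Mapping.keys (frag_of p - frag_of q - frag_of r) \<subseteq> T"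
  using keys_diff[of "frag_of p" "frag_of q"] keys_diff[of "frag_of p - frag_of q" "frag_of r"]
  by (auto simp: keys_frag_of)

lemma act_gr_0: "x \<in> xgr s \<Longrightarrow> r \<in> gr 0 \<Longrightarrow> x \<triangleleft>\<^bsub>X\<^esub> r \<in> xgr s"
  using act_gr[of x s r 0] zero_in_U by simp

lemma mult_gr_0: "r \<in> gr 0 \<Longrightarrow> y \<in> gr u \<Longrightarrow> r \<otimes>\<^bsub>A\<^esub> y \<in> gr u"
  using A.gr_mult[of r 0 y u] by simp

lemma gens_cases [consumes 1, case_names add_left add_right balanced]:
  assumes "g \<in> gens s u"
    "\<And>x x' y. \<lbrakk>x \<in> xgr s; x' \<in> xgr s; y \<in> gr u;
      g = frag_of (x \<oplus>\<^bsub>X\<^esub> x', y) - frag_of (x, y) - frag_of (x', y)\<rbrakk> \<Longrightarrow> thesis"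
    "\<And>x y y'. \<lbrakk>x \<in> xgr s; y \<in> gr u; y' \<in> gr u;
      g = frag_of (x, y \<oplus>\<^bsub>A\<^esub> y') - frag_of (x, y) - frag_of (x, y')\<rbrakk> \<Longrightarrow> thesis"
    "\<And>x r y. \<lbrakk>x \<in> xgr s; r \<in> gr 0; y \<in> gr u;
      g = frag_of (x \<triangleleft>\<^bsub>X\<^esub> r, y) - frag_of (x, r \<otimes>\<^bsub>A\<^esub> y)\<rbrakk> \<Longrightarrow> thesis"
  shows thesis
  using assms unfolding gens_def by blast

lemma
  shows gens_add_left: "\<lbrakk>x \<in> xgr s; x' \<in> xgr s; y \<in> gr u\<rbrakk> \<Longrightarrow>
      frag_of (x \<oplus>\<^bsub>X\<^esub> x', y) - frag_of (x, y) - frag_of (x', y) \<in> gens s u"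
    and gens_add_right: "\<lbrakk>x \<in> xgr s; y \<in> gr u; y' \<in> gr u\<rbrakk> \<Longrightarrow>
      frag_of (x, y \<oplus>\<^bsub>A\<^esub> y') - frag_of (x, y) - frag_of (x, y') \<in> gens s u"
    and gens_balanced: "\<lbrakk>x \<in> xgr s; r \<in> gr 0; y \<in> gr u\<rbrakk> \<Longrightarrow>
      frag_of (x \<triangleleft>\<^bsub>X\<^esub> r, y) - frag_of (x, r \<otimes>\<^bsub>A\<^esub> y) \<in> gens s u"
  unfolding gens_def by blast+

lemma keys_gens: "g \<in> gens s u \<Longrightarrow> Poly_Mapping.keys g \<subseteq> xgr s \<times> gr u"
  by (erule gens_cases; simp only:; intro keys_fragI)
     (auto intro: X.M.gr_add A.gr_add act_gr_0 mult_gr_0)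

lemma rel_subgroup: "subgroup (rel s u) (FA s u)"
  unfolding rel_eq by (rule group.generate_is_subgroup) (auto dest: keys_gens)

lemma rel_normal: "rel s u \<lhd> FA s u"
  by (rule comm_group.subgroup_imp_normal[OF abelian_free_Abelian_group rel_subgroup])

lemma keys_rel: "f \<in> rel s u \<Longrightarrow> Poly_Mapping.keys f \<subseteq> xgr s \<times> gr u"
  using subsetD[OF subgroup.subset[OF rel_subgroup, of s u]] by (simp only: carrier_free_Abelian_group_iff)

lemma ev_gens:
  assumes u: "u \<in> U" and g: "g \<in> gens s u"
  shows "ev g = \<zero>\<^bsub>X\<^esub>"
proof -
  note F = act_fun[OF u, of s]
  note of = X.M.frag_sum_of[where \<phi> = "\<lambda>(x, a). x \<triangleleft>\<^bsub>X\<^esub> a"]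
  have frag2: "ev (frag_of p - frag_of q) = ev (frag_of p) \<ominus>\<^bsub>X\<^esub> ev (frag_of q)"
    if "p \<in> xgr s \<times> gr u" "q \<in> xgr s \<times> gr u" for p q
    using that by (intro X.M.frag_sum_diff[OF F]) (simp_all add: keys_frag_of)
  have frag3: "ev (frag_of p - frag_of q - frag_of r) =
      ev (frag_of p) \<ominus>\<^bsub>X\<^esub> ev (frag_of q) \<ominus>\<^bsub>X\<^esub> ev (frag_of r)"
    if "p \<in> xgr s \<times> gr u" "q \<in> xgr s \<times> gr u" "r \<in> xgr s \<times> gr u" for p q r
    using that keys_fragI(1)[OF that(1,2)]
    by (subst X.M.frag_sum_diff[OF F]) (simp_all add: keys_frag_of frag2)
  have ab: "x \<oplus>\<^bsub>X\<^esub> y \<ominus>\<^bsub>X\<^esub> x \<ominus>\<^bsub>X\<^esub> y = \<zero>\<^bsub>X\<^esub>" if "x \<in> carrier X" "y \<in> carrier X" for x y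
  proof -
    have "x \<oplus>\<^bsub>X\<^esub> y \<ominus>\<^bsub>X\<^esub> x = y"
      using that X.M.r_neg1[of x y] by (simp add: X.M.minus_eq X.M.a_ac)
    then show ?thesis using that by (simp add: X.M.minus_eq X.M.r_neg)
  qed
  from g show ?thesis
  proof (cases rule: gens_cases)
    case (add_left x x' y)
    note c = X.M.gr_carrier[OF add_left(1)] X.M.gr_carrier[OF add_left(2)]
    show ?thesis
      unfolding add_left(4)
      using add_left c act_closed[OF c(1) add_left(3) u] act_closed[OF c(2) add_left(3) u]
      by (subst frag3) (simp_all add: X.M.gr_add of act_add_left[OF _ _ _ u] ab)
  next
    case (add_right x y y')
    note c = X.M.gr_carrier[OF add_right(1)]
    show ?thesis
      unfolding add_right(4)
      using add_right c act_closed[OF c add_right(2) u] act_closed[OF c add_right(3) u]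
      by (subst frag3) (simp_all add: A.gr_add of act_add_right[OF _ _ _ u] ab)
  next
    case (balanced x r y)
    note c = X.M.gr_carrier[OF balanced(1)]
    have "(x \<triangleleft>\<^bsub>X\<^esub> r) \<triangleleft>\<^bsub>X\<^esub> y = x \<triangleleft>\<^bsub>X\<^esub> (r \<otimes>\<^bsub>A\<^esub> y)"
      using act_assoc[OF c balanced(2,3) zero_in_U u] u by simp
    then show ?thesis
      unfolding balanced(4)
      using balanced act_closed[OF c mult_gr_0[OF balanced(2,3)] u]
      by (subst frag2) (simp_all add: act_gr_0 mult_gr_0 of X.M.minus_eq X.M.r_neg)
  qed
qed

lemma ev_rel:
  assumes u: "u \<in> U" and f: "f \<in> rel s u"
  shows "ev f = \<zero>\<^bsub>X\<^esub>"
proof -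
  have "f \<in> rel s u \<and> ev f = \<zero>\<^bsub>X\<^esub>" using f[unfolded rel_eq]
  proof (induction rule: generate.induct)
    case one
    then show ?case
      using subgroup.one_closed[OF rel_subgroup, of s u] by (simp add: X.M.frag_sum_zero)
  next
    case (incl h)
    then show ?case using ev_gens[OF u] generate.incl rel_eq by metis
  next
    case (inv h)
    have "h \<in> rel s u" using inv generate.incl rel_eq by metis
    then have "-h \<in> rel s u"
      using subgroup.m_inv_closed[OF rel_subgroup, of h s u] keys_rel[of h s u] by simp
    moreover have "ev (0 - h) = ev 0 \<ominus>\<^bsub>X\<^esub> ev h"
      using keys_gens[OF inv] by (intro X.M.frag_sum_diff[OF act_fun[OF u]]) auto
    ultimately show ?case
      using ev_gens[OF u inv] keys_gens[OF inv] by (simp add: X.M.frag_sum_zero X.M.minus_eq)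
  next
    case (eng f g)
    then have "f + g \<in> rel s u"
      using subgroup.m_closed[OF rel_subgroup, of f s u g] by simp
    moreover have "ev (f + g) = ev f \<oplus>\<^bsub>X\<^esub> ev g"
      using eng keys_rel by (intro X.M.frag_sum_add[OF act_fun[OF u, of s]]) simp_all
    ultimately show ?case using eng by simp
  qed
  then show ?thesis ..
qed

lemma coset_eq: "coset s u f = {r + f | r. r \<in> rel s u}"
  by (auto simp: r_coset_def)

lemma coset_refl: "f \<in> coset s u f"
  unfolding coset_eq using subgroup.one_closed[OF rel_subgroup, of s u]
  by (intro CollectI exI[of _ 0]) simp

text \<open>\<open>mu\<close> extracts the only element of an image; there is only one because
  \<open>ev\<close> kills the relations and so is constant on a coset.\<close>

lemma mu_coset:
  assumes u: "u \<in> U" and f: "Poly_Mapping.keys f \<subseteq> xgr s \<times> gr u"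
  shows "mu X (coset s u f) = ev f"
proof -
  have mu: "mu X T = the_elem (ev ` T)" for T
    by (simp add: mu_def frag_sum_def case_prod_unfold)
  have ev_eq: "ev (r + f) = ev f" if r: "r \<in> rel s u" for r
    using X.M.frag_sum_add[OF act_fun[OF u] keys_rel[OF r] f] ev_rel[OF u r]
      X.M.frag_sum_closed[OF act_fun[OF u] f] by simp
  moreover note coset_refl[of f s u]
  ultimately have "ev ` coset s u f = {ev f}" by (auto simp: coset_eq image_iff)
  then show ?thesis by (simp add: mu)
qed

lemma carrier_tens: "carrier (tens A gr X xgr s u) = coset s u ` {f. Poly_Mapping.keys f \<subseteq> xgr s \<times> gr u}"
  by (auto simp: tens_def tensor_product_def FactGroup_def RCOSETS_def tens_rel_def)

lemma mult_tens:
  assumes "Poly_Mapping.keys f \<subseteq> xgr s \<times> gr u" "Poly_Mapping.keys g \<subseteq> xgr s \<times> gr u"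
  shows "coset s u f \<otimes>\<^bsub>tens A gr X xgr s u\<^esub> coset s u g = coset s u (f + g)"
  using normal.rcos_sum[OF rel_normal, of f s u g] assms
  by (simp add: tens_def tensor_product_def FactGroup_def tens_rel_def)

lemma group_tens: "group (tens A gr X xgr s u)"
  using normal.factorgroup_is_group[OF rel_normal, of s u]
  by (simp add: tens_def tensor_product_def tens_rel_def)

text \<open>It makes \<open>Ker_mu\<close> a subgroup, so that containment of the generated group
  \<open>Ker_mu_times\<close> in it can be tested on generators.\<close>

lemma group_hom_mu:
  assumes u: "u \<in> U"
  shows "group_hom (tens A gr X xgr s u) (add_monoid (X\<lparr>carrier := xgr (s + u)\<rparr>)) (mu X)"
proof (intro group_hom.intro group_hom_axioms.intro group_tens homI)
  have "abelian_group (X\<lparr>carrier := xgr (s + u)\<rparr>)"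
    by (rule X.M.abelian_group_restrict[OF X.M.gr_subgroup]) simp_all
  then show "group (add_monoid (X\<lparr>carrier := xgr (s + u)\<rparr>))" by (rule abelian_group.a_group)
next
  fix T assume "T \<in> carrier (tens A gr X xgr s u)"
  then obtain f where f: "Poly_Mapping.keys f \<subseteq> xgr s \<times> gr u" "T = coset s u f"
    by (auto simp: carrier_tens)
  then show "mu X T \<in> carrier (add_monoid (X\<lparr>carrier := xgr (s + u)\<rparr>))"
    using X.M.frag_sum_in_subgroup[OF X.M.gr_subgroup act_fun_gr[OF u] f(1)]
    by (simp add: mu_coset[OF u])
next
  fix T T' assume "T \<in> carrier (tens A gr X xgr s u)" "T' \<in> carrier (tens A gr X xgr s u)"
  then obtain f g where f: "Poly_Mapping.keys f \<subseteq> xgr s \<times> gr u" "T = coset s u f"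
    and g: "Poly_Mapping.keys g \<subseteq> xgr s \<times> gr u" "T' = coset s u g"
    by (auto simp: carrier_tens)
  then show "mu X (T \<otimes>\<^bsub>tens A gr X xgr s u\<^esub> T') =
      mu X T \<otimes>\<^bsub>add_monoid (X\<lparr>carrier := xgr (s + u)\<rparr>)\<^esub> mu X T'"
    using Poly_Mapping.keys_add[of f g]
    by (simp add: mult_tens mu_coset[OF u] X.M.frag_sum_add[OF act_fun[OF u]] order.trans[OF Poly_Mapping.keys_add])
qed

lemma Ker_mu_eq:
  assumes u: "u \<in> U"
  shows "Ker_mu A gr X xgr s u =
    coset s u ` {f. Poly_Mapping.keys f \<subseteq> xgr s \<times> gr u \<and> ev f = \<zero>\<^bsub>X\<^esub>}"
  by (auto simp: Ker_mu_def kernel_def carrier_tens mu_coset[OF u])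

section \<open>Right multiplication by elements of \<open>A\<close> on formal sums and on their
  cosets\<close>

abbreviation fmul :: "'a \<Rightarrow> (('x \<times> 'a) \<Rightarrow>\<^sub>0 int) \<Rightarrow> (('x \<times> 'a) \<Rightarrow>\<^sub>0 int)" where
  "fmul b \<equiv> frag_extend (\<lambda>(x, a). frag_of (x, a \<otimes>\<^bsub>A\<^esub> b))"

lemma fmul_alt: "fmul b = frag_extend (\<lambda>p. frag_of ((\<lambda>(x, a). (x, a \<otimes>\<^bsub>A\<^esub> b)) p))"
  by (simp add: case_prod_unfold)

lemma keys_fmul:
  assumes "b \<in> gr i" "Poly_Mapping.keys f \<subseteq> xgr s \<times> gr u"
  shows "Poly_Mapping.keys (fmul b f) \<subseteq> xgr s \<times> gr (u + i)"
proof -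
  have "(\<lambda>_. \<zero>\<^bsub>X\<^esub>) \<in> xgr s \<times> gr (u + i) \<rightarrow> carrier X" by simp
  then show ?thesis
    unfolding fmul_alt by (rule X.M.frag_sum_extend(1)[OF mult_fun[OF assms(1)] _ assms(2)])
qed

text \<open>Each of the three families of relations is mapped to itself: the second by
  distributivity in \<open>A\<close>, the third because left multiplication by
  \<open>A\<^sub>0\<close> commutes with right multiplication by \<open>b\<close>. This makes
  \<open>tens_act\<close> well defined.\<close>

lemma fmul_rel:
  assumes b: "b \<in> gr i" and f: "f \<in> rel s u"
  shows "fmul b f \<in> rel s (u + i)"
  using f[unfolded rel_eq]
proof (induction rule: generate.induct)
  case one
  then show ?case using subgroup.one_closed[OF rel_subgroup, of s "u + i"] by simp
next
  have gen: "fmul b h \<in> gens s (u + i)" if "h \<in> gens s u" for h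
    using that
  proof (cases rule: gens_cases)
    case (add_left x x' y)
    then show ?thesis
      using gens_add_left[OF _ _ A.gr_mult[OF _ b]] by (simp add: frag_extend_diff)
  next
    case (add_right x y y')
    then have "(y \<oplus>\<^bsub>A\<^esub> y') \<otimes>\<^bsub>A\<^esub> b = y \<otimes>\<^bsub>A\<^esub> b \<oplus>\<^bsub>A\<^esub> y' \<otimes>\<^bsub>A\<^esub> b"
      using A.gr_carrier b by (intro A.l_distr) blast+
    then show ?thesis
      using add_right gens_add_right[OF _ A.gr_mult[OF _ b] A.gr_mult[OF _ b]]
      by (simp add: frag_extend_diff)
  next
    case (balanced x r y)
    then have "(r \<otimes>\<^bsub>A\<^esub> y) \<otimes>\<^bsub>A\<^esub> b = r \<otimes>\<^bsub>A\<^esub> (y \<otimes>\<^bsub>A\<^esub> b)"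
      using A.gr_carrier b by (intro A.m_assoc) blast+
    then show ?thesis
      using balanced gens_balanced[OF _ _ A.gr_mult[OF _ b]] by (simp add: frag_extend_diff)
  qed
  {
    case (incl h)
    then show ?case using gen rel_eq generate.incl by metis
  next
    case (inv h)
    have "fmul b h \<in> rel s (u + i)" using gen[OF inv] rel_eq generate.incl by metis
    then have "- fmul b h \<in> rel s (u + i)"
      using subgroup.m_inv_closed[OF rel_subgroup, of "fmul b h" s "u + i"] keys_rel by simp
    then show ?case using keys_gens[OF inv] by (simp add: frag_extend_minus)
  next
    case (eng f g)
    then show ?case
      using subgroup.m_closed[OF rel_subgroup, of "fmul b f" s "u + i" "fmul b g"]
      by (simp add: frag_extend_add)
  }
qed

lemma coset_rel_add:
  assumes "r \<in> rel s u" "Poly_Mapping.keys f \<subseteq> xgr s \<times> gr u"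
  shows "coset s u (r + f) = coset s u f"
proof -
  interpret group "FA s u" by simp
  have "coset s u r = rel s u"
    using assms keys_rel by (intro coset_join2[OF _ rel_subgroup]) auto
  then show ?thesis
    using coset_mult_assoc[of "rel s u" r f] assms keys_rel[OF assms(1)]
      subgroup.subset[OF rel_subgroup, of s u] by simp
qed

lemma tens_act_coset:
  assumes b: "b \<in> gr i" and f: "Poly_Mapping.keys f \<subseteq> xgr s \<times> gr u"
  shows "tens_act A gr X xgr s u i (coset s u f) b = coset s (u + i) (fmul b f)"
proof -
  have "coset s (u + i) (fmul b (r + f)) = coset s (u + i) (fmul b f)" if "r \<in> rel s u" for r
    using coset_rel_add[OF fmul_rel[OF b that] keys_fmul[OF b f]] by (simp add: frag_extend_add)
  moreover note coset_refl[of f s u]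
  ultimately have "(\<lambda>f. coset s (u + i) (fmul b f)) ` coset s u f = {coset s (u + i) (fmul b f)}"
    by (auto simp: coset_eq[of s u] image_iff)
  then show ?thesis by (simp add: tens_act_def)
qed

lemma ev_fmul:
  assumes b: "b \<in> gr i" and f: "Poly_Mapping.keys f \<subseteq> xgr s \<times> gr u" and v: "u + i \<in> U"
  shows "ev (fmul b f) = frag_sum X (\<lambda>(x, a). x \<triangleleft>\<^bsub>X\<^esub> (a \<otimes>\<^bsub>A\<^esub> b)) f"
  unfolding fmul_alt X.M.frag_sum_extend(2)[OF mult_fun[OF b] act_fun[OF v] f]
  by (simp add: case_prod_unfold)

text \<open>The bridge from cosets to formal sums: after it, assertion (2) is a statement about
  \<open>ev\<close> and supports alone.\<close>

lemma Ker_mu_times_subset_iff: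
  assumes u: "u \<in> U" and v: "u + i \<in> U"
  shows "Ker_mu_times A gr X xgr s u i \<subseteq> Ker_mu A gr X xgr s (u + i) \<longleftrightarrow>
    (\<forall>f b. Poly_Mapping.keys f \<subseteq> xgr s \<times> gr u \<and> ev f = \<zero>\<^bsub>X\<^esub> \<and> b \<in> gr i \<longrightarrow>
      frag_sum X (\<lambda>(x, a). x \<triangleleft>\<^bsub>X\<^esub> (a \<otimes>\<^bsub>A\<^esub> b)) f = \<zero>\<^bsub>X\<^esub>)" (is "?L \<longleftrightarrow> ?R")
proof -
  let ?G = "{tens_act A gr X xgr s u i T b | T b. T \<in> Ker_mu A gr X xgr s u \<and> b \<in> gr i}"
  have G: "?G = {coset s (u + i) (fmul b f) | f b.
      Poly_Mapping.keys f \<subseteq> xgr s \<times> gr u \<and> ev f = \<zero>\<^bsub>X\<^esub> \<and> b \<in> gr i}" (is "_ = ?H")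
  proof
    show "?G \<subseteq> ?H"
      unfolding Ker_mu_eq[OF u] by clarify (metis tens_act_coset)
    show "?H \<subseteq> ?G"
      unfolding Ker_mu_eq[OF u] by clarify (metis (mono_tags, lifting) tens_act_coset imageI mem_Collect_eq)
  qed
  interpret mu: group_hom "tens A gr X xgr s (u + i)"
    "add_monoid (X\<lparr>carrier := xgr (s + (u + i))\<rparr>)" "mu X"
    by (rule group_hom_mu[OF v])
  have "?L \<longleftrightarrow> ?G \<subseteq> Ker_mu A gr X xgr s (u + i)"
  proof
    assume ?L
    then show "?G \<subseteq> Ker_mu A gr X xgr s (u + i)"
      unfolding Ker_mu_times_def by (blast intro: generate.incl)
  next
    assume "?G \<subseteq> Ker_mu A gr X xgr s (u + i)"
    then show ?L
      unfolding Ker_mu_times_def Ker_mu_def[of _ _ _ _ _ "u + i"]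
      by (intro group.generate_subgroup_incl[OF group_tens] mu.subgroup_kernel)
  qed
  also have "\<dots> \<longleftrightarrow> ?R"
  proof -
    have "coset s (u + i) (fmul b f) \<in> Ker_mu A gr X xgr s (u + i) \<longleftrightarrow>
        frag_sum X (\<lambda>(x, a). x \<triangleleft>\<^bsub>X\<^esub> (a \<otimes>\<^bsub>A\<^esub> b)) f = \<zero>\<^bsub>X\<^esub>"
      if "Poly_Mapping.keys f \<subseteq> xgr s \<times> gr u" "b \<in> gr i" for f b
      using keys_fmul[OF that(2,1)]
      by (auto simp: Ker_mu_def kernel_def carrier_tens mu_coset[OF v] ev_fmul[OF that(2,1) v])
    then show ?thesis unfolding G by blast
  qed
  finally show ?thesis .
qed

end

lemma (in graded_ring) products_gr:
  assumes "x \<in> products i j"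
  shows "x \<in> gr (i + j)"
  using assms by (induction rule: products_induct) (auto intro: gr_mult gr_minus)

section \<open>The extended multiplication\<close>

lemma colon_iff: "m \<in> colon S U \<Longrightarrow> m + v \<in> S \<longleftrightarrow> v \<in> U"
  unfolding colon_def by auto

locale modular_module = truncated_module A gr U X xgr
  for A :: "('k, 'a, 'p) module_scheme" and gr and U
    and X :: "('a, 'x, 'q) right_module_scheme" and xgr and S :: "int set" +
  assumes gr_neg: "i < 0 \<Longrightarrow> gr i = {\<zero>\<^bsub>A\<^esub>}"
    and generated_A: "generated_in_degrees_0_1 A gr"
    and generated_X: "generated_in_degrees (trunc_algebra A gr U) X xgr (colon S U)"
begin

section \<open>Spanning each degree of \<open>X\<close> from the nearest generators below it\<close>

lemma colon_shift:
  assumes "m \<in> colon S U" "m' \<in> colon S U"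
  shows "m' - m + v \<in> U \<longleftrightarrow> v \<in> U"
  using colon_iff[OF assms(1), of "m' - m + v"] colon_iff[OF assms(2), of v] by simp

lemma colon_diff_in_U: "m \<in> colon S U \<Longrightarrow> m' \<in> colon S U \<Longrightarrow> m' - m \<in> U"
  using colon_shift[of m m' 0] zero_in_U by simp

text \<open>A relation rather than a function, because \<open>(S : U)\<close> may have no element at
  or below \<open>s\<close>; in that case \<open>X\<^sub>s\<close> turns out to be zero, see
  \<open>xgr_cases\<close>.\<close>

definition top_degree :: "int \<Rightarrow> int \<Rightarrow> bool" where
  "top_degree s m \<longleftrightarrow> m \<in> colon S U \<and> m \<le> s \<and> (\<forall>m'\<in>colon S U. m' \<le> s \<longrightarrow> m' \<le> m)"

lemma top_degree_unique: "top_degree s m \<Longrightarrow> top_degree s m' \<Longrightarrow> m = m'"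
  unfolding top_degree_def by force

lemma top_degree_exists:
  assumes "m \<in> colon S U" "m \<le> s"
  obtains m' where "top_degree s m'" "m \<le> m'"
proof -
  let ?C = "{m' \<in> colon S U. m \<le> m' \<and> m' \<le> s}"
  have fin: "finite ?C" by (rule finite_subset[of _ "{m..s}"]) auto
  have "Max ?C \<in> ?C" using assms fin by (intro Max_in) auto
  moreover have "m' \<le> Max ?C" if "m' \<in> colon S U" "m' \<le> s" for m'
  proof (cases "m \<le> m'")
    case True
    then show ?thesis using fin that by (intro Max_ge) auto
  next
    case False
    then show ?thesis using \<open>Max ?C \<in> ?C\<close> by auto
  qed
  ultimately show thesis using that[of "Max ?C"] by (auto simp: top_degree_def)
qed

lemma top_degree_in_U: "top_degree s m \<Longrightarrow> s \<in> S \<Longrightarrow> s - m \<in> U"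
  using colon_iff[of m S U "s - m"] by (simp add: top_degree_def)

definition span :: "int \<Rightarrow> int \<Rightarrow> 'x set" where
  "span s m = ev ` {f. Poly_Mapping.keys f \<subseteq> xgr m \<times> gr (s - m)}"

lemma span_subgroup: "s - m \<in> U \<Longrightarrow> additive_subgroup (span s m) X"
  unfolding span_def by (rule X.M.frag_sum_image_subgroup[OF act_fun])

lemma act_in_span: "\<lbrakk>x \<in> xgr m; a \<in> gr (s - m); s - m \<in> U\<rbrakk> \<Longrightarrow> x \<triangleleft>\<^bsub>X\<^esub> a \<in> span s m"
  unfolding span_def using act_closed[OF X.M.gr_carrier]
  by (intro image_eqI[of _ _ "frag_of (x, a)"]) (auto simp: X.M.frag_sum_of keys_frag_of)

lemma gr_split:
  assumes "m \<in> colon S U" "top_degree t m'" "m \<le> m'" "e \<in> gr (t - m)"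
  shows "e \<in> A.products (m' - m) (t - m')"
  using A.gr_eq_products[OF generated_A gr_neg, of "m' - m" "t - m'" e] assms by (simp add: top_degree_def)

text \<open>Nothing is truncated on the way: \<open>m' - m\<close> is a period of \<open>U\<close>
  and hence lies in \<open>U\<close>, while \<open>t - m\<close> and \<open>t - m'\<close> lie in
  \<open>U\<close> because \<open>t\<close> is in \<open>S\<close>.\<close>

lemma act_products:
  assumes m: "m \<in> colon S U" and t: "t \<in> S" and m': "top_degree t m'" and x: "x \<in> xgr m"
    and p: "p \<in> gr (m' - m)" and r: "r \<in> gr (t - m')"
  shows "x \<triangleleft>\<^bsub>X\<^esub> p \<in> xgr m'" and "x \<triangleleft>\<^bsub>X\<^esub> (p \<otimes>\<^bsub>A\<^esub> r) = (x \<triangleleft>\<^bsub>X\<^esub> p) \<triangleleft>\<^bsub>X\<^esub> r"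
proof -
  have d: "m' - m \<in> U" using colon_diff_in_U m m' by (simp add: top_degree_def)
  then show "x \<triangleleft>\<^bsub>X\<^esub> p \<in> xgr m'" using act_gr[OF x p] by simp
  have "m' - m + (t - m') \<in> U" using colon_iff[OF m, of "t - m"] t by simp
  then show "x \<triangleleft>\<^bsub>X\<^esub> (p \<otimes>\<^bsub>A\<^esub> r) = (x \<triangleleft>\<^bsub>X\<^esub> p) \<triangleleft>\<^bsub>X\<^esub> r"
    using act_assoc[OF X.M.gr_carrier[OF x] p r d top_degree_in_U[OF m' t]] by simp
qed

lemma act_in_top_span:
  assumes m: "m \<in> colon S U" and t: "t \<in> S" and m': "top_degree t m'" "m \<le> m'"
    and x: "x \<in> xgr m" and e: "e \<in> gr (t - m)"
  shows "x \<triangleleft>\<^bsub>X\<^esub> e \<in> span t m'"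
  using gr_split[OF m m' e]
proof (induction rule: A.products_induct)
  case (mult p r)
  then show ?case
    using act_products[OF m t m'(1) x mult] act_in_span[OF _ mult(2) top_degree_in_U[OF m'(1) t]] by simp
next
  case (diff a b)
  have "t - m \<in> U" using colon_iff[OF m, of "t - m"] t by simp
  moreover have "a \<in> gr (t - m)" "b \<in> gr (t - m)" using diff A.products_gr by force+
  ultimately show ?case
    using act_minus_right[OF X.M.gr_carrier[OF x]] diff
      X.M.additive_subgroup_minus[OF span_subgroup[OF top_degree_in_U[OF m'(1) t]]] by metis
qed

text \<open>The candidate for \<open>X\<^sub>s\<close>. Zero is adjoined by hand so that it is a
  subgroup in every degree, also in those without a top degree or outside \<open>S\<close>.\<close>

definition spanned :: "int \<Rightarrow> 'x set" where
  "spanned s = {x. x = \<zero>\<^bsub>X\<^esub> \<or> (\<exists>m. top_degree s m \<and> s \<in> S \<and> x \<in> span s m)}"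

lemma spanned_eq:
  obtains "spanned s = {\<zero>\<^bsub>X\<^esub>}" "\<And>m. \<not> (top_degree s m \<and> s \<in> S)" | m where "top_degree s m" "s \<in> S" "spanned s = span s m"
proof (cases "\<exists>m. top_degree s m \<and> s \<in> S")
  case True
  then obtain m where m: "top_degree s m" "s \<in> S" by blast
  then have "spanned s = span s m"
    unfolding spanned_def
    using top_degree_unique[OF m(1)] additive_subgroup.zero_closed[OF span_subgroup[OF top_degree_in_U[OF m]]]
    by blast
  then show ?thesis using that m by blast
next
  case False
  then show ?thesis using that(1) by (auto simp: spanned_def)
qed

lemma spanned_subgroup: "additive_subgroup (spanned s) X"
proof (cases rule: spanned_eq[of s])
  case 1
  then show ?thesis by (auto intro!: X.M.additive_subgroup_minusI simp: X.M.minus_eq)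
next
  case (2 m)
  then show ?thesis using span_subgroup[OF top_degree_in_U] by metis
qed

lemma spanned_gr: "x \<in> spanned s \<Longrightarrow> x \<in> xgr s"
proof (cases rule: spanned_eq[of s])
  case (2 m)
  assume "x \<in> spanned s"
  then obtain f where "Poly_Mapping.keys f \<subseteq> xgr m \<times> gr (s - m)" "x = ev f"
    using 2 by (auto simp: span_def)
  then show ?thesis
    using X.M.frag_sum_in_subgroup[OF X.M.gr_subgroup act_fun_gr[OF top_degree_in_U[OF 2(1,2)]], of f m] by simp
qed (simp add: X.M.gr_zero)

lemma spanned_act:
  assumes x: "x \<in> spanned s" and a: "a \<in> gr j" and j: "j \<in> U"
  shows "x \<triangleleft>\<^bsub>X\<^esub> a \<in> spanned (s + j)"
proof (cases rule: spanned_eq[of s])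
  case 1
  then have "x \<triangleleft>\<^bsub>X\<^esub> a = \<zero>\<^bsub>X\<^esub>"
    using x additive_map.map_zero[OF additive_map_act[OF a j]] by simp
  then show ?thesis by (simp add: spanned_def)
next
  case (2 m)
  note u = top_degree_in_U[OF 2(1,2)]
  have m: "m \<in> colon S U" "m \<le> s" using 2 by (auto simp: top_degree_def)
  obtain f where f: "Poly_Mapping.keys f \<subseteq> xgr m \<times> gr (s - m)" "x = ev f"
    using 2 x by (auto simp: span_def)
  from f(1) have "ev f \<triangleleft>\<^bsub>X\<^esub> a \<in> spanned (s + j)"
  proof (induction rule: frag_induct_on)
    case zero
    then show ?case
      using additive_map.map_zero[OF additive_map_act[OF a j]]
      by (simp add: X.M.frag_sum_zero spanned_def)
  next
    case (diff f g)
    then show ?case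
      by (simp add: X.M.frag_sum_diff[OF act_fun[OF u]] X.M.frag_sum_closed[OF act_fun[OF u]]
          additive_map.map_minus[OF additive_map_act[OF a j]]
          X.M.additive_subgroup_minus[OF spanned_subgroup])
  next
    case (one p)
    obtain y c where p: "p = (y, c)" "y \<in> xgr m" "c \<in> gr (s - m)" using one by auto
    note yc = X.M.gr_carrier[OF p(2)]
    have ev: "ev (frag_of p) = y \<triangleleft>\<^bsub>X\<^esub> c"
      using act_closed[OF yc p(3) u] by (simp add: p(1) X.M.frag_sum_of)
    have assoc: "(y \<triangleleft>\<^bsub>X\<^esub> c) \<triangleleft>\<^bsub>X\<^esub> a = (if s - m + j \<in> U then y \<triangleleft>\<^bsub>X\<^esub> (c \<otimes>\<^bsub>A\<^esub> a) else \<zero>\<^bsub>X\<^esub>)"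
      using act_assoc[OF yc p(3) a u j] .
    show ?case
    \<comment> \<open>With \<open>0 \<le> j\<close> the degree \<open>m\<close> stays at or below
      \<open>s + j\<close>, so a top degree of \<open>s + j\<close> exists and \<open>c a\<close>
      can be split at it. In the remaining cases the product is 0, by truncation or because
      \<open>a\<close> has negative degree.\<close>
    proof (cases "s - m + j \<in> U \<and> 0 \<le> j")
      case True
      then obtain m' where m': "top_degree (s + j) m'" "m \<le> m'" using top_degree_exists[OF m(1), of "s + j"] m by auto
      have "s + j \<in> S" using colon_iff[OF m(1), of "s - m + j"] True by simp
      moreover have "c \<otimes>\<^bsub>A\<^esub> a \<in> gr (s + j - m)" using A.gr_mult[OF p(3) a] by (simp add: algebra_simps)
      ultimately show ?thesis
        using act_in_top_span[OF m(1) _ m' p(2)] m' True by (auto simp: ev assoc spanned_def)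
    next
      case False
      then consider "s - m + j \<notin> U" | "j < 0" by linarith
      then have "(y \<triangleleft>\<^bsub>X\<^esub> c) \<triangleleft>\<^bsub>X\<^esub> a = \<zero>\<^bsub>X\<^esub>"
      proof cases
        case 2
        then have "a = \<zero>\<^bsub>A\<^esub>" using a gr_neg by blast
        then show ?thesis using act_zero_right[OF act_closed[OF yc p(3) u]] by simp
      qed (simp add: assoc)
      then show ?thesis by (simp add: ev spanned_def)
    qed
  qed
  then show ?thesis by (simp add: f(2))
qed

lemma colon_subset_S: "m \<in> colon S U \<Longrightarrow> m \<in> S"
  using colon_iff[of m S U 0] zero_in_U by simp

text \<open>The elements all of whose components are spanned form a submodule, by
  \<open>spanned_act\<close>. It contains the generators, since a degree \<open>m\<close> of
  \<open>(S : U)\<close> is its own top degree and \<open>x = x \<one>\<close>. Hence it is all of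
  \<open>X\<close>.\<close>

lemma xgr_spanned:
  assumes "x \<in> xgr s"
  shows "x \<in> spanned s"
proof -
  let ?H = "{x \<in> carrier X. \<forall>s. X.M.comp x s \<in> spanned s}"
  have sub: "additive_subgroup ?H X" by (rule X.M.additive_subgroup_components[OF spanned_subgroup])
  have spanned_H: "x \<in> ?H" if "x \<in> spanned s" for x s
    using that spanned_gr[OF that] X.M.gr_carrier additive_subgroup.zero_closed[OF spanned_subgroup]
    by (auto simp: X.M.comp_homogeneous)
  interpret act: biadditive_action "trunc_algebra A gr U" X by (rule X.biadditive_action)
  have H_act: "x \<triangleleft>\<^bsub>X\<^esub> a \<in> ?H" if x: "x \<in> ?H" and a: "a \<in> carrier (trunc_algebra A gr U)" for x a
    using a
  proof (induction rule: X.R.homogeneous_induct)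
    case (add a b)
    then show ?case
      using x act.act_add_right[of x a b] additive_subgroup.a_closed[OF sub] by simp
  next
    case (homogeneous a j)
    have xc: "x \<in> carrier X" using x by simp
    show ?case
    proof (cases "j \<in> U")
      case True
      then have a: "a \<in> gr j" using homogeneous by (simp add: trunc_grading_def)
      have "x \<triangleleft>\<^bsub>X\<^esub> a = (\<Oplus>\<^bsub>X\<^esub>i\<in>{i. X.M.comp x i \<noteq> \<zero>\<^bsub>X\<^esub>}. X.M.comp x i) \<triangleleft>\<^bsub>X\<^esub> a"
        by (simp only: X.M.finsum_support[OF xc])
      also have "\<dots> = (\<Oplus>\<^bsub>X\<^esub>i\<in>{i. X.M.comp x i \<noteq> \<zero>\<^bsub>X\<^esub>}. X.M.comp x i \<triangleleft>\<^bsub>X\<^esub> a)"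
        using xc by (intro additive_map.map_finsum[OF additive_map_act[OF a True]] X.M.comp_closed)
      also have "\<dots> \<in> ?H"
        using x spanned_H[OF spanned_act[OF _ a True]] by (intro X.M.finsum_in_subgroup[OF sub]) blast
      finally show ?thesis .
    next
      case False
      then have "a = \<zero>\<^bsub>A\<^esub>" using homogeneous by (simp add: trunc_grading_def)
      then show ?thesis using act_zero_right[OF xc] additive_subgroup.zero_closed[OF sub] by simp
    qed
  qed
  have "xgr m \<subseteq> ?H" if m: "m \<in> colon S U" for m
  proof
    fix x assume x: "x \<in> xgr m"
    have m': "top_degree m m" using m by (simp add: top_degree_def)
    have "\<one>\<^bsub>A\<^esub> \<in> gr (m - m)" using A.gr_one by simp
    then have "x \<triangleleft>\<^bsub>X\<^esub> \<one>\<^bsub>A\<^esub> \<in> span m m"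
      using act_in_top_span[OF m colon_subset_S[OF m] m' order.refl x] by simp
    then have "x \<in> spanned m"
      using act_one[OF X.M.gr_carrier[OF x]] m' colon_subset_S[OF m] by (auto simp: spanned_def)
    then show "x \<in> ?H" by (rule spanned_H)
  qed
  then have "carrier X \<subseteq> ?H"
    using generated_X sub H_act unfolding generated_in_degrees_def right_submodule_def by blast
  then have "X.M.comp x s \<in> spanned s" using X.M.gr_carrier[OF assms] by blast
  then show ?thesis using assms by (simp add: X.M.comp_homogeneous)
qed

lemma xgr_cases:
  obtains (trivial) "xgr s = {\<zero>\<^bsub>X\<^esub>}" "\<And>m. \<not> (top_degree s m \<and> s \<in> S)"
  | (span) m where "top_degree s m" "s \<in> S" "xgr s = span s m"
proof (cases rule: spanned_eq[of s])
  case 1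
  then show ?thesis using that(1) xgr_spanned[of _ s] spanned_gr[of _ s] by blast
next
  case (2 m)
  then show ?thesis using that(2) xgr_spanned[of _ s] spanned_gr[of _ s] by blast
qed

text \<open>That \<open>X\<close> has its support in \<open>S\<close> is a consequence of its
  generation in degrees \<open>m\<close> with \<open>m + U = S\<close>.\<close>

lemma xgr_outside: "s \<notin> S \<Longrightarrow> xgr s = {\<zero>\<^bsub>X\<^esub>}"
  by (cases rule: xgr_cases[of s]) auto

text \<open>The contribution of a pair \<open>(x, c)\<close>, with \<open>c\<close> of degree
  \<open>u\<close>, to \<open>(\<Sum>x c) \<star> a\<close>. For \<open>x\<close> of degree
  \<open>m\<close> in \<open>(S : U)\<close> the zero branch is taken exactly when
  \<open>m + u + j\<close> leaves \<open>S\<close>; there \<open>c a\<close> need not belong to the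
  truncated algebra, so the action of \<open>X\<close> could not be used.\<close>

definition emul :: "int \<Rightarrow> int \<Rightarrow> 'a \<Rightarrow> 'x \<times> 'a \<Rightarrow> 'x" where
  "emul u j a = (\<lambda>(x, c). if u + j \<in> U then x \<triangleleft>\<^bsub>X\<^esub> (c \<otimes>\<^bsub>A\<^esub> a) else \<zero>\<^bsub>X\<^esub>)"

lemma emul_gr:
  assumes "a \<in> gr j"
  shows "emul (s - m) j a \<in> xgr m \<times> gr (s - m) \<rightarrow> xgr (s + j)"
proof
  fix p assume "p \<in> xgr m \<times> gr (s - m)"
  then obtain x c where p: "p = (x, c)" "x \<in> xgr m" "c \<in> gr (s - m)" by auto
  show "emul (s - m) j a p \<in> xgr (s + j)"
    using act_gr[OF p(2) A.gr_mult[OF p(3) assms]] X.M.gr_zero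
    by (auto simp: emul_def p(1) algebra_simps)
qed

lemma emul_fun: "a \<in> gr j \<Longrightarrow> emul (s - m) j a \<in> xgr m \<times> gr (s - m) \<rightarrow> carrier X"
  using emul_gr[of a j s m] X.M.gr_carrier by blast

section \<open>Assertion (2) on formal sums, with \<open>i = v - u\<close>, and its
  necessity\<close>

definition kernel_condition :: bool where
  "kernel_condition \<longleftrightarrow> (\<forall>m\<in>colon S U. \<forall>u\<in>U. \<forall>i f b. 0 \<le> u \<and> 0 < i \<and> u + i \<in> U \<and> i \<notin> U \<and>
     Poly_Mapping.keys f \<subseteq> xgr m \<times> gr u \<and> ev f = \<zero>\<^bsub>X\<^esub> \<and> b \<in> gr i \<longrightarrow>
     frag_sum X (\<lambda>(x, a). x \<triangleleft>\<^bsub>X\<^esub> (a \<otimes>\<^bsub>A\<^esub> b)) f = \<zero>\<^bsub>X\<^esub>)"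

lemma kernel_condition_iff:
  "kernel_condition \<longleftrightarrow> (\<forall>m\<in>colon S U. \<forall>u\<in>U. \<forall>v\<in>U. 0 \<le> u \<and> u < v \<and> v - u \<notin> U \<longrightarrow>
    Ker_mu_times A gr X xgr m u (v - u) \<subseteq> Ker_mu A gr X xgr m v)" (is "_ \<longleftrightarrow> ?R")
proof
  assume K: kernel_condition
  show ?R
  proof (intro ballI impI)
    fix m u v assume *: "m \<in> colon S U" "u \<in> U" "v \<in> U" "0 \<le> u \<and> u < v \<and> v - u \<notin> U"
    then have "\<forall>f b. Poly_Mapping.keys f \<subseteq> xgr m \<times> gr u \<and> ev f = \<zero>\<^bsub>X\<^esub> \<and> b \<in> gr (v - u) \<longrightarrow>
        frag_sum X (\<lambda>(x, a). x \<triangleleft>\<^bsub>X\<^esub> (a \<otimes>\<^bsub>A\<^esub> b)) f = \<zero>\<^bsub>X\<^esub>"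
      using spec[OF bspec[OF bspec[OF K[unfolded kernel_condition_def] *(1)] *(2)], of "v - u"] by simp
    then show "Ker_mu_times A gr X xgr m u (v - u) \<subseteq> Ker_mu A gr X xgr m v"
      using Ker_mu_times_subset_iff[of u "v - u" m] * by simp
  qed
next
  assume R: ?R
  show kernel_condition
    unfolding kernel_condition_def
  proof (intro ballI allI impI)
    fix m u i f b
    assume *: "m \<in> colon S U" "u \<in> U" "0 \<le> u \<and> 0 < i \<and> u + i \<in> U \<and> i \<notin> U \<and>
     Poly_Mapping.keys f \<subseteq> xgr m \<times> gr u \<and> ev f = \<zero>\<^bsub>X\<^esub> \<and> b \<in> gr i"
    then have "Ker_mu_times A gr X xgr m u (u + i - u) \<subseteq> Ker_mu A gr X xgr m (u + i)"
      using R[rule_format, of m u "u + i"] by simp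
    then show "frag_sum X (\<lambda>(x, a). x \<triangleleft>\<^bsub>X\<^esub> (a \<otimes>\<^bsub>A\<^esub> b)) f = \<zero>\<^bsub>X\<^esub>"
      using Ker_mu_times_subset_iff[of u i m] * by simp
  qed
qed

lemma liftable_imp_kernel_condition:
  assumes M: "graded_right_module A gr M mgr"
    and iso: "graded_isomorphic (trunc_algebra A gr U) X xgr
      (trunc_module A gr M mgr S) (trunc_grading M mgr S)"
  shows kernel_condition
  unfolding kernel_condition_def
proof (intro ballI allI impI; elim conjE)
  fix m u i f b
  assume m: "m \<in> colon S U" and u: "u \<in> U" and v: "u + i \<in> U" and b: "b \<in> gr i"
    and f: "Poly_Mapping.keys f \<subseteq> xgr m \<times> gr u" and ev: "ev f = \<zero>\<^bsub>X\<^esub>"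
  interpret M: graded_right_module A gr M mgr by fact
  let ?T = "trunc_module A gr M mgr S"
  obtain \<phi> \<psi> where \<phi>: "\<phi> \<in> graded_hom (trunc_algebra A gr U) X xgr ?T (trunc_grading M mgr S)"
    and \<psi>: "\<And>x. x \<in> carrier X \<Longrightarrow> \<psi> (\<phi> x) = x"
    using iso unfolding graded_isomorphic_def by blast
  have \<phi>_closed: "\<phi> x \<in> carrier M" and \<phi>_add: "\<phi> (x \<oplus>\<^bsub>X\<^esub> y) = \<phi> x \<oplus>\<^bsub>M\<^esub> \<phi> y"
    if "x \<in> carrier X" "y \<in> carrier X" for x y
    using \<phi> that by (auto simp: graded_hom_def hom_def trunc_module_def trunc_carrier_def)
  interpret \<phi>: additive_map X M \<phi>
    by (intro additive_map.intro additive_map_axioms.intro X.M.abelian_group_axioms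
        M.M.abelian_group_axioms \<phi>_closed \<phi>_add)
  have \<phi>_m: "\<phi> x \<in> mgr m" if "x \<in> xgr m" for x
  proof -
    have "\<phi> ` xgr m \<subseteq> trunc_grading M mgr S m" using \<phi> by (simp add: graded_hom_def)
    then show ?thesis using that colon_subset_S[OF m] by (auto simp: trunc_grading_def)
  qed
  \<comment> \<open>Since \<open>m\<close> lies in \<open>(S : U)\<close>, the degree
    \<open>m + w\<close> is in \<open>S\<close>. So the truncated action on \<open>\<phi> x\<close>
    is that of \<open>M\<close>, where associativity holds without restriction on degrees.\<close>
  have \<phi>_act: "\<phi> (x \<triangleleft>\<^bsub>X\<^esub> a) = \<phi> x \<triangleleft>\<^bsub>M\<^esub> a" if "x \<in> xgr m" "a \<in> gr w" "w \<in> U" for x a w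
  proof -
    have "\<phi> (x \<triangleleft>\<^bsub>X\<^esub> a) = \<phi> x \<triangleleft>\<^bsub>?T\<^esub> a"
      using \<phi> X.M.gr_carrier[OF that(1)] gr_trunc_algebra(2)[OF that(3,2)] by (simp add: graded_hom_def)
    also have "\<dots> = \<phi> x \<triangleleft>\<^bsub>M\<^esub> a"
      using trunc_module_ract[OF A.graded_group_axioms M.M.graded_group_axioms M.biadditive_action
          \<phi>_m[OF that(1)] that(2), of S] colon_iff[OF m, of w] that(3) by simp
    finally show ?thesis .
  qed
  note F = act_fun[OF u, of m]
  have F': "(\<lambda>(x, a). x \<triangleleft>\<^bsub>X\<^esub> (a \<otimes>\<^bsub>A\<^esub> b)) \<in> xgr m \<times> gr u \<rightarrow> carrier X"
    using act_closed[OF X.M.gr_carrier A.gr_mult[OF _ b] v] by auto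
  have bM: "additive_map M M (\<lambda>x. x \<triangleleft>\<^bsub>M\<^esub> b)"
    using biadditive_action.additive_map_act_left[OF M.biadditive_action A.gr_carrier[OF b]] .
  have \<phi>b: "additive_map X M (\<lambda>x. \<phi> x \<triangleleft>\<^bsub>M\<^esub> b)"
    by (intro additive_map.intro additive_map_axioms.intro X.M.abelian_group_axioms
        M.M.abelian_group_axioms)
       (simp_all add: \<phi>.map_closed \<phi>.map_add additive_map.map_closed[OF bM] additive_map.map_add[OF bM])
  have "\<phi> (frag_sum X (\<lambda>(x, a). x \<triangleleft>\<^bsub>X\<^esub> (a \<otimes>\<^bsub>A\<^esub> b)) f) =
      frag_sum M (\<lambda>p. \<phi> ((\<lambda>(x, a). x \<triangleleft>\<^bsub>X\<^esub> (a \<otimes>\<^bsub>A\<^esub> b)) p)) f"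
    by (rule additive_map_frag_sum[OF \<phi>.additive_map_axioms F' f])
  also have "\<dots> = frag_sum M (\<lambda>p. \<phi> ((\<lambda>(x, a). x \<triangleleft>\<^bsub>X\<^esub> a) p) \<triangleleft>\<^bsub>M\<^esub> b) f"
  proof (rule M.M.frag_sum_cong[OF _ f])
    show "(\<lambda>p. \<phi> ((\<lambda>(x, a). x \<triangleleft>\<^bsub>X\<^esub> a) p) \<triangleleft>\<^bsub>M\<^esub> b) \<in> xgr m \<times> gr u \<rightarrow> carrier M"
      by (intro Pi_I additive_map.map_closed[OF \<phi>b] funcset_mem[OF F])
    fix p assume "p \<in> xgr m \<times> gr u"
    then obtain x a where p: "p = (x, a)" "x \<in> xgr m" "a \<in> gr u" by auto
    show "\<phi> ((\<lambda>(x, a). x \<triangleleft>\<^bsub>X\<^esub> (a \<otimes>\<^bsub>A\<^esub> b)) p) = \<phi> ((\<lambda>(x, a). x \<triangleleft>\<^bsub>X\<^esub> a) p) \<triangleleft>\<^bsub>M\<^esub> b"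
      using \<phi>_act[OF p(2) A.gr_mult[OF p(3) b] v] \<phi>_act[OF p(2,3) u]
        M.ract_assoc[OF M.M.gr_carrier[OF \<phi>_m[OF p(2)]] A.gr_carrier[OF p(3)] A.gr_carrier[OF b]]
      by (simp add: p(1))
  qed
  also have "\<dots> = \<phi> (ev f) \<triangleleft>\<^bsub>M\<^esub> b"
    by (rule additive_map_frag_sum[OF \<phi>b F f, symmetric])
  also have "\<dots> = \<phi> \<zero>\<^bsub>X\<^esub>"
    by (simp add: ev \<phi>.map_zero additive_map.map_zero[OF bM])
  \<comment> \<open>The image in \<open>M\<close> has been shown to be 0; the left inverse
    \<open>\<psi>\<close> brings this back to \<open>X\<close>.\<close>
  finally have "\<psi> (\<phi> (frag_sum X (\<lambda>(x, a). x \<triangleleft>\<^bsub>X\<^esub> (a \<otimes>\<^bsub>A\<^esub> b)) f)) = \<psi> (\<phi> \<zero>\<^bsub>X\<^esub>)"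
    by (rule arg_cong)
  then show "frag_sum X (\<lambda>(x, a). x \<triangleleft>\<^bsub>X\<^esub> (a \<otimes>\<^bsub>A\<^esub> b)) f = \<zero>\<^bsub>X\<^esub>"
    by (simp only: \<psi>[OF X.M.frag_sum_closed[OF F' f]] \<psi>[OF X.M.zero_closed])
qed

end

section \<open>The product \<open>x \<star> a\<close>: independence of representatives, additivity
  and associativity\<close>

context modular_module
begin

text \<open>The alternative \<open>f = 0\<close> provides a representative of 0 in degrees without a
  top degree or outside \<open>S\<close>, so that every element of \<open>X\<^sub>s\<close> has
  one.\<close>

definition represents :: "int \<Rightarrow> 'x \<Rightarrow> (('x \<times> 'a) \<Rightarrow>\<^sub>0 int) \<Rightarrow> bool" where
  "represents s x f \<longleftrightarrow> ev f = x \<and>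
     (f = 0 \<or> (\<exists>m. top_degree s m \<and> s \<in> S \<and> Poly_Mapping.keys f \<subseteq> xgr m \<times> gr (s - m)))"

lemma represents_exists:
  assumes "x \<in> xgr s"
  shows "\<exists>f. represents s x f"
proof (cases rule: xgr_cases[of s])
  case trivial
  then have "represents s x 0" using assms by (simp add: represents_def X.M.frag_sum_zero)
  then show ?thesis ..
next
  case (span m)
  then obtain f where "Poly_Mapping.keys f \<subseteq> xgr m \<times> gr (s - m)" "x = ev f"
    using assms by (auto simp: span_def)
  then have "represents s x f" using span by (auto simp: represents_def)
  then show ?thesis ..
qed

text \<open>An arbitrary choice; under the kernel condition \<open>star_eval\<close> shows that
  \<open>star\<close> does not depend on it.\<close>

definition rep :: "int \<Rightarrow> 'x \<Rightarrow> ('x \<times> 'a) \<Rightarrow>\<^sub>0 int" where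
  "rep s x = (SOME f. represents s x f)"

lemma represents_rep: "x \<in> xgr s \<Longrightarrow> represents s x (rep s x)"
  unfolding rep_def by (rule someI_ex[OF represents_exists])

text \<open>
  The product \<open>x \<star> a\<close> of \<open>x \<in> X\<^sub>s\<close> and \<open>a \<in> A\<^sub>j\<close>. If no element of \<open>(S : U)\<close> is at most \<open>s\<close>, the \<open>THE\<close>
  term is unspecified, but then \<open>rep s x = 0\<close> and the value is 0.
\<close>

definition star :: "int \<Rightarrow> int \<Rightarrow> 'x \<Rightarrow> 'a \<Rightarrow> 'x" where
  "star s j x a = frag_sum X (emul (s - (THE m. top_degree s m)) j a) (rep s x)"

lemma the_top_degree: "top_degree s m \<Longrightarrow> (THE m. top_degree s m) = m"
  using top_degree_unique by blast

lemma star_trivial: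
  assumes "xgr s = {\<zero>\<^bsub>X\<^esub>}" "\<And>m. \<not> (top_degree s m \<and> s \<in> S)" "x \<in> xgr s"
  shows "star s j x a = \<zero>\<^bsub>X\<^esub>"
  using represents_rep[OF assms(3)] assms(2) by (auto simp: represents_def star_def X.M.frag_sum_zero)

lemma rep_keys:
  assumes "top_degree s m" "s \<in> S" "x \<in> xgr s"
  shows "Poly_Mapping.keys (rep s x) \<subseteq> xgr m \<times> gr (s - m)" and "ev (rep s x) = x"
proof -
  have "rep s x = 0 \<or> Poly_Mapping.keys (rep s x) \<subseteq> xgr m \<times> gr (s - m)"
    using represents_rep[OF assms(3)] top_degree_unique[OF assms(1)] unfolding represents_def by blast
  then show "Poly_Mapping.keys (rep s x) \<subseteq> xgr m \<times> gr (s - m)" by auto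
  show "ev (rep s x) = x" using represents_rep[OF assms(3)] by (simp add: represents_def)
qed

text \<open>Only the last of the four cases uses the kernel condition, with \<open>m \<le> s\<close>
  providing \<open>0 \<le> s - m\<close>. If the degree leaves \<open>U\<close>, all summands are 0;
  if \<open>j\<close> is in \<open>U\<close>, associativity in \<open>X\<close> pulls
  \<open>a\<close> out of the sum; if \<open>j < 0\<close>, then \<open>a\<close> is 0. The value
  \<open>j = 0\<close> belongs to the second case or the first, as 0 is in \<open>U\<close>.\<close>

lemma frag_sum_emul_zero:
  assumes K: kernel_condition and m: "m \<in> colon S U" "m \<le> s" and s: "s \<in> S"
    and f: "Poly_Mapping.keys f \<subseteq> xgr m \<times> gr (s - m)" and ev: "ev f = \<zero>\<^bsub>X\<^esub>" and a: "a \<in> gr j"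
  shows "frag_sum X (emul (s - m) j a) f = \<zero>\<^bsub>X\<^esub>"
proof -
  let ?u = "s - m"
  have u: "?u \<in> U" using colon_iff[OF m(1), of ?u] s by simp
  have triv: "frag_sum X (\<lambda>p. \<zero>\<^bsub>X\<^esub>) f = \<zero>\<^bsub>X\<^esub>"
    by (simp add: frag_sum_def X.M.add.int_pow_one)
  consider "?u + j \<notin> U" | "?u + j \<in> U" "j \<in> U" | "?u + j \<in> U" "j < 0" | "?u + j \<in> U" "0 < j" "j \<notin> U"
    using zero_in_U by (cases j "0 :: int" rule: linorder_cases) auto
  then show ?thesis
  proof cases
    case 1
    then show ?thesis using triv by (simp add: emul_def case_prod_unfold)
  next
    case 2
    note F = act_fun[OF u, of m]
    have "frag_sum X (emul ?u j a) f = frag_sum X (\<lambda>p. (\<lambda>(x, a). x \<triangleleft>\<^bsub>X\<^esub> a) p \<triangleleft>\<^bsub>X\<^esub> a) f"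
    proof (rule X.M.frag_sum_cong[OF _ f])
      show "(\<lambda>p. (\<lambda>(x, a). x \<triangleleft>\<^bsub>X\<^esub> a) p \<triangleleft>\<^bsub>X\<^esub> a) \<in> xgr m \<times> gr ?u \<rightarrow> carrier X"
        by (intro Pi_I act_closed[OF funcset_mem[OF F] a 2(2)])
      fix p assume "p \<in> xgr m \<times> gr ?u"
      then show "emul ?u j a p = (\<lambda>(x, a). x \<triangleleft>\<^bsub>X\<^esub> a) p \<triangleleft>\<^bsub>X\<^esub> a"
        using act_assoc[OF X.M.gr_carrier _ a u 2(2)] 2(1) by (auto simp: emul_def)
    qed
    also have "\<dots> = ev f \<triangleleft>\<^bsub>X\<^esub> a"
      by (rule additive_map_frag_sum[OF additive_map_act[OF a 2(2)] F f, symmetric])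
    finally show ?thesis
      using ev additive_map.map_zero[OF additive_map_act[OF a 2(2)]] by simp
  next
    case 3
    then have "a = \<zero>\<^bsub>A\<^esub>" using a gr_neg by blast
    then have "frag_sum X (emul ?u j a) f = frag_sum X (\<lambda>p. \<zero>\<^bsub>X\<^esub>) f"
      using A.gr_carrier X.M.gr_carrier
      by (intro X.M.frag_sum_cong[OF _ f]) (auto simp: emul_def act_zero_right)
    then show ?thesis using triv by simp
  next
    case 4
    then have "emul ?u j a = (\<lambda>(x, c). x \<triangleleft>\<^bsub>X\<^esub> (c \<otimes>\<^bsub>A\<^esub> a))" by (simp add: emul_def)
    then show ?thesis
      using K[unfolded kernel_condition_def, rule_format, of m ?u j f a] m u f ev a 4 by simp
  qed
qed

text \<open>A given formal sum and the chosen representative of its value differ by one with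
  \<open>ev\<close> equal to 0, to which \<open>frag_sum_emul_zero\<close> applies. So
  \<open>\<star>\<close> may be computed from any formal sum at the top degree, and additivity in
  \<open>x\<close> follows by adding formal sums.\<close>

lemma star_eval:
  assumes K: kernel_condition and m: "top_degree s m" and s: "s \<in> S"
    and f: "Poly_Mapping.keys f \<subseteq> xgr m \<times> gr (s - m)" and a: "a \<in> gr j"
  shows "star s j (ev f) a = frag_sum X (emul (s - m) j a) f"
proof -
  note u = top_degree_in_U[OF m s]
  note F = act_fun[OF u, of m] and E = emul_fun[OF a, of s m]
  have x: "ev f \<in> xgr s"
    using X.M.frag_sum_in_subgroup[OF X.M.gr_subgroup act_fun_gr[OF u] f] by simp
  let ?r = "rep s (ev f)"
  note r = rep_keys[OF m s x]
  have k: "Poly_Mapping.keys (f - ?r) \<subseteq> xgr m \<times> gr (s - m)"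
    using keys_diff[of f ?r] f r by blast
  have "ev (f - ?r) = \<zero>\<^bsub>X\<^esub>"
    using X.M.frag_sum_diff[OF F f r(1)] X.M.frag_sum_closed[OF F f] by (simp add: r(2) X.M.minus_eq X.M.r_neg)
  then have "frag_sum X (emul (s - m) j a) (f - ?r) = \<zero>\<^bsub>X\<^esub>"
    using m by (intro frag_sum_emul_zero[OF K _ _ s k _ a]) (auto simp: top_degree_def)
  then have "frag_sum X (emul (s - m) j a) f \<ominus>\<^bsub>X\<^esub> frag_sum X (emul (s - m) j a) ?r = \<zero>\<^bsub>X\<^esub>"
    using X.M.frag_sum_diff[OF E f r(1)] by simp
  moreover have "x = y" if "x \<ominus>\<^bsub>X\<^esub> y = \<zero>\<^bsub>X\<^esub>" "x \<in> carrier X" "y \<in> carrier X" for x y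
    using that X.M.minus_equality[of x "\<ominus>\<^bsub>X\<^esub> y"] by (simp add: X.M.minus_eq)
  ultimately have "frag_sum X (emul (s - m) j a) f = frag_sum X (emul (s - m) j a) ?r"
    using X.M.frag_sum_closed[OF E f] X.M.frag_sum_closed[OF E r(1)] by blast
  then show ?thesis by (simp add: star_def the_top_degree[OF m])
qed

lemma star_rep:
  assumes m: "top_degree s m" and s: "s \<in> S" and x: "x \<in> xgr s"
  obtains f where "Poly_Mapping.keys f \<subseteq> xgr m \<times> gr (s - m)" "x = ev f"
  using rep_keys[OF assms] that by metis

lemma star_gr:
  assumes x: "x \<in> xgr s" and a: "a \<in> gr j"
  shows "star s j x a \<in> xgr (s + j)"
proof (cases rule: xgr_cases[of s])
  case trivial
  then show ?thesis using star_trivial[OF trivial x] X.M.gr_zero by simp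
next
  case (span m)
  then show ?thesis
    unfolding star_def the_top_degree[OF span(1)]
    by (intro X.M.frag_sum_in_subgroup[OF X.M.gr_subgroup emul_gr[OF a] rep_keys(1)[OF _ _ x]])
qed

lemma star_closed: "x \<in> xgr s \<Longrightarrow> a \<in> gr j \<Longrightarrow> star s j x a \<in> carrier X"
  using star_gr X.M.gr_carrier by blast

lemma star_add_left:
  assumes K: kernel_condition and x: "x \<in> xgr s" and y: "y \<in> xgr s" and a: "a \<in> gr j"
  shows "star s j (x \<oplus>\<^bsub>X\<^esub> y) a = star s j x a \<oplus>\<^bsub>X\<^esub> star s j y a"
proof (cases rule: xgr_cases[of s])
  case trivial
  then show ?thesis using star_trivial[OF trivial] x y X.M.gr_add[OF x y] by simp
next
  case (span m)
  obtain f g where f: "Poly_Mapping.keys f \<subseteq> xgr m \<times> gr (s - m)" "x = ev f"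
    and g: "Poly_Mapping.keys g \<subseteq> xgr m \<times> gr (s - m)" "y = ev g"
    using star_rep[OF span(1,2)] x y by metis
  have "Poly_Mapping.keys (f + g) \<subseteq> xgr m \<times> gr (s - m)"
    using Poly_Mapping.keys_add[of f g] f g by blast
  moreover have "x \<oplus>\<^bsub>X\<^esub> y = ev (f + g)"
    using X.M.frag_sum_add[OF act_fun[OF top_degree_in_U[OF span(1,2)]] f(1) g(1)] f g by simp
  ultimately show ?thesis
    using star_eval[OF K span(1,2) _ a] f g X.M.frag_sum_add[OF emul_fun[OF a] f(1) g(1)] by simp
qed

lemma star_zero_left:
  assumes K: kernel_condition and a: "a \<in> gr j"
  shows "star s j \<zero>\<^bsub>X\<^esub> a = \<zero>\<^bsub>X\<^esub>"
  using star_add_left[OF K X.M.gr_zero X.M.gr_zero a, of s] star_closed[OF X.M.gr_zero a, of s]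
  by (metis X.M.add.l_cancel_one' X.M.l_zero X.M.zero_closed)

lemma star_minus_left:
  assumes K: kernel_condition and x: "x \<in> xgr s" and y: "y \<in> xgr s" and a: "a \<in> gr j"
  shows "star s j (x \<ominus>\<^bsub>X\<^esub> y) a = star s j x a \<ominus>\<^bsub>X\<^esub> star s j y a"
proof -
  note c = X.M.gr_carrier[OF x] X.M.gr_carrier[OF y]
  have "x = (x \<ominus>\<^bsub>X\<^esub> y) \<oplus>\<^bsub>X\<^esub> y" using c by (simp add: X.M.minus_eq X.M.a_assoc X.M.l_neg)
  then have "star s j x a = star s j (x \<ominus>\<^bsub>X\<^esub> y) a \<oplus>\<^bsub>X\<^esub> star s j y a"
    using star_add_left[OF K X.M.gr_minus[OF x y] y a] by simp
  then show ?thesis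
    using star_closed[OF X.M.gr_minus[OF x y] a] star_closed[OF y a]
    by (simp add: X.M.minus_eq X.M.a_assoc X.M.r_neg)
qed

text \<open>For fixed \<open>x\<close> one representative serves both scalars and their sum, so
  independence of representatives is not involved.\<close>

lemma star_add_right:
  assumes x: "x \<in> xgr s" and a: "a \<in> gr j" and b: "b \<in> gr j"
  shows "star s j x (a \<oplus>\<^bsub>A\<^esub> b) = star s j x a \<oplus>\<^bsub>X\<^esub> star s j x b"
proof (cases rule: xgr_cases[of s])
  case trivial
  then show ?thesis using star_trivial[OF trivial x] by simp
next
  case (span m)
  note r = rep_keys(1)[OF span(1,2) x]
  have "frag_sum X (emul (s - m) j (a \<oplus>\<^bsub>A\<^esub> b)) (rep s x) =
      frag_sum X (\<lambda>p. emul (s - m) j a p \<oplus>\<^bsub>X\<^esub> emul (s - m) j b p) (rep s x)"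
  proof (rule X.M.frag_sum_cong[OF _ r])
    show "(\<lambda>p. emul (s - m) j a p \<oplus>\<^bsub>X\<^esub> emul (s - m) j b p) \<in> xgr m \<times> gr (s - m) \<rightarrow> carrier X"
      by (intro Pi_I X.M.a_closed funcset_mem[OF emul_fun[OF a]] funcset_mem[OF emul_fun[OF b]])
    fix p assume "p \<in> xgr m \<times> gr (s - m)"
    then obtain y c where p: "p = (y, c)" "y \<in> xgr m" "c \<in> gr (s - m)" by auto
    have "c \<otimes>\<^bsub>A\<^esub> (a \<oplus>\<^bsub>A\<^esub> b) = c \<otimes>\<^bsub>A\<^esub> a \<oplus>\<^bsub>A\<^esub> c \<otimes>\<^bsub>A\<^esub> b"
      using A.r_distr A.gr_carrier[OF a] A.gr_carrier[OF b] A.gr_carrier[OF p(3)] by simp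
    then show "emul (s - m) j (a \<oplus>\<^bsub>A\<^esub> b) p = emul (s - m) j a p \<oplus>\<^bsub>X\<^esub> emul (s - m) j b p"
      using act_add_right[OF X.M.gr_carrier[OF p(2)] A.gr_mult[OF p(3) a] A.gr_mult[OF p(3) b]]
      by (simp add: emul_def p(1))
  qed
  then show ?thesis
    unfolding star_def the_top_degree[OF span(1)]
    by (simp add: X.M.frag_sum_add_fun[OF emul_fun[OF a] emul_fun[OF b] r])
qed

lemma star_zero_right: "x \<in> xgr s \<Longrightarrow> star s j x \<zero>\<^bsub>A\<^esub> = \<zero>\<^bsub>X\<^esub>"
  using star_add_right[OF _ A.gr_zero A.gr_zero, of x s j] star_closed[OF _ A.gr_zero, of x s j]
  by (metis A.l_zero A.zero_closed X.M.add.l_cancel_one')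

text \<open>The zero branch of \<open>emul\<close> is the one that \<open>act_assoc\<close>
  dictates. Hence for \<open>j\<close> in \<open>U\<close> the summands are the products
  \<open>(y c) a\<close>, and \<open>a\<close> can be pulled out of the sum.\<close>

lemma star_act:
  assumes K: kernel_condition and x: "x \<in> xgr s" and a: "a \<in> gr j" and j: "j \<in> U"
  shows "star s j x a = x \<triangleleft>\<^bsub>X\<^esub> a"
proof (cases rule: xgr_cases[of s])
  case trivial
  then show ?thesis
    using star_trivial[OF trivial x] x additive_map.map_zero[OF additive_map_act[OF a j]] by simp
next
  case (span m)
  note u = top_degree_in_U[OF span(1,2)]
  obtain f where f: "Poly_Mapping.keys f \<subseteq> xgr m \<times> gr (s - m)" "x = ev f"
    using star_rep[OF span(1,2) x] by metis
  have "frag_sum X (emul (s - m) j a) f = frag_sum X (\<lambda>p. (\<lambda>(x, a). x \<triangleleft>\<^bsub>X\<^esub> a) p \<triangleleft>\<^bsub>X\<^esub> a) f"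
  proof (rule X.M.frag_sum_cong[OF _ f(1)])
    show "(\<lambda>p. (\<lambda>(x, a). x \<triangleleft>\<^bsub>X\<^esub> a) p \<triangleleft>\<^bsub>X\<^esub> a) \<in> xgr m \<times> gr (s - m) \<rightarrow> carrier X"
      by (intro Pi_I act_closed[OF funcset_mem[OF act_fun[OF u]] a j])
    fix p assume "p \<in> xgr m \<times> gr (s - m)"
    then show "emul (s - m) j a p = (\<lambda>(x, a). x \<triangleleft>\<^bsub>X\<^esub> a) p \<triangleleft>\<^bsub>X\<^esub> a"
      using act_assoc[OF X.M.gr_carrier _ a u j] by (auto simp: emul_def)
  qed
  also have "\<dots> = ev f \<triangleleft>\<^bsub>X\<^esub> a"
    by (rule additive_map_frag_sum[OF additive_map_act[OF a j] act_fun[OF u] f(1), symmetric])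
  finally show ?thesis using star_eval[OF K span(1,2) f(1) a] f(2) by simp
qed

text \<open>By definition this holds for the top degree \<open>m'\<close> of \<open>t\<close>. For a
  smaller \<open>m\<close>, \<open>e\<close> is a combination of products \<open>p r\<close> with
  \<open>y p\<close> in \<open>X\<close> of degree \<open>m'\<close>, and \<open>t - m' + l\<close>
  and \<open>t - m + l\<close> lie in \<open>U\<close> simultaneously because \<open>m' - m\<close>
  is a period. The freedom in \<open>m\<close> is needed when a multiplication has raised the top
  degree.\<close>

lemma star_of_act:
  assumes K: kernel_condition and m: "m \<in> colon S U" "m \<le> t" and t: "t \<in> S"
    and y: "y \<in> xgr m" and e: "e \<in> gr (t - m)" and b: "b \<in> gr l"
  shows "star t l (y \<triangleleft>\<^bsub>X\<^esub> e) b = (if t - m + l \<in> U then y \<triangleleft>\<^bsub>X\<^esub> (e \<otimes>\<^bsub>A\<^esub> b) else \<zero>\<^bsub>X\<^esub>)"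
proof -
  obtain m' where m': "top_degree t m'" "m \<le> m'" using top_degree_exists[OF m] .
  have C': "m' \<in> colon S U" using m' by (simp add: top_degree_def)
  note yc = X.M.gr_carrier[OF y] and bc = A.gr_carrier[OF b]
  have tm: "t - m \<in> U" using colon_iff[OF m(1), of "t - m"] t by simp
  note u' = top_degree_in_U[OF m'(1) t] and d = colon_diff_in_U[OF m(1) C']
  show ?thesis using gr_split[OF m(1) m' e]
  proof (induction rule: A.products_induct)
    case (mult p r)
    have yp: "y \<triangleleft>\<^bsub>X\<^esub> p \<in> xgr m'" "y \<triangleleft>\<^bsub>X\<^esub> (p \<otimes>\<^bsub>A\<^esub> r) = (y \<triangleleft>\<^bsub>X\<^esub> p) \<triangleleft>\<^bsub>X\<^esub> r"
      using act_products[OF m(1) t m'(1) y mult] by auto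
    have r: "(y \<triangleleft>\<^bsub>X\<^esub> p) \<triangleleft>\<^bsub>X\<^esub> r \<in> carrier X"
      using act_closed[OF X.M.gr_carrier[OF yp(1)] mult(2) u'] .
    have "star t l (ev (frag_of (y \<triangleleft>\<^bsub>X\<^esub> p, r))) b = frag_sum X (emul (t - m') l b) (frag_of (y \<triangleleft>\<^bsub>X\<^esub> p, r))"
      using yp(1) mult(2) by (intro star_eval[OF K m'(1) t _ b]) (simp add: keys_frag_of)
    moreover have "ev (frag_of (y \<triangleleft>\<^bsub>X\<^esub> p, r)) = y \<triangleleft>\<^bsub>X\<^esub> (p \<otimes>\<^bsub>A\<^esub> r)"
      using r by (simp add: X.M.frag_sum_of yp(2))
    moreover have "frag_sum X (emul (t - m') l b) (frag_of (y \<triangleleft>\<^bsub>X\<^esub> p, r)) = emul (t - m') l b (y \<triangleleft>\<^bsub>X\<^esub> p, r)"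
      using funcset_mem[OF emul_fun[OF b, of t m'], of "(y \<triangleleft>\<^bsub>X\<^esub> p, r)"] yp(1) mult(2)
      by (intro X.M.frag_sum_of) simp
    ultimately have "star t l (y \<triangleleft>\<^bsub>X\<^esub> (p \<otimes>\<^bsub>A\<^esub> r)) b = emul (t - m') l b (y \<triangleleft>\<^bsub>X\<^esub> p, r)" by simp
    moreover have "t - m' + l \<in> U \<longleftrightarrow> t - m + l \<in> U"
      using colon_shift[OF m(1) C', of "t - m' + l"] by (simp add: algebra_simps)
    moreover have "(y \<triangleleft>\<^bsub>X\<^esub> p) \<triangleleft>\<^bsub>X\<^esub> (r \<otimes>\<^bsub>A\<^esub> b) = y \<triangleleft>\<^bsub>X\<^esub> ((p \<otimes>\<^bsub>A\<^esub> r) \<otimes>\<^bsub>A\<^esub> b)"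
      if "t - m' + l \<in> U" "t - m + l \<in> U"
      using act_assoc[OF yc mult(1) A.gr_mult[OF mult(2) b] d that(1)] that(2)
        A.m_assoc[OF A.gr_carrier[OF mult(1)] A.gr_carrier[OF mult(2)] bc] by (simp add: algebra_simps)
    ultimately show ?case by (auto simp: emul_def)
  next
    case (diff e1 e2)
    have e: "e1 \<in> gr (t - m)" "e2 \<in> gr (t - m)" using A.products_gr[OF diff(1)] A.products_gr[OF diff(2)] by auto
    have "star t l (y \<triangleleft>\<^bsub>X\<^esub> (e1 \<ominus>\<^bsub>A\<^esub> e2)) b = star t l (y \<triangleleft>\<^bsub>X\<^esub> e1) b \<ominus>\<^bsub>X\<^esub> star t l (y \<triangleleft>\<^bsub>X\<^esub> e2) b"
      using act_gr[OF y e(1) tm] act_gr[OF y e(2) tm]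
      by (simp add: act_minus_right[OF yc e tm] star_minus_left[OF K _ _ b])
    moreover have "(e1 \<ominus>\<^bsub>A\<^esub> e2) \<otimes>\<^bsub>A\<^esub> b = e1 \<otimes>\<^bsub>A\<^esub> b \<ominus>\<^bsub>A\<^esub> e2 \<otimes>\<^bsub>A\<^esub> b"
      using additive_map.map_minus[OF A.additive_map_mult_right[OF bc]] e A.gr_carrier by blast
    moreover have "y \<triangleleft>\<^bsub>X\<^esub> (e1 \<otimes>\<^bsub>A\<^esub> b \<ominus>\<^bsub>A\<^esub> e2 \<otimes>\<^bsub>A\<^esub> b) = y \<triangleleft>\<^bsub>X\<^esub> (e1 \<otimes>\<^bsub>A\<^esub> b) \<ominus>\<^bsub>X\<^esub> y \<triangleleft>\<^bsub>X\<^esub> (e2 \<otimes>\<^bsub>A\<^esub> b)"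
      if "t - m + l \<in> U"
      using act_minus_right[OF yc A.gr_mult[OF e(1) b] A.gr_mult[OF e(2) b] that] .
    ultimately show ?case using diff(3,4) by (simp add: X.M.minus_eq)
  qed
qed

text \<open>Because \<open>s + j\<close> is in \<open>S\<close>, no summand \<open>y (c a)\<close>
  of \<open>x \<star> a\<close> is truncated. Each is thus of the form treated in
  \<open>star_of_act\<close>, still with \<open>y\<close> at the top degree \<open>m\<close> of
  \<open>s\<close>, and the claim reduces to associativity in \<open>A\<close>.\<close>

lemma star_assoc:
  assumes K: kernel_condition and s: "s + j \<in> S"
    and x: "x \<in> xgr s" and a: "a \<in> gr j" and b: "b \<in> gr l"
  shows "star (s + j) l (star s j x a) b = star s (j + l) x (a \<otimes>\<^bsub>A\<^esub> b)"
proof (cases rule: xgr_cases[of s])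
  case trivial
  then show ?thesis using star_trivial[OF trivial x] star_zero_left[OF K b] by simp
next
  case (span m)
  have m: "m \<in> colon S U" "m \<le> s" using span by (auto simp: top_degree_def)
  note ab = A.gr_mult[OF a b] and ac = A.gr_carrier[OF a] and bc = A.gr_carrier[OF b]
  show ?thesis
  \<comment> \<open>For negative \<open>j\<close> the degree \<open>s + j\<close> could drop below
    \<open>m\<close>, but then \<open>a\<close> is 0.\<close>
  proof (cases "j < 0")
    case True
    then have a0: "a = \<zero>\<^bsub>A\<^esub>" using a gr_neg by blast
    then have "a \<otimes>\<^bsub>A\<^esub> b = \<zero>\<^bsub>A\<^esub>" using bc by simp
    then show ?thesis using a0 star_zero_right[OF x] star_zero_left[OF K b] by simp
  next
    case False
    obtain f where f: "Poly_Mapping.keys f \<subseteq> xgr m \<times> gr (s - m)" "x = ev f"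
      using star_rep[OF span(1,2) x] by metis
    have mul: "frag_sum X (emul (s - m) j a) f \<in> xgr (s + j)"
      if "Poly_Mapping.keys f \<subseteq> xgr m \<times> gr (s - m)" for f
      using that by (intro X.M.frag_sum_in_subgroup[OF X.M.gr_subgroup emul_gr[OF a]])
    from f(1) have "star (s + j) l (frag_sum X (emul (s - m) j a) f) b =
        frag_sum X (emul (s - m) (j + l) (a \<otimes>\<^bsub>A\<^esub> b)) f"
    proof (induction rule: frag_induct_on)
      case zero
      then show ?case by (simp add: X.M.frag_sum_zero star_zero_left[OF K b])
    next
      case (diff f g)
      then show ?case
        by (simp add: X.M.frag_sum_diff[OF emul_fun[OF a]] X.M.frag_sum_diff[OF emul_fun[OF ab]]
            star_minus_left[OF K mul mul b])
    next
      case (one p)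
      then obtain y c where p: "p = (y, c)" "y \<in> xgr m" "c \<in> gr (s - m)" by auto
      have uj: "s - m + j \<in> U" using colon_iff[OF m(1), of "s - m + j"] s by simp
      have ca: "c \<otimes>\<^bsub>A\<^esub> a \<in> gr (s + j - m)" using A.gr_mult[OF p(3) a] by (simp add: algebra_simps)
      have of: "frag_sum X (emul (s - m) i e) (frag_of p) = emul (s - m) i e p" if "e \<in> gr i" for i e
        using funcset_mem[OF emul_fun[OF that] one] by (intro X.M.frag_sum_of)
      have "star (s + j) l (y \<triangleleft>\<^bsub>X\<^esub> (c \<otimes>\<^bsub>A\<^esub> a)) b =
          (if s + j - m + l \<in> U then y \<triangleleft>\<^bsub>X\<^esub> ((c \<otimes>\<^bsub>A\<^esub> a) \<otimes>\<^bsub>A\<^esub> b) else \<zero>\<^bsub>X\<^esub>)"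
        using False m(2) by (intro star_of_act[OF K m(1) _ s p(2) ca b]) simp
      moreover have "(c \<otimes>\<^bsub>A\<^esub> a) \<otimes>\<^bsub>A\<^esub> b = c \<otimes>\<^bsub>A\<^esub> (a \<otimes>\<^bsub>A\<^esub> b)"
        using A.m_assoc[OF A.gr_carrier[OF p(3)] ac bc] .
      moreover have "s + j - m + l = s - m + (j + l)" by simp
      ultimately show ?case
        unfolding of[OF a] of[OF ab] by (simp add: emul_def p(1) uj)
    qed
    then show ?thesis
      using star_eval[OF K span(1,2) f(1) a] star_eval[OF K span(1,2) f(1) ab] f(2) by simp
  qed
qed

end

lemma (in graded_ring) comp_mult_left:
  assumes c: "c \<in> gr j" and a: "a \<in> carrier R"
  shows "comp (c \<otimes> a) (j + q) = c \<otimes> comp a q"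
  using a
proof (induction rule: homogeneous_induct)
  case (homogeneous a l)
  then show ?case
    using gr_mult[OF c homogeneous] gr_carrier[OF c] by (simp add: comp_homogeneous)
next
  case (add a b)
  then show ?case using gr_carrier[OF c] by (simp add: r_distr comp_add comp_closed)
qed

section \<open>Construction of the lift\<close>

context modular_module
begin

text \<open>An additive map from \<open>A\<close> to the product of the \<open>X\<^sub>k\<close>,
  stored as the family of its components. No finiteness is asked for here. The value 0 outside the
  carrier makes equality of functions coincide with equality of maps.\<close>

definition graded_maps :: "(int \<Rightarrow> 'a \<Rightarrow> 'x) set" where
  "graded_maps = {F. \<forall>k. (\<forall>a\<in>carrier A. F k a \<in> xgr k) \<and>
     (\<forall>a\<in>carrier A. \<forall>b\<in>carrier A. F k (a \<oplus>\<^bsub>A\<^esub> b) = F k a \<oplus>\<^bsub>X\<^esub> F k b) \<and>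
     (\<forall>a. a \<notin> carrier A \<longrightarrow> F k a = \<zero>\<^bsub>X\<^esub>)}"

text \<open>The module of additive maps from \<open>A\<close> coinduced from the integers.
  Translation of the argument by \<open>c\<close> on the left gives a right action,
  \<open>((F c) d) a = F (c (d a))\<close>, and its axioms do not involve
  \<open>\<star>\<close>.\<close>

definition coinduced :: "('a, int \<Rightarrow> 'a \<Rightarrow> 'x) right_module" where
  "coinduced = \<lparr>carrier = graded_maps, monoid.mult = undefined, one = undefined,
     ring.zero = (\<lambda>k a. \<zero>\<^bsub>X\<^esub>), ring.add = (\<lambda>F G k a. F k a \<oplus>\<^bsub>X\<^esub> G k a),
     ract = (\<lambda>F c k a. if a \<in> carrier A then F k (c \<otimes>\<^bsub>A\<^esub> a) else \<zero>\<^bsub>X\<^esub>)\<rparr>"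

lemma coinduced_simps:
  "carrier coinduced = graded_maps" "\<zero>\<^bsub>coinduced\<^esub> = (\<lambda>k a. \<zero>\<^bsub>X\<^esub>)"
  "add coinduced F G = (\<lambda>k a. F k a \<oplus>\<^bsub>X\<^esub> G k a)"
  "ract coinduced F c = (\<lambda>k a. if a \<in> carrier A then F k (c \<otimes>\<^bsub>A\<^esub> a) else \<zero>\<^bsub>X\<^esub>)"
  by (simp_all add: coinduced_def)

lemma
  assumes "F \<in> graded_maps"
  shows map_gr: "a \<in> carrier A \<Longrightarrow> F k a \<in> xgr k"
    and map_add: "\<lbrakk>a \<in> carrier A; b \<in> carrier A\<rbrakk> \<Longrightarrow> F k (a \<oplus>\<^bsub>A\<^esub> b) = F k a \<oplus>\<^bsub>X\<^esub> F k b"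
    and map_outside: "a \<notin> carrier A \<Longrightarrow> F k a = \<zero>\<^bsub>X\<^esub>"
  using assms by (simp_all add: graded_maps_def)

lemma map_closed: "F \<in> graded_maps \<Longrightarrow> F k a \<in> carrier X"
  by (cases "a \<in> carrier A") (auto simp: map_outside intro: X.M.gr_carrier[OF map_gr])

lemma map_zero: "F \<in> graded_maps \<Longrightarrow> F k \<zero>\<^bsub>A\<^esub> = \<zero>\<^bsub>X\<^esub>"
  using map_add[of F "\<zero>\<^bsub>A\<^esub>" "\<zero>\<^bsub>A\<^esub>" k] map_closed[of F k "\<zero>\<^bsub>A\<^esub>"]
  by (metis A.l_zero A.zero_closed X.M.add.l_cancel_one')

lemma graded_mapsI:
  assumes "\<And>k a. a \<in> carrier A \<Longrightarrow> F k a \<in> xgr k"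
    "\<And>k a b. \<lbrakk>a \<in> carrier A; b \<in> carrier A\<rbrakk> \<Longrightarrow> F k (a \<oplus>\<^bsub>A\<^esub> b) = F k a \<oplus>\<^bsub>X\<^esub> F k b"
    "\<And>k a. a \<notin> carrier A \<Longrightarrow> F k a = \<zero>\<^bsub>X\<^esub>"
  shows "F \<in> graded_maps"
  using assms by (simp add: graded_maps_def)

lemma zero_map: "(\<lambda>k a. \<zero>\<^bsub>X\<^esub>) \<in> graded_maps"
  by (rule graded_mapsI) (simp_all add: X.M.gr_zero)

lemma minus_map:
  assumes "F \<in> graded_maps"
  shows "(\<lambda>k a. \<ominus>\<^bsub>X\<^esub> F k a) \<in> graded_maps"
proof (rule graded_mapsI)
  fix k a assume "a \<in> carrier A"
  then have "\<zero>\<^bsub>X\<^esub> \<ominus>\<^bsub>X\<^esub> F k a \<in> xgr k" by (intro X.M.gr_minus X.M.gr_zero map_gr[OF assms])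
  then show "\<ominus>\<^bsub>X\<^esub> F k a \<in> xgr k" using map_closed[OF assms] by (simp add: X.M.minus_eq)
qed (use assms map_closed[OF assms] in
      \<open>simp_all add: map_add map_outside X.M.minus_add\<close>)

lemma abelian_group_coinduced: "abelian_group coinduced"
proof (rule abelian_groupI; (unfold coinduced_simps)?)
  fix F G assume F: "F \<in> graded_maps" and G: "G \<in> graded_maps"
  show "(\<lambda>k a. F k a \<oplus>\<^bsub>X\<^esub> G k a) \<in> graded_maps"
  proof (rule graded_mapsI)
    fix k a b assume "a \<in> carrier A" "b \<in> carrier A"
    then show "F k (a \<oplus>\<^bsub>A\<^esub> b) \<oplus>\<^bsub>X\<^esub> G k (a \<oplus>\<^bsub>A\<^esub> b) = F k a \<oplus>\<^bsub>X\<^esub> G k a \<oplus>\<^bsub>X\<^esub> (F k b \<oplus>\<^bsub>X\<^esub> G k b)"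
      using map_closed[OF F] map_closed[OF G] by (simp add: map_add[OF F] map_add[OF G] X.M.a_ac)
  qed (simp_all add: map_gr[OF F] map_gr[OF G] map_outside[OF F] map_outside[OF G] X.M.gr_add)
  show "(\<lambda>k a. F k a \<oplus>\<^bsub>X\<^esub> G k a) = (\<lambda>k a. G k a \<oplus>\<^bsub>X\<^esub> F k a)"
    using map_closed[OF F] map_closed[OF G] by (simp add: X.M.a_comm)
  fix H assume H: "H \<in> graded_maps"
  show "(\<lambda>k a. F k a \<oplus>\<^bsub>X\<^esub> G k a \<oplus>\<^bsub>X\<^esub> H k a) = (\<lambda>k a. F k a \<oplus>\<^bsub>X\<^esub> (G k a \<oplus>\<^bsub>X\<^esub> H k a))"
    using map_closed[OF F] map_closed[OF G] map_closed[OF H] by (simp add: X.M.a_assoc)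
next
  fix F assume F: "F \<in> graded_maps"
  show "(\<lambda>k a. \<zero>\<^bsub>X\<^esub> \<oplus>\<^bsub>X\<^esub> F k a) = F" using map_closed[OF F] by simp
  show "\<exists>G\<in>graded_maps. (\<lambda>k a. G k a \<oplus>\<^bsub>X\<^esub> F k a) = (\<lambda>k a. \<zero>\<^bsub>X\<^esub>)"
    using map_closed[OF F] by (intro bexI[OF _ minus_map[OF F]]) (simp add: X.M.l_neg)
qed (rule zero_map)

sublocale C: abelian_group coinduced by (rule abelian_group_coinduced)

lemma minus_coinduced:
  assumes F: "F \<in> graded_maps" and G: "G \<in> graded_maps"
  shows "F \<ominus>\<^bsub>coinduced\<^esub> G = (\<lambda>k a. F k a \<ominus>\<^bsub>X\<^esub> G k a)"
proof -
  have "\<ominus>\<^bsub>coinduced\<^esub> G = (\<lambda>k a. \<ominus>\<^bsub>X\<^esub> G k a)"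
    using minus_map[OF G] G map_closed[OF G]
    by (intro C.minus_equality) (simp_all add: coinduced_simps X.M.l_neg)
  then show ?thesis by (simp add: C.minus_eq X.M.minus_eq coinduced_simps)
qed

lemma right_module_coinduced: "right_module A coinduced"
proof (intro right_module.intro right_module_axioms.intro abelian_group_coinduced;
    (unfold coinduced_simps)?)
  show "ring A" by (rule A.ring_axioms)
  fix F c assume F: "F \<in> graded_maps" and c: "c \<in> carrier A"
  show "(\<lambda>k a. if a \<in> carrier A then F k (c \<otimes>\<^bsub>A\<^esub> a) else \<zero>\<^bsub>X\<^esub>) \<in> graded_maps"
    by (rule graded_mapsI) (use c in \<open>simp_all add: map_gr[OF F] map_add[OF F] A.r_distr\<close>)
  fix G assume "G \<in> graded_maps"
  show "(\<lambda>k a. if a \<in> carrier A then F k (c \<otimes>\<^bsub>A\<^esub> a) \<oplus>\<^bsub>X\<^esub> G k (c \<otimes>\<^bsub>A\<^esub> a) else \<zero>\<^bsub>X\<^esub>) =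
      (\<lambda>k a. (if a \<in> carrier A then F k (c \<otimes>\<^bsub>A\<^esub> a) else \<zero>\<^bsub>X\<^esub>) \<oplus>\<^bsub>X\<^esub>
        (if a \<in> carrier A then G k (c \<otimes>\<^bsub>A\<^esub> a) else \<zero>\<^bsub>X\<^esub>))"
    by (auto simp: fun_eq_iff)
next
  fix F c d assume F: "F \<in> graded_maps" and cd: "c \<in> carrier A" "d \<in> carrier A"
  show "(\<lambda>k a. if a \<in> carrier A then F k ((c \<oplus>\<^bsub>A\<^esub> d) \<otimes>\<^bsub>A\<^esub> a) else \<zero>\<^bsub>X\<^esub>) =
      (\<lambda>k a. (if a \<in> carrier A then F k (c \<otimes>\<^bsub>A\<^esub> a) else \<zero>\<^bsub>X\<^esub>) \<oplus>\<^bsub>X\<^esub>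
        (if a \<in> carrier A then F k (d \<otimes>\<^bsub>A\<^esub> a) else \<zero>\<^bsub>X\<^esub>))"
    using cd by (auto simp: fun_eq_iff A.l_distr map_add[OF F])
  show "(\<lambda>k a. if a \<in> carrier A
        then if d \<otimes>\<^bsub>A\<^esub> a \<in> carrier A then F k (c \<otimes>\<^bsub>A\<^esub> (d \<otimes>\<^bsub>A\<^esub> a)) else \<zero>\<^bsub>X\<^esub> else \<zero>\<^bsub>X\<^esub>) =
      (\<lambda>k a. if a \<in> carrier A then F k (c \<otimes>\<^bsub>A\<^esub> d \<otimes>\<^bsub>A\<^esub> a) else \<zero>\<^bsub>X\<^esub>)"
    using cd by (auto simp: fun_eq_iff A.m_assoc)
next
  fix F assume F: "F \<in> graded_maps"
  show "(\<lambda>k a. if a \<in> carrier A then F k (\<one>\<^bsub>A\<^esub> \<otimes>\<^bsub>A\<^esub> a) else \<zero>\<^bsub>X\<^esub>) = F"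
    using map_outside[OF F] by (auto simp: fun_eq_iff)
qed

sublocale C: right_module A coinduced by (rule right_module_coinduced)

text \<open>
  In \<open>F k a\<close> only the component of \<open>F a\<close> of degree \<open>k\<close> is recorded, so that \<open>F\<close> has degree \<open>i\<close> if
  \<open>F k\<close> vanishes on all \<open>A\<^sub>j\<close> with \<open>j \<noteq> k - i\<close>.
\<close>

definition lift_gr :: "int \<Rightarrow> (int \<Rightarrow> 'a \<Rightarrow> 'x) set" where
  "lift_gr i = {F \<in> graded_maps. (\<forall>k j. \<forall>a\<in>gr j. k \<noteq> i + j \<longrightarrow> F k a = \<zero>\<^bsub>X\<^esub>) \<and>
     (\<forall>j l. i + j \<in> S \<longrightarrow> (\<forall>b\<in>gr j. \<forall>a\<in>gr l. F (i + j + l) (b \<otimes>\<^bsub>A\<^esub> a) = star (i + j) l (F (i + j) b) a))}"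

lemma
  assumes "F \<in> lift_gr i"
  shows lift_gr_map: "F \<in> graded_maps"
    and lift_gr_zero: "\<lbrakk>a \<in> gr j; k \<noteq> i + j\<rbrakk> \<Longrightarrow> F k a = \<zero>\<^bsub>X\<^esub>"
    and lift_gr_mult: "\<lbrakk>i + j \<in> S; b \<in> gr j; a \<in> gr l\<rbrakk> \<Longrightarrow>
      F (i + j + l) (b \<otimes>\<^bsub>A\<^esub> a) = star (i + j) l (F (i + j) b) a"
  using assms by (simp_all add: lift_gr_def)

lemma lift_grI:
  assumes "F \<in> graded_maps" "\<And>k j a. \<lbrakk>a \<in> gr j; k \<noteq> i + j\<rbrakk> \<Longrightarrow> F k a = \<zero>\<^bsub>X\<^esub>"
    "\<And>j l b a. \<lbrakk>i + j \<in> S; b \<in> gr j; a \<in> gr l\<rbrakk> \<Longrightarrow>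
      F (i + j + l) (b \<otimes>\<^bsub>A\<^esub> a) = star (i + j) l (F (i + j) b) a"
  shows "F \<in> lift_gr i"
  using assms by (simp add: lift_gr_def)

text \<open>The law in \<open>lift_gr\<close> is preserved by differences because
  \<open>\<star>\<close> is additive on the left, and this is where the kernel condition
  enters.\<close>

lemma lift_gr_subgroup:
  assumes K: kernel_condition
  shows "additive_subgroup (lift_gr i) coinduced"
proof (rule C.additive_subgroup_minusI)
  show "lift_gr i \<subseteq> carrier coinduced" using lift_gr_map by (auto simp: coinduced_simps)
  show "\<zero>\<^bsub>coinduced\<^esub> \<in> lift_gr i"
    unfolding coinduced_simps by (rule lift_grI[OF zero_map]) (simp_all add: star_zero_left[OF K])
  fix F G assume F: "F \<in> lift_gr i" and G: "G \<in> lift_gr i"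
  note FG = lift_gr_map[OF F] lift_gr_map[OF G]
  have "(\<lambda>k a. F k a \<ominus>\<^bsub>X\<^esub> G k a) \<in> lift_gr i"
  proof (rule lift_grI)
    show "(\<lambda>k a. F k a \<ominus>\<^bsub>X\<^esub> G k a) \<in> graded_maps"
      using C.minus_closed[of F G] FG by (simp add: minus_coinduced[OF FG] coinduced_simps)
    fix j l a b assume *: "i + j \<in> S" "b \<in> gr j" "a \<in> gr l"
    note b = A.gr_carrier[OF *(2)]
    show "F (i + j + l) (b \<otimes>\<^bsub>A\<^esub> a) \<ominus>\<^bsub>X\<^esub> G (i + j + l) (b \<otimes>\<^bsub>A\<^esub> a) =
        star (i + j) l (F (i + j) b \<ominus>\<^bsub>X\<^esub> G (i + j) b) a"
      using star_minus_left[OF K map_gr[OF FG(1) b] map_gr[OF FG(2) b] *(3)]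
      by (simp add: lift_gr_mult[OF F *] lift_gr_mult[OF G *])
  qed (simp add: lift_gr_zero[OF F] lift_gr_zero[OF G] X.M.minus_eq)
  then show "F \<ominus>\<^bsub>coinduced\<^esub> G \<in> lift_gr i" by (simp add: minus_coinduced[OF FG])
qed

text \<open>The part of \<open>F\<close> of degree \<open>i\<close>: a map of that degree reaches
  \<open>X\<^sub>k\<close> only from \<open>A\<^sub>k\<^sub>-\<^sub>i\<close>, so everything else in
  the argument is discarded.\<close>

definition pr :: "int \<Rightarrow> (int \<Rightarrow> 'a \<Rightarrow> 'x) \<Rightarrow> int \<Rightarrow> 'a \<Rightarrow> 'x" where
  "pr i F = (\<lambda>k a. if a \<in> carrier A then F k (A.comp a (k - i)) else \<zero>\<^bsub>X\<^esub>)"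

lemma pr_map:
  assumes "F \<in> graded_maps"
  shows "pr i F \<in> graded_maps"
  by (rule graded_mapsI)
     (use assms in \<open>simp_all add: pr_def map_gr A.comp_closed A.comp_add map_add\<close>)

lemma additive_map_pr: "additive_map coinduced coinduced (pr i)"
proof (intro additive_map.intro additive_map_axioms.intro abelian_group_coinduced)
  show "pr i F \<in> carrier coinduced" if "F \<in> carrier coinduced" for F
    using that by (simp add: coinduced_simps(1) pr_map)
  show "pr i (F \<oplus>\<^bsub>coinduced\<^esub> G) = pr i F \<oplus>\<^bsub>coinduced\<^esub> pr i G" for F G
    by (simp add: coinduced_simps pr_def fun_eq_iff)
qed

lemma pr_lift_gr:
  assumes "F \<in> lift_gr i"
  shows "pr j F = (if j = i then F else \<zero>\<^bsub>coinduced\<^esub>)"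
proof (intro ext)
  fix k a
  note F = lift_gr_map[OF assms]
  show "pr j F k a = (if j = i then F else \<zero>\<^bsub>coinduced\<^esub>) k a"
  proof (cases "a \<in> carrier A")
    case True
    show ?thesis
    proof (cases "j = i")
      case False
      then show ?thesis
        using True lift_gr_zero[OF assms A.comp_gr[OF True]] by (simp add: pr_def coinduced_simps)
    next
      case ji: True
      have "F k (A.comp a (k - i)) = F k a" using True
      proof (induction rule: A.homogeneous_induct)
        case (homogeneous a l)
        then show ?case
          using lift_gr_zero[OF assms homogeneous, of k] map_zero[OF F]
          by (auto simp: A.comp_homogeneous)
      next
        case (add a b)
        then show ?case by (simp add: A.comp_add map_add[OF F] A.comp_closed)
      qed
      then show ?thesis using True ji by (simp add: pr_def)
    qed
  qed (simp add: pr_def map_outside[OF F] coinduced_simps)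
qed

definition lift_carrier :: "(int \<Rightarrow> 'a \<Rightarrow> 'x) set" where
  "lift_carrier = {F \<in> graded_maps. (\<forall>i. pr i F \<in> lift_gr i) \<and> finite {i. pr i F \<noteq> \<zero>\<^bsub>coinduced\<^esub>}}"

lemma lift_carrier_subgroup:
  assumes K: kernel_condition
  shows "additive_subgroup lift_carrier coinduced"
proof (rule C.additive_subgroup_minusI)
  show "lift_carrier \<subseteq> carrier coinduced" by (auto simp: lift_carrier_def coinduced_simps)
  have "pr i \<zero>\<^bsub>coinduced\<^esub> = \<zero>\<^bsub>coinduced\<^esub>" for i
    by (rule additive_map.map_zero[OF additive_map_pr])
  then show "\<zero>\<^bsub>coinduced\<^esub> \<in> lift_carrier"
    using C.zero_closed additive_subgroup.zero_closed[OF lift_gr_subgroup[OF K]]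
    by (simp add: lift_carrier_def coinduced_simps(1))
  fix F G assume F: "F \<in> lift_carrier" and G: "G \<in> lift_carrier"
  then have FG: "F \<in> carrier coinduced" "G \<in> carrier coinduced"
    by (simp_all add: lift_carrier_def coinduced_simps)
  have pr: "pr i (F \<ominus>\<^bsub>coinduced\<^esub> G) = pr i F \<ominus>\<^bsub>coinduced\<^esub> pr i G" for i
    by (rule additive_map.map_minus[OF additive_map_pr FG])
  have "{i. pr i F \<ominus>\<^bsub>coinduced\<^esub> pr i G \<noteq> \<zero>\<^bsub>coinduced\<^esub>} \<subseteq>
      {i. pr i F \<noteq> \<zero>\<^bsub>coinduced\<^esub>} \<union> {i. pr i G \<noteq> \<zero>\<^bsub>coinduced\<^esub>}"
    by (auto simp: C.minus_eq)
  moreover have "finite \<dots>" using F G by (simp add: lift_carrier_def)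
  ultimately have "finite {i. pr i F \<ominus>\<^bsub>coinduced\<^esub> pr i G \<noteq> \<zero>\<^bsub>coinduced\<^esub>}" by (rule finite_subset)
  moreover have "pr i F \<ominus>\<^bsub>coinduced\<^esub> pr i G \<in> lift_gr i" for i
    using F G by (intro C.additive_subgroup_minus[OF lift_gr_subgroup[OF K]]) (simp_all add: lift_carrier_def)
  ultimately show "F \<ominus>\<^bsub>coinduced\<^esub> G \<in> lift_carrier"
    using C.minus_closed[OF FG] by (simp add: lift_carrier_def pr coinduced_simps(1))
qed

lemma lift_gr_subset:
  assumes K: kernel_condition
  shows "lift_gr i \<subseteq> lift_carrier"
proof
  fix F assume F: "F \<in> lift_gr i"
  have "{j. pr j F \<noteq> \<zero>\<^bsub>coinduced\<^esub>} \<subseteq> {i}" by (auto simp: pr_lift_gr[OF F])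
  then have "finite {j. pr j F \<noteq> \<zero>\<^bsub>coinduced\<^esub>}" by (rule finite_subset) simp
  then show "F \<in> lift_carrier"
    using F lift_gr_map[OF F] additive_subgroup.zero_closed[OF lift_gr_subgroup[OF K]]
    by (simp add: lift_carrier_def pr_lift_gr[OF F])
qed

text \<open>On an argument in \<open>A\<^sub>l\<close> and in the component \<open>k\<close>, only
  the summand with \<open>i = k - l\<close> survives, and it has the value of \<open>F\<close>
  there.\<close>

lemma finsum_pr:
  assumes F: "F \<in> lift_carrier"
  shows "(\<Oplus>\<^bsub>coinduced\<^esub>i\<in>{i. pr i F \<noteq> \<zero>\<^bsub>coinduced\<^esub>}. pr i F) = F" (is "?s = F")
proof (intro ext)
  fix k a
  let ?I = "{i. pr i F \<noteq> \<zero>\<^bsub>coinduced\<^esub>}"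
  have Fm: "F \<in> graded_maps" and fin: "finite ?I" using F by (simp_all add: lift_carrier_def)
  have prc: "pr i F \<in> carrier coinduced" for i using pr_map[OF Fm] by (simp add: coinduced_simps)
  have s: "?s \<in> graded_maps"
    using C.finsum_closed[of "\<lambda>i. pr i F" ?I] prc by (simp add: coinduced_simps(1))
  show "?s k a = F k a"
  proof (cases "a \<in> carrier A")
    case True
    then show ?thesis
    proof (induction rule: A.homogeneous_induct)
      case (add a b)
      then show ?case by (simp add: map_add[OF s] map_add[OF Fm])
    next
      case (homogeneous a l)
      note a = A.gr_carrier[OF homogeneous]
      have "additive_map coinduced X (\<lambda>F. F k a)"
        by (intro additive_map.intro additive_map_axioms.intro abelian_group_coinduced
            X.M.abelian_group_axioms) (simp_all add: coinduced_simps map_closed)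
      then have "?s k a = (\<Oplus>\<^bsub>X\<^esub>i\<in>?I. pr i F k a)"
        using prc by (rule additive_map.map_finsum)
      also have "\<dots> = (\<Oplus>\<^bsub>X\<^esub>i\<in>?I. if k - l = i then F k a else \<zero>\<^bsub>X\<^esub>)"
        using a map_closed[OF Fm] map_zero[OF Fm]
        by (intro X.M.finsum_cong') (auto simp: pr_def A.comp_homogeneous[OF homogeneous])
      also have "\<dots> = F k a"
      proof (cases "k - l \<in> ?I")
        case True
        then show ?thesis
          using fin map_closed[OF Fm] X.M.add.finprod_singleton[of "k - l" ?I "\<lambda>_. F k a"] by simp
      next
        \<comment> \<open>If the index \<open>k - l\<close> does not occur in the sum, its
          projection is zero and so \<open>F k a\<close> is 0 too.\<close>
        case False
        then have "pr (k - l) F k a = \<zero>\<^bsub>X\<^esub>" by (simp add: coinduced_simps)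
        then have "F k a = \<zero>\<^bsub>X\<^esub>" using a by (simp add: pr_def A.comp_homogeneous[OF homogeneous])
        then show ?thesis by (simp add: X.M.add.finprod_one_eqI)
      qed
      finally show ?case .
    qed
  qed (simp add: map_outside[OF s] map_outside[OF Fm])
qed

section \<open>The lift as a graded right \<open>A\<close>-module\<close>

definition lift :: "('a, int \<Rightarrow> 'a \<Rightarrow> 'x) right_module" where
  "lift = coinduced\<lparr>carrier := lift_carrier\<rparr>"

lemma lift_simps:
  "carrier lift = lift_carrier" "\<zero>\<^bsub>lift\<^esub> = \<zero>\<^bsub>coinduced\<^esub>" "add lift = add coinduced"
  "ract lift = ract coinduced"
  by (simp_all add: lift_def)

lemma graded_group_lift:
  assumes K: kernel_condition
  shows "graded_group lift lift_gr"
proof -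
  note H = lift_carrier_subgroup[OF K]
  have ab: "abelian_group lift" by (rule C.abelian_group_restrict[OF H lift_simps(1-3)])
  then interpret L: abelian_group lift .
  show ?thesis
  proof (rule graded_groupI[OF ab, where p = pr])
    show "additive_subgroup (lift_gr i) lift" for i
      by (rule C.additive_subgroup_restrict[OF H lift_simps(1-3) lift_gr_subgroup[OF K] lift_gr_subset[OF K]])
    show "pr j F = (if j = i then F else \<zero>\<^bsub>lift\<^esub>)" if "F \<in> lift_gr i" for i j F
      using pr_lift_gr[OF that] by (simp add: lift_simps)
    show "additive_map lift lift (pr i)" for i
    proof unfold_locales
      fix F G assume FG: "F \<in> carrier lift" "G \<in> carrier lift"
      then show "pr i F \<in> carrier lift"
        using lift_gr_subset[OF K] by (auto simp: lift_simps lift_carrier_def)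
      show "pr i (F \<oplus>\<^bsub>lift\<^esub> G) = pr i F \<oplus>\<^bsub>lift\<^esub> pr i G"
        using FG by (simp add: lift_simps lift_carrier_def coinduced_simps
            additive_map.map_add[OF additive_map_pr, unfolded coinduced_simps])
    qed
    show "\<exists>c I. (\<forall>i. c i \<in> lift_gr i) \<and> finite I \<and> F = finsum lift c I" if "F \<in> carrier lift" for F
    proof (intro exI conjI allI)
      have F: "F \<in> lift_carrier" using that by (simp add: lift_simps)
      then show "pr i F \<in> lift_gr i" for i by (simp add: lift_carrier_def)
      then have "finsum lift (\<lambda>i. pr i F) {i. pr i F \<noteq> \<zero>\<^bsub>coinduced\<^esub>} =
          finsum coinduced (\<lambda>i. pr i F) {i. pr i F \<noteq> \<zero>\<^bsub>coinduced\<^esub>}"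
        using lift_gr_subset[OF K]
        by (intro finsum_carrier_update[OF abelian_group_coinduced H _ ab lift_simps(1-3)]) blast
      then show "F = finsum lift (\<lambda>i. pr i F) {i. pr i F \<noteq> \<zero>\<^bsub>coinduced\<^esub>}"
        using finsum_pr[OF F] by simp
      show "finite {i. pr i F \<noteq> \<zero>\<^bsub>coinduced\<^esub>}" using F by (simp add: lift_carrier_def)
    qed
  qed
qed

text \<open>The law for \<open>F c\<close> at the pair \<open>(b, a)\<close> is the law for
  \<open>F\<close> at \<open>(c b, a)\<close>, whose degree \<open>i + (n + j)\<close> is the
  same.\<close>

lemma lift_gr_act:
  assumes F: "F \<in> lift_gr i" and c: "c \<in> gr n"
  shows "F \<triangleleft>\<^bsub>coinduced\<^esub> c \<in> lift_gr (i + n)"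
proof (rule lift_grI)
  note Fm = lift_gr_map[OF F] and cc = A.gr_carrier[OF c]
  show "F \<triangleleft>\<^bsub>coinduced\<^esub> c \<in> graded_maps"
    using C.ract_closed[of F c] Fm cc by (simp add: coinduced_simps(1))
  show "(F \<triangleleft>\<^bsub>coinduced\<^esub> c) k a = \<zero>\<^bsub>X\<^esub>" if "a \<in> gr j" "k \<noteq> i + n + j" for k j a
    using that lift_gr_zero[OF F A.gr_mult[OF c that(1)], of k] A.gr_carrier[OF that(1)]
    by (simp add: coinduced_simps)
  fix j l a b assume *: "i + n + j \<in> S" "b \<in> gr j" "a \<in> gr l"
  note ba = A.gr_carrier[OF *(2)] A.gr_carrier[OF *(3)]
  have "F (i + (n + j) + l) ((c \<otimes>\<^bsub>A\<^esub> b) \<otimes>\<^bsub>A\<^esub> a) = star (i + (n + j)) l (F (i + (n + j)) (c \<otimes>\<^bsub>A\<^esub> b)) a"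
    using * by (intro lift_gr_mult[OF F] A.gr_mult c) (simp_all add: add.assoc)
  then show "(F \<triangleleft>\<^bsub>coinduced\<^esub> c) (i + n + j + l) (b \<otimes>\<^bsub>A\<^esub> a) =
      star (i + n + j) l ((F \<triangleleft>\<^bsub>coinduced\<^esub> c) (i + n + j) b) a"
    using ba cc by (simp add: coinduced_simps A.m_assoc add.assoc)
qed

text \<open>Acting by \<open>c\<close> of degree \<open>j\<close> shifts projections by
  \<open>j\<close>, so finiteness of the support is inherited; general \<open>c\<close> are sums of
  homogeneous ones.\<close>

lemma lift_carrier_act:
  assumes K: kernel_condition and F: "F \<in> lift_carrier" and c: "c \<in> carrier A"
  shows "F \<triangleleft>\<^bsub>coinduced\<^esub> c \<in> lift_carrier"
proof -
  have Fm: "F \<in> graded_maps" using F by (simp add: lift_carrier_def)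
  then have Fc: "F \<in> carrier coinduced" by (simp add: coinduced_simps)
  show ?thesis using c
  proof (induction rule: A.homogeneous_induct)
    case (add c d)
    then show ?case
      using C.ract_add_right[OF Fc add(1,2)]
        additive_subgroup.a_closed[OF lift_carrier_subgroup[OF K]] by simp
  next
    case (homogeneous c j)
    note cc = A.gr_carrier[OF homogeneous]
    have pr: "pr n (F \<triangleleft>\<^bsub>coinduced\<^esub> c) = pr (n - j) F \<triangleleft>\<^bsub>coinduced\<^esub> c" for n
    proof (intro ext)
      fix k a
      have "A.comp (c \<otimes>\<^bsub>A\<^esub> a) (k - (n - j)) = c \<otimes>\<^bsub>A\<^esub> A.comp a (k - n)" if "a \<in> carrier A"
        using A.comp_mult_left[OF homogeneous that, of "k - n"] by (simp add: algebra_simps)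
      then show "pr n (F \<triangleleft>\<^bsub>coinduced\<^esub> c) k a = (pr (n - j) F \<triangleleft>\<^bsub>coinduced\<^esub> c) k a"
        using cc by (simp add: pr_def coinduced_simps A.comp_closed)
    qed
    have "\<zero>\<^bsub>coinduced\<^esub> \<triangleleft>\<^bsub>coinduced\<^esub> c = \<zero>\<^bsub>coinduced\<^esub>"
      by (simp add: coinduced_simps fun_eq_iff)
    then have "{n. pr (n - j) F \<triangleleft>\<^bsub>coinduced\<^esub> c \<noteq> \<zero>\<^bsub>coinduced\<^esub>} \<subseteq>
        (\<lambda>i. i + j) ` {i. pr i F \<noteq> \<zero>\<^bsub>coinduced\<^esub>}"
      by (intro subsetI, rule_tac x = "x - j" in image_eqI) auto
    moreover have "finite \<dots>" using F by (simp add: lift_carrier_def)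
    ultimately have "finite {n. pr (n - j) F \<triangleleft>\<^bsub>coinduced\<^esub> c \<noteq> \<zero>\<^bsub>coinduced\<^esub>}"
      by (rule finite_subset)
    moreover have "pr (n - j) F \<triangleleft>\<^bsub>coinduced\<^esub> c \<in> lift_gr n" for n
      using lift_gr_act[OF _ homogeneous, of "pr (n - j) F" "n - j"] F by (simp add: lift_carrier_def)
    ultimately show ?case
      using C.ract_closed[OF Fc cc] by (simp add: lift_carrier_def pr coinduced_simps(1))
  qed
qed

lemma graded_right_module_lift:
  assumes K: kernel_condition
  shows "graded_right_module A gr lift lift_gr"
proof -
  interpret L: graded_group lift lift_gr by (rule graded_group_lift[OF K])
  have sub: "F \<in> carrier coinduced" if "F \<in> lift_carrier" for F
    using that by (simp add: lift_carrier_def coinduced_simps)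
  have "right_module A lift"
    by (intro right_module.intro right_module_axioms.intro A.ring_axioms L.abelian_group_axioms)
       (simp_all add: lift_simps lift_carrier_act[OF K] sub C.ract_add_left C.ract_add_right
          C.ract_assoc C.ract_one)
  then show ?thesis
    by (intro graded_right_module.intro graded_right_module_axioms.intro A.graded_ring_axioms
        L.graded_group_axioms) (simp_all add: lift_simps lift_gr_act)
qed

section \<open>The map from \<open>X\<close> to the lift that sends \<open>x\<close> to left
  multiplication by \<open>x\<close>\<close>

definition embed :: "int \<Rightarrow> 'x \<Rightarrow> int \<Rightarrow> 'a \<Rightarrow> 'x" where
  "embed s x = (\<lambda>k a. if a \<in> carrier A then star s (k - s) x (A.comp a (k - s)) else \<zero>\<^bsub>X\<^esub>)"

lemma embed_homogeneous:
  assumes x: "x \<in> xgr s" and a: "a \<in> gr j"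
  shows "embed s x k a = (if k = s + j then star s j x a else \<zero>\<^bsub>X\<^esub>)"
  using A.gr_carrier[OF a] star_zero_right[OF x]
  by (auto simp: embed_def A.comp_homogeneous[OF a])

lemma embed_map:
  assumes x: "x \<in> xgr s"
  shows "embed s x \<in> graded_maps"
proof (rule graded_mapsI)
  fix k a b assume a: "a \<in> carrier A"
  then show "embed s x k a \<in> xgr k"
    using star_gr[OF x A.comp_gr[OF a], of "k - s"] by (simp add: embed_def)
  assume b: "b \<in> carrier A"
  show "embed s x k (a \<oplus>\<^bsub>A\<^esub> b) = embed s x k a \<oplus>\<^bsub>X\<^esub> embed s x k b"
    using a b star_add_right[OF x A.comp_gr[OF a] A.comp_gr[OF b]]
    by (simp add: embed_def A.comp_add)
qed (simp add: embed_def)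

text \<open>Membership is precisely \<open>star_assoc\<close>, whose restriction to
  \<open>s + j\<close> in \<open>S\<close> is mirrored in \<open>lift_gr\<close>.\<close>

lemma embed_lift_gr:
  assumes K: kernel_condition and x: "x \<in> xgr s"
  shows "embed s x \<in> lift_gr s"
proof (rule lift_grI[OF embed_map[OF x]])
  show "embed s x k a = \<zero>\<^bsub>X\<^esub>" if "a \<in> gr j" "k \<noteq> s + j" for k j a
    using that by (simp add: embed_homogeneous[OF x])
  fix j l b a assume *: "s + j \<in> S" "b \<in> gr j" "a \<in> gr l"
  show "embed s x (s + j + l) (b \<otimes>\<^bsub>A\<^esub> a) = star (s + j) l (embed s x (s + j) b) a"
    using star_assoc[OF K *(1) x *(2,3)]
    by (simp add: embed_homogeneous[OF x A.gr_mult[OF *(2,3)]] embed_homogeneous[OF x *(2)])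
qed

lemma graded_map_ext:
  assumes F: "F \<in> graded_maps" and G: "G \<in> graded_maps"
    and eq: "\<And>k j a. a \<in> gr j \<Longrightarrow> F k a = G k a"
  shows "F = G"
proof (intro ext)
  fix k a
  show "F k a = G k a"
  proof (cases "a \<in> carrier A")
    case True
    then show ?thesis
      by (induction rule: A.homogeneous_induct) (simp_all add: eq map_add[OF F] map_add[OF G])
  qed (simp add: map_outside[OF F] map_outside[OF G])
qed

text \<open>For \<open>s\<close> in \<open>S\<close>, the law of \<open>lift_gr\<close> with
  \<open>b = \<one>\<close> reads \<open>F a = F \<one> \<star> a\<close>, so evaluation at
  \<open>\<one>\<close> inverts \<open>embed\<close>. Outside \<open>S\<close> both sides vanish,
  the truncation by definition and \<open>X\<close> by \<open>xgr_outside\<close>.\<close>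

lemma liftable:
  assumes K: kernel_condition
  shows "liftable TYPE(int \<Rightarrow> 'a \<Rightarrow> 'x) A gr S U X xgr"
proof -
  interpret L: graded_right_module A gr lift lift_gr by (rule graded_right_module_lift[OF K])
  let ?T = "trunc_module A gr lift lift_gr S" and ?tgr = "trunc_grading lift lift_gr S"
  have T: "carrier ?T = trunc_carrier lift lift_gr S" "\<zero>\<^bsub>?T\<^esub> = \<zero>\<^bsub>lift\<^esub>" "add ?T = add lift"
    by (simp_all add: trunc_module_def)
  have sub: "carrier (trunc_algebra A gr U) \<subseteq> carrier A" and addR: "add (trunc_algebra A gr U) = add A"
    by (auto simp: trunc_algebra_def trunc_carrier_def)
  have tgr: "?tgr s = lift_gr s" if "s \<in> S" for s using that by (simp add: trunc_grading_def)
  have "graded_isomorphic (trunc_algebra A gr U) X xgr ?T ?tgr"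
  proof (rule graded_isomorphicI[where \<phi> = embed and \<psi> = "\<lambda>s F. F s \<one>\<^bsub>A\<^esub>"])
    show "graded_group X xgr" by (rule X.M.graded_group_axioms)
    show "graded_group ?T ?tgr" by (rule L.M.trunc_graded_group[OF T])
    show "graded_group (trunc_algebra A gr U) (trunc_grading A gr U)" by (rule X.R.graded_group_axioms)
    show "biadditive_action (trunc_algebra A gr U) X" by (rule X.biadditive_action)
    show "biadditive_action (trunc_algebra A gr U) ?T"
      by (rule trunc_module_biadditive_action[OF A.graded_group_axioms L.M.graded_group_axioms
            L.biadditive_action L.gr_ract X.R.abelian_group_axioms sub addR])
    show "x \<triangleleft>\<^bsub>X\<^esub> a \<in> xgr (i + j)" if "x \<in> xgr i" "a \<in> trunc_grading A gr U j" for i j x a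
      using that by (rule X.gr_ract)
  next
    fix s x assume x: "x \<in> xgr s"
    show "embed s x \<in> ?tgr s"
    proof (cases "s \<in> S")
      case False
      then have "x = \<zero>\<^bsub>X\<^esub>" using x xgr_outside by blast
      then have "embed s x = \<zero>\<^bsub>lift\<^esub>"
        using star_zero_left[OF K A.comp_gr] by (simp add: embed_def lift_simps coinduced_simps fun_eq_iff)
      then show ?thesis using False by (simp add: trunc_grading_def)
    qed (use embed_lift_gr[OF K x] tgr in simp)
    have "embed s x s \<one>\<^bsub>A\<^esub> = x \<triangleleft>\<^bsub>X\<^esub> \<one>\<^bsub>A\<^esub>"
      by (simp add: embed_homogeneous[OF x A.gr_one] star_act[OF K x A.gr_one zero_in_U])
    then show "embed s x s \<one>\<^bsub>A\<^esub> = x" using act_one[OF X.M.gr_carrier[OF x]] by simp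
    fix y assume y: "y \<in> xgr s"
    show "embed s (x \<oplus>\<^bsub>X\<^esub> y) = embed s x \<oplus>\<^bsub>?T\<^esub> embed s y"
      by (auto simp: T lift_simps coinduced_simps embed_def fun_eq_iff star_add_left[OF K x y] A.comp_gr)
  next
    fix s j x a assume x: "x \<in> xgr s" and a': "a \<in> trunc_grading A gr U j"
    have a: "a \<in> gr j"
      using a' A.gr_zero by (auto simp: trunc_grading_def split: if_splits)
    have xa: "x \<triangleleft>\<^bsub>X\<^esub> a = star s j x a"
      using a' star_act[OF K x a]
        act_zero_right[OF X.M.gr_carrier[OF x]] star_zero_right[OF x]
      by (auto simp: trunc_grading_def split: if_splits)
    have e: "embed s x \<in> lift_gr s" by (rule embed_lift_gr[OF K x])
    have act: "embed s x \<triangleleft>\<^bsub>?T\<^esub> a = (if s + j \<in> S then embed s x \<triangleleft>\<^bsub>lift\<^esub> a else \<zero>\<^bsub>lift\<^esub>)"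
      by (rule trunc_module_ract[OF A.graded_group_axioms L.M.graded_group_axioms
            L.biadditive_action e a])
    note g = star_gr[OF x a]
    show "embed (s + j) (x \<triangleleft>\<^bsub>X\<^esub> a) = embed s x \<triangleleft>\<^bsub>?T\<^esub> a"
    proof (cases "s + j \<in> S")
      case True
      have "embed (s + j) (star s j x a) = embed s x \<triangleleft>\<^bsub>lift\<^esub> a"
      proof (rule graded_map_ext[OF embed_map[OF g]])
        show "embed s x \<triangleleft>\<^bsub>lift\<^esub> a \<in> graded_maps"
          using lift_gr_map[OF lift_gr_act[OF e a]] by (simp add: lift_simps)
        fix k l c assume c: "c \<in> gr l"
        show "embed (s + j) (star s j x a) k c = (embed s x \<triangleleft>\<^bsub>lift\<^esub> a) k c"
          using star_assoc[OF K True x a c] A.gr_carrier[OF c]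
          by (simp add: lift_simps coinduced_simps embed_homogeneous[OF g c]
              embed_homogeneous[OF x A.gr_mult[OF a c]] add.assoc)
      qed
      then show ?thesis using True by (simp add: act xa)
    next
      case False
      then have "x \<triangleleft>\<^bsub>X\<^esub> a = \<zero>\<^bsub>X\<^esub>" using g xgr_outside unfolding xa by blast
      then have "embed (s + j) (x \<triangleleft>\<^bsub>X\<^esub> a) = \<zero>\<^bsub>lift\<^esub>"
        using star_zero_left[OF K A.comp_gr] by (simp add: embed_def lift_simps coinduced_simps fun_eq_iff)
      then show ?thesis using False by (simp add: act)
    qed
  next
    fix s F assume F: "F \<in> ?tgr s"
    show "F s \<one>\<^bsub>A\<^esub> \<in> xgr s"
      using F map_gr[OF lift_gr_map, of F s] X.M.gr_zero
      by (auto simp: trunc_grading_def lift_simps coinduced_simps split: if_splits)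
    show "embed s (F s \<one>\<^bsub>A\<^esub>) = F"
    proof (cases "s \<in> S")
      case False
      then have "F = (\<lambda>k a. \<zero>\<^bsub>X\<^esub>)" using F by (simp add: trunc_grading_def lift_simps coinduced_simps)
      then show ?thesis using star_zero_left[OF K A.comp_gr] by (simp add: embed_def fun_eq_iff)
    next
      case True
      then have F: "F \<in> lift_gr s" using F by (simp add: trunc_grading_def)
      note Fm = lift_gr_map[OF F]
      have x: "F s \<one>\<^bsub>A\<^esub> \<in> xgr s" using map_gr[OF Fm] by simp
      show ?thesis
      proof (rule graded_map_ext[OF embed_map[OF x] Fm])
        fix k j a assume a: "a \<in> gr j"
        show "embed s (F s \<one>\<^bsub>A\<^esub>) k a = F k a"
          using lift_gr_mult[OF F _ A.gr_one a] lift_gr_zero[OF F a, of k] True A.gr_carrier[OF a]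
          by (simp add: embed_homogeneous[OF x a])
      qed
    qed
  qed
  then show ?thesis
    unfolding liftable_def using L.graded_right_module_axioms by blast
qed

end

text \<open>The second conjunct justifies the fixed type of the lift. It is obtained through the
  kernel condition: a lift over any type \<open>'m\<close> forces this condition, which in turn
  yields a lift over \<open>int \<Rightarrow> 'a \<Rightarrow> 'x\<close>.\<close>

theorem proposition4p6:
  fixes K :: "('k, 'n) ring_scheme"
    and A :: "('k, 'a, 'p) module_scheme" and gr :: "int \<Rightarrow> 'a set"
    and X :: "('a, 'x, 'q) right_module_scheme" and xgr :: "int \<Rightarrow> 'x set"
    and S U :: "int set"
  assumes "positively_graded_algebra K A gr"
    and "generated_in_degrees_0_1 A gr"
    and "semisimple_ring (A\<lparr>carrier := gr 0\<rparr>)"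
    and "right_modular S U"
    and "graded_right_module (trunc_algebra A gr U) (trunc_grading A gr U) X xgr"
    and "generated_in_degrees (trunc_algebra A gr U) X xgr (colon S U)"
  shows "(liftable TYPE(int \<Rightarrow> 'a \<Rightarrow> 'x) A gr S U X xgr \<longleftrightarrow>
           (\<forall>m\<in>colon S U. \<forall>u\<in>U. \<forall>v\<in>U. 0 \<le> u \<and> u < v \<and> v - u \<notin> U \<longrightarrow>
              Ker_mu_times A gr X xgr m u (v - u) \<subseteq> Ker_mu A gr X xgr m v)) \<and>
         (liftable TYPE('m) A gr S U X xgr \<longrightarrow> liftable TYPE(int \<Rightarrow> 'a \<Rightarrow> 'x) A gr S U X xgr)"
proof -
  interpret A: positively_graded_algebra K A gr by fact
  have "0 \<in> U" using assms(4) by (simp add: right_modular_def ring_supporting_def)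
  then interpret modular_module A gr U X xgr S
    using assms(2,5,6) A.gr_neg
    by (intro modular_module.intro truncated_module.intro truncated_module_axioms.intro
        modular_module_axioms.intro A.A.graded_ring_axioms)
  have "kernel_condition" if "liftable TYPE(int \<Rightarrow> 'a \<Rightarrow> 'x) A gr S U X xgr"
    using that liftable_imp_kernel_condition unfolding liftable_def by blast
  moreover have "kernel_condition" if "liftable TYPE('m) A gr S U X xgr"
    using that liftable_imp_kernel_condition unfolding liftable_def by blast
  ultimately show ?thesis
    using liftable unfolding kernel_condition_iff[symmetric] by blast
qed

end
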